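(* Let $M,N\ge 0$ be integers, not both zero. The supercommutative algebra $\mathrm{gr}\,\mathrm{Y}(\mathfrak{gl}_{M|N})$ is freely generated (as a supercommutative algebra) by the elements $X_{ij}^{(r)}$ of $\mathbb{Z}_2$-degree $\bar\imath+\bar\jmath$, where $r=1,2,\dots$ and $i,j=1,\dots,M+N$.
   Context: All algebras are over $\mathbb{C}$. For $i=1,\dots,M+N$ put $\bar\imath=0$ if $i\le M$ and $\bar\imath=1$ if $i>M$. Square brackets denote the supercommutator $[X,Y]=XY-(-1)^{\deg X\deg Y}YX$. The Yangian $\mathrm{Y}(\mathfrak{gl}_{M|N})$ is the unital associative $\mathbb{Z}_2$-graded algebra with generators $T_{ij}^{(r)}$ ($r\ge 1$, $1\le i,j\le M+N$), $\deg T_{ij}^{(r)}=\bar\imath+\bar\jmath$, and defining relations, for all $i,j,k,l$, $$(u-v)\,[T_{ij}(u),T_{kl}(v)]\,(-1)^{\bar\imath\bar k+\bar\imath\bar l+\bar k\bar l}=T_{kj}(u)T_{il}(v)-T_{kj}(v)T_{il}(u),$$ where $T_{ij}(u)=\delta_{ij}\cdot 1+T_{ij}^{(1)}u^{-1}+T_{ij}^{(2)}u^{-2}+\cdots$ and $u,v$ are formal variables. $\mathrm{gr}\,\mathrm{Y}(\mathfrak{gl}_{M|N})$ is the graded algebra associated with the ascending filtration on $\mathrm{Y}(\mathfrak{gl}_{M|N})$ in which the generator $T_{ij}^{(r)}$ has degree $r$; $X_{ij}^{(r)}$ is the image of $T_{ij}^{(r)}$ in the component of degree $r$. The $\mathbb{Z}_2$-grading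 descends to $\mathrm{gr}\,\mathrm{Y}(\mathfrak{gl}_{M|N})$, with $\deg X_{ij}^{(r)}=\bar\imath+\bar\jmath$. A supercommutative algebra is freely generated by a family of homogeneous elements if it is the tensor product of the polynomial algebra on the members of $\mathbb{Z}_2$-degree $0$ and the exterior algebra on the members of $\mathbb{Z}_2$-degree $1$. *)

theory Defs
  imports Complex_Main "HOL-Library.Multiset" "HOL-Library.Poly_Mapping"
    "HOL-Algebra.QuotRing" "HOL-Algebra.Module"
begin

section \<open>Associative algebras over the complex numbers\<close>

text \<open>
  Algebras are \<^type>\<open>module\<close> records over the complex numbers (the field \<open>smult\<close> is the scalar
  multiplication). The locale \<open>algebra\<close> of HOL-Algebra is restricted to commutative algebras,
  so the noncommutative notion is spelled out here.
\<close>

definition complex_ring :: "complex ring" where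
  "complex_ring = \<lparr>carrier = UNIV, mult = (*), one = 1, zero = 0, add = (+)\<rparr>"

definition assoc_algebra :: "(complex, 'a) module \<Rightarrow> bool" where
  "assoc_algebra A \<longleftrightarrow> ring A \<and> module complex_ring A \<and>
     (\<forall>c. \<forall>x\<in>carrier A. \<forall>y\<in>carrier A.
        (c \<odot>\<^bsub>A\<^esub> x) \<otimes>\<^bsub>A\<^esub> y = c \<odot>\<^bsub>A\<^esub> (x \<otimes>\<^bsub>A\<^esub> y) \<and>
        x \<otimes>\<^bsub>A\<^esub> (c \<odot>\<^bsub>A\<^esub> y) = c \<odot>\<^bsub>A\<^esub> (x \<otimes>\<^bsub>A\<^esub> y))"

definition algebra_iso :: "(complex, 'a) module \<Rightarrow> (complex, 'b) module \<Rightarrow> ('a \<Rightarrow> 'b) set" where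
  "algebra_iso A B =
     {h \<in> ring_iso A B. \<forall>c. \<forall>x\<in>carrier A. h (c \<odot>\<^bsub>A\<^esub> x) = c \<odot>\<^bsub>B\<^esub> h x}"

definition quot_algebra :: "(complex, 'a) module \<Rightarrow> 'a set \<Rightarrow> (complex, 'a set) module" where
  "quot_algebra A I =
     ring.extend (A Quot I) (module.fields (\<lambda>c C. \<Union>x\<in>C. I +>\<^bsub>A\<^esub> (c \<odot>\<^bsub>A\<^esub> x)))"

text \<open>The monoid algebra: formal linear combinations of the elements of a monoid.\<close>

definition monoid_algebra :: "('a, 'm) monoid_scheme \<Rightarrow> (complex, 'a \<Rightarrow>\<^sub>0 complex) module" where
  "monoid_algebra S =
     \<lparr>carrier = {f. Poly_Mapping.keys f \<subseteq> carrier S},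
      mult = (\<lambda>f g. \<Sum>x\<in>Poly_Mapping.keys f. \<Sum>y\<in>Poly_Mapping.keys g.
                Poly_Mapping.single (x \<otimes>\<^bsub>S\<^esub> y) (Poly_Mapping.lookup f x * Poly_Mapping.lookup g y)),
      one = Poly_Mapping.single \<one>\<^bsub>S\<^esub> 1,
      zero = 0,
      add = (+),
      smult = (\<lambda>c. Poly_Mapping.map ((*) c))\<rparr>"

definition free_algebra :: "'g set \<Rightarrow> (complex, 'g list \<Rightarrow>\<^sub>0 complex) module" where
  "free_algebra G = monoid_algebra \<lparr>carrier = lists G, mult = (@), one = []\<rparr>"

definition free_gen :: "'g \<Rightarrow> 'g list \<Rightarrow>\<^sub>0 complex" where
  "free_gen g = Poly_Mapping.single [g] 1"

section \<open>Free supercommutative algebras\<close>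

text \<open>Monomials are finite multisets of variables.\<close>

definition poly_algebra :: "'g set \<Rightarrow> (complex, 'g multiset \<Rightarrow>\<^sub>0 complex) module" where
  "poly_algebra G = monoid_algebra \<lparr>carrier = {m. set_mset m \<subseteq> G}, mult = (+), one = {#}\<rparr>"

definition poly_gen :: "'g \<Rightarrow> 'g multiset \<Rightarrow>\<^sub>0 complex" where
  "poly_gen g = Poly_Mapping.single {#g#} 1"

text \<open>
  The exterior algebra of the vector space \<open>V\<close> with basis \<open>G\<close>: the free algebra on \<open>G\<close> is the tensor
  algebra of \<open>V\<close>, and \<open>V\<close> consists of the combinations of words of length one.
\<close>

definition ext_ideal :: "'g set \<Rightarrow> ('g list \<Rightarrow>\<^sub>0 complex) set" where
  "ext_ideal G = Idl\<^bsub>free_algebra G\<^esub>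
     {v \<otimes>\<^bsub>free_algebra G\<^esub> v | v.
        v \<in> carrier (free_algebra G) \<and> (\<forall>w\<in>Poly_Mapping.keys v. length w = 1)}"

definition ext_algebra :: "'g set \<Rightarrow> (complex, ('g list \<Rightarrow>\<^sub>0 complex) set) module" where
  "ext_algebra G = quot_algebra (free_algebra G) (ext_ideal G)"

definition ext_gen :: "'g set \<Rightarrow> 'g \<Rightarrow> ('g list \<Rightarrow>\<^sub>0 complex) set" where
  "ext_gen G g = ext_ideal G +>\<^bsub>free_algebra G\<^esub> free_gen g"

text \<open>
  The tensor product \<open>A \<otimes> B\<close> over the complex numbers: the free vector space on the pairs \<open>(a, b)\<close>,
  with the product \<open>(a, b) (a', b') = (a a', b b')\<close>, modulo bilinearity. The span of
  the bilinearity relations is closed under multiplication by pairs, hence it is the ideal generated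
  by them.
\<close>

definition bilinear_rels ::
  "(complex, 'a) module \<Rightarrow> (complex, 'b) module \<Rightarrow> ('a \<times> 'b \<Rightarrow>\<^sub>0 complex) set" where
  "bilinear_rels A B =
     {Poly_Mapping.single (a \<oplus>\<^bsub>A\<^esub> a', b) 1 - Poly_Mapping.single (a, b) 1 - Poly_Mapping.single (a', b) 1
       | a a' b. a \<in> carrier A \<and> a' \<in> carrier A \<and> b \<in> carrier B} \<union>
     {Poly_Mapping.single (a, b \<oplus>\<^bsub>B\<^esub> b') 1 - Poly_Mapping.single (a, b) 1 - Poly_Mapping.single (a, b') 1
       | a b b'. a \<in> carrier A \<and> b \<in> carrier B \<and> b' \<in> carrier B} \<union>
     {Poly_Mapping.single (c \<odot>\<^bsub>A\<^esub> a, b) 1 - Poly_Mapping.single (a, b) c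
       | a b c. a \<in> carrier A \<and> b \<in> carrier B} \<union>
     {Poly_Mapping.single (a, c \<odot>\<^bsub>B\<^esub> b) 1 - Poly_Mapping.single (a, b) c
       | a b c. a \<in> carrier A \<and> b \<in> carrier B}"

definition tensor_ideal ::
  "(complex, 'a) module \<Rightarrow> (complex, 'b) module \<Rightarrow> ('a \<times> 'b \<Rightarrow>\<^sub>0 complex) set" where
  "tensor_ideal A B = Idl\<^bsub>monoid_algebra (A \<times>\<times> B)\<^esub> (bilinear_rels A B)"

definition tensor_algebra ::
  "(complex, 'a) module \<Rightarrow> (complex, 'b) module \<Rightarrow> (complex, ('a \<times> 'b \<Rightarrow>\<^sub>0 complex) set) module" where
  "tensor_algebra A B = quot_algebra (monoid_algebra (A \<times>\<times> B)) (tensor_ideal A B)"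

definition pure_tensor ::
  "(complex, 'a) module \<Rightarrow> (complex, 'b) module \<Rightarrow> 'a \<Rightarrow> 'b \<Rightarrow> ('a \<times> 'b \<Rightarrow>\<^sub>0 complex) set" where
  "pure_tensor A B a b =
     tensor_ideal A B +>\<^bsub>monoid_algebra (A \<times>\<times> B)\<^esub> Poly_Mapping.single (a, b) 1"

text \<open>
  \<open>p g\<close>, which is 0 or 1, is the parity of the generator \<open>g\<close>. No signs enter the product of the two
  tensor factors, since the polynomial algebra is purely even.
\<close>

definition free_supercomm ::
  "'g set \<Rightarrow> ('g \<Rightarrow> nat) \<Rightarrow>
     (complex, (('g multiset \<Rightarrow>\<^sub>0 complex) \<times> ('g list \<Rightarrow>\<^sub>0 complex) set \<Rightarrow>\<^sub>0 complex) set) module" where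
  "free_supercomm G p =
     tensor_algebra (poly_algebra {g \<in> G. p g = 0}) (ext_algebra {g \<in> G. p g = 1})"

definition free_supercomm_gen ::
  "'g set \<Rightarrow> ('g \<Rightarrow> nat) \<Rightarrow> 'g \<Rightarrow>
     (('g multiset \<Rightarrow>\<^sub>0 complex) \<times> ('g list \<Rightarrow>\<^sub>0 complex) set \<Rightarrow>\<^sub>0 complex) set" where
  "free_supercomm_gen G p g =
     (let P = poly_algebra {g \<in> G. p g = 0}; L = ext_algebra {g \<in> G. p g = 1} in
      if p g = 0 then pure_tensor P L (poly_gen g) \<one>\<^bsub>L\<^esub>
      else pure_tensor P L \<one>\<^bsub>P\<^esub> (ext_gen {g \<in> G. p g = 1} g))"

text \<open>
  The homogeneous components of a \<open>\<int>\<^sub>2\<close>-grading are \<open>P 0\<close> and \<open>P 1\<close>; the values of \<open>P\<close> at other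
  arguments are irrelevant.
\<close>

definition supercommutative_algebra :: "(complex, 'a) module \<Rightarrow> (nat \<Rightarrow> 'a set) \<Rightarrow> bool" where
  "supercommutative_algebra A P \<longleftrightarrow> assoc_algebra A \<and>
     (\<forall>e<2. submodule (P e) complex_ring A) \<and>
     (\<forall>x\<in>carrier A. \<exists>!(y, z). y \<in> P 0 \<and> z \<in> P 1 \<and> x = y \<oplus>\<^bsub>A\<^esub> z) \<and>
     (\<forall>e<2. \<forall>f<2. \<forall>x\<in>P e. \<forall>y\<in>P f.
        x \<otimes>\<^bsub>A\<^esub> y \<in> P ((e + f) mod 2) \<and>
        x \<otimes>\<^bsub>A\<^esub> y = ((-1) ^ (e * f)) \<odot>\<^bsub>A\<^esub> (y \<otimes>\<^bsub>A\<^esub> x))"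

text \<open>
  The family \<open>(x g)\<close>, indexed by \<open>g \<in> G\<close> and homogeneous of parities \<open>p g\<close>, freely generates \<open>A\<close>.
  The isomorphism preserves parity automatically, since it does so on the generators.
\<close>

definition freely_generated_supercomm ::
  "(complex, 'a) module \<Rightarrow> (nat \<Rightarrow> 'a set) \<Rightarrow> 'g set \<Rightarrow> ('g \<Rightarrow> nat) \<Rightarrow> ('g \<Rightarrow> 'a) \<Rightarrow> bool" where
  "freely_generated_supercomm A P G p x \<longleftrightarrow>
     supercommutative_algebra A P \<and>
     (\<forall>g\<in>G. p g < 2 \<and> x g \<in> P (p g)) \<and>
     (\<exists>h\<in>algebra_iso (free_supercomm G p) A. \<forall>g\<in>G. h (free_supercomm_gen G p g) = x g)"

section \<open>The graded algebra of a filtered algebra\<close>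

text \<open>For an ascending filtration \<open>F 0 \<subseteq> F 1 \<subseteq> \<dots>\<close>, the subspace preceding \<open>F d\<close>, which is zero
  for \<open>d = 0\<close>.\<close>

definition filt_below :: "(complex, 'a) module \<Rightarrow> (nat \<Rightarrow> 'a set) \<Rightarrow> nat \<Rightarrow> 'a set" where
  "filt_below A F d = (if d = 0 then {\<zero>\<^bsub>A\<^esub>} else F (d - 1))"

text \<open>The image of an element \<open>x \<in> F r\<close> in the component of degree \<open>r\<close>.\<close>

definition gr_symbol :: "(complex, 'a) module \<Rightarrow> (nat \<Rightarrow> 'a set) \<Rightarrow> nat \<Rightarrow> 'a \<Rightarrow> nat \<Rightarrow> 'a set" where
  "gr_symbol A F r x = (\<lambda>d. if d = r then filt_below A F r +>\<^bsub>A\<^esub> x else filt_below A F d)"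

text \<open>
  An element of the direct sum of the quotients \<open>F d / F (d - 1)\<close> is a sequence of cosets, almost
  all of them trivial. The product has components \<open>(a b)\<^sub>d = \<Sum>\<^sub>p a\<^sub>p b\<^sub>d\<^sub>-\<^sub>p\<close>, computed on
  arbitrary representatives \<open>x p \<in> a p\<close>, \<open>y q \<in> b q\<close>.
\<close>

definition gr_algebra ::
  "(complex, 'a) module \<Rightarrow> (nat \<Rightarrow> 'a set) \<Rightarrow> (complex, nat \<Rightarrow> 'a set) module" where
  "gr_algebra A F =
     \<lparr>carrier = {a. (\<forall>d. \<exists>x\<in>F d. a d = filt_below A F d +>\<^bsub>A\<^esub> x) \<and> finite {d. a d \<noteq> filt_below A F d}},
      mult = (\<lambda>a b d. \<Union>{filt_below A F d +>\<^bsub>A\<^esub> (\<Oplus>\<^bsub>A\<^esub>p\<in>{..d}. x p \<otimes>\<^bsub>A\<^esub> y (d - p)) | x y.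
                (\<forall>p. x p \<in> a p) \<and> (\<forall>q. y q \<in> b q)}),
      one = gr_symbol A F 0 \<one>\<^bsub>A\<^esub>,
      zero = filt_below A F,
      add = (\<lambda>a b d. a d <+>\<^bsub>A\<^esub> b d),
      smult = (\<lambda>c a d. \<Union>x\<in>a d. filt_below A F d +>\<^bsub>A\<^esub> (c \<odot>\<^bsub>A\<^esub> x))\<rparr>"

text \<open>The \<open>\<int>\<^sub>2\<close>-grading of the graded algebra induced by a \<open>\<int>\<^sub>2\<close>-grading \<open>P\<close> of \<open>A\<close>.\<close>

definition gr_parity ::
  "(complex, 'a) module \<Rightarrow> (nat \<Rightarrow> 'a set) \<Rightarrow> (nat \<Rightarrow> 'a set) \<Rightarrow> nat \<Rightarrow> (nat \<Rightarrow> 'a set) set" where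
  "gr_parity A F P e =
     {a \<in> carrier (gr_algebra A F). \<forall>d. \<exists>x\<in>F d \<inter> P e. a d = filt_below A F d +>\<^bsub>A\<^esub> x}"

section \<open>The Yangian of the general linear Lie superalgebra\<close>

definition ipar :: "nat \<Rightarrow> nat \<Rightarrow> nat" where
  "ipar M i = (if i \<le> M then 0 else 1)"

text \<open>\<open>(i, j, r)\<close> stands for the generator \<open>T\<^sub>i\<^sub>j\<close> with upper index \<open>r\<close>.\<close>

type_synonym ygen = "nat \<times> nat \<times> nat"

definition ygens :: "nat \<Rightarrow> nat \<Rightarrow> ygen set" where
  "ygens M N = {(i, j, r). i \<in> {1..M + N} \<and> j \<in> {1..M + N} \<and> 1 \<le> r}"

definition gen_parity :: "nat \<Rightarrow> ygen \<Rightarrow> nat" where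
  "gen_parity M = (\<lambda>(i, j, r). (ipar M i + ipar M j) mod 2)"

text \<open>The coefficient at \<open>u\<^sup>-\<^sup>r\<close> of the series \<open>T\<^sub>i\<^sub>j(u)\<close>, for an arbitrary integer \<open>r\<close>.\<close>

definition T_coeff :: "nat \<Rightarrow> nat \<Rightarrow> int \<Rightarrow> ygen list \<Rightarrow>\<^sub>0 complex" where
  "T_coeff i j r =
     (if r < 0 then 0
      else if r = 0 then (if i = j then Poly_Mapping.single [] 1 else 0)
      else free_gen (i, j, nat r))"

text \<open>The coefficient at \<open>u\<^sup>-\<^sup>r v\<^sup>-\<^sup>s\<close> of the supercommutator \<open>[T\<^sub>i\<^sub>j(u), T\<^sub>k\<^sub>l(v)]\<close>.\<close>

definition T_supercomm ::
  "nat \<Rightarrow> nat \<Rightarrow> nat \<Rightarrow> nat \<Rightarrow> nat \<Rightarrow> nat \<Rightarrow> int \<Rightarrow> int \<Rightarrow> ygen list \<Rightarrow>\<^sub>0 complex" where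
  "T_supercomm M N i j k l r s =
     (let A = free_algebra (ygens M N) in
      T_coeff i j r \<otimes>\<^bsub>A\<^esub> T_coeff k l s -
      ((-1) ^ ((ipar M i + ipar M j) * (ipar M k + ipar M l))) \<odot>\<^bsub>A\<^esub> (T_coeff k l s \<otimes>\<^bsub>A\<^esub> T_coeff i j r))"

text \<open>
  Difference of the coefficients at \<open>u\<^sup>-\<^sup>r v\<^sup>-\<^sup>s\<close> of the two sides of the defining relation. The
  factor \<open>u - v\<close> makes the coefficients at \<open>u\<^sup>-\<^sup>r\<^sup>-\<^sup>1 v\<^sup>-\<^sup>s\<close> and \<open>u\<^sup>-\<^sup>r v\<^sup>-\<^sup>s\<^sup>-\<^sup>1\<close> of the
  supercommutator contribute.
\<close>

definition yangian_rel ::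
  "nat \<Rightarrow> nat \<Rightarrow> nat \<Rightarrow> nat \<Rightarrow> nat \<Rightarrow> nat \<Rightarrow> int \<Rightarrow> int \<Rightarrow> ygen list \<Rightarrow>\<^sub>0 complex" where
  "yangian_rel M N i j k l r s =
     (let A = free_algebra (ygens M N) in
      ((-1) ^ (ipar M i * ipar M k + ipar M i * ipar M l + ipar M k * ipar M l)) \<odot>\<^bsub>A\<^esub>
        (T_supercomm M N i j k l (r + 1) s - T_supercomm M N i j k l r (s + 1)) -
      (T_coeff k j r \<otimes>\<^bsub>A\<^esub> T_coeff i l s - T_coeff k j s \<otimes>\<^bsub>A\<^esub> T_coeff i l r))"

definition yangian_ideal :: "nat \<Rightarrow> nat \<Rightarrow> (ygen list \<Rightarrow>\<^sub>0 complex) set" where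
  "yangian_ideal M N = Idl\<^bsub>free_algebra (ygens M N)\<^esub>
     {yangian_rel M N i j k l r s | i j k l r s.
        i \<in> {1..M + N} \<and> j \<in> {1..M + N} \<and> k \<in> {1..M + N} \<and> l \<in> {1..M + N}}"

definition yangian :: "nat \<Rightarrow> nat \<Rightarrow> (complex, (ygen list \<Rightarrow>\<^sub>0 complex) set) module" where
  "yangian M N = quot_algebra (free_algebra (ygens M N)) (yangian_ideal M N)"

definition yangian_proj ::
  "nat \<Rightarrow> nat \<Rightarrow> (ygen list \<Rightarrow>\<^sub>0 complex) \<Rightarrow> (ygen list \<Rightarrow>\<^sub>0 complex) set" where
  "yangian_proj M N f = yangian_ideal M N +>\<^bsub>free_algebra (ygens M N)\<^esub> f"

text \<open>The span of the monomials in the generators of total degree at most \<open>d\<close>.\<close>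

definition yangian_filt :: "nat \<Rightarrow> nat \<Rightarrow> nat \<Rightarrow> (ygen list \<Rightarrow>\<^sub>0 complex) set set" where
  "yangian_filt M N d = yangian_proj M N `
     {f \<in> carrier (free_algebra (ygens M N)).
        \<forall>w\<in>Poly_Mapping.keys f. (\<Sum>(i, j, r)\<leftarrow>w. r) \<le> d}"

definition yangian_parity :: "nat \<Rightarrow> nat \<Rightarrow> nat \<Rightarrow> (ygen list \<Rightarrow>\<^sub>0 complex) set set" where
  "yangian_parity M N e = yangian_proj M N `
     {f \<in> carrier (free_algebra (ygens M N)).
        \<forall>w\<in>Poly_Mapping.keys f. (\<Sum>g\<leftarrow>w. gen_parity M g) mod 2 = e}"

definition gr_yangian :: "nat \<Rightarrow> nat \<Rightarrow> (complex, nat \<Rightarrow> (ygen list \<Rightarrow>\<^sub>0 complex) set set) module" where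
  "gr_yangian M N = gr_algebra (yangian M N) (yangian_filt M N)"

definition gr_yangian_parity ::
  "nat \<Rightarrow> nat \<Rightarrow> nat \<Rightarrow> (nat \<Rightarrow> (ygen list \<Rightarrow>\<^sub>0 complex) set set) set" where
  "gr_yangian_parity M N = gr_parity (yangian M N) (yangian_filt M N) (yangian_parity M N)"

definition X_gen :: "nat \<Rightarrow> nat \<Rightarrow> ygen \<Rightarrow> nat \<Rightarrow> (ygen list \<Rightarrow>\<^sub>0 complex) set set" where
  "X_gen M N = (\<lambda>(i, j, r).
     gr_symbol (yangian M N) (yangian_filt M N) r (yangian_proj M N (free_gen (i, j, r))))"

end

theory Submission
  imports Defs "HOL-Computational_Algebra.Formal_Power_Series" "HOL-Library.Product_Lexorder"
begin

text \<open>
  The graded algebra is supercommutative because the defining relation gives, by induction on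
  \<open>r\<close>, that the supercommutator of \<open>T\<^sub>i\<^sub>j\<^sup>(\<^sup>r\<^sup>)\<close> and \<open>T\<^sub>k\<^sub>l\<^sup>(\<^sup>s\<^sup>)\<close> has degree less than \<open>r + s\<close>. Hence it is
  the image of the free supercommutative algebra, which is spanned by the normal words: a sorted word
  in the even generators followed by a strictly sorted word in the odd ones. It remains to
  see that the normal words are linearly independent in the Yangian.

  Let \<open>B\<close> be the algebra with basis \<open>1\<close> and the symbols \<open>E\<^sub>i\<^sub>j z\<^sup>r\<^sup>-\<^sup>1\<close> (matrix units times powers of \<open>z\<close>),
  one for every generator. The evaluation \<open>T\<^sub>i\<^sub>j\<^sup>(\<^sup>r\<^sup>) \<mapsto> \<plusminus>E\<^sub>i\<^sub>j z\<^sup>r\<^sup>-\<^sup>1\<close> and the coproduct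
  \<open>T\<^sub>i\<^sub>j(u) \<mapsto> \<Sum>\<^sub>a \<plusminus>T\<^sub>i\<^sub>a(u) \<otimes> T\<^sub>a\<^sub>j(u)\<close> make every tensor power of \<open>B\<close> a module. Up to terms of smaller degree
  in \<open>z\<close> a generator acts on the \<open>m\<close>-th power as the sum over the \<open>m\<close> tensor sites of its images. Choose,
  among the words of a linear combination, first those of maximal degree in \<open>z\<close> and then one of maximal
  length \<open>m\<close>, say \<open>g\<^sub>1 \<dots> g\<^sub>m\<close>; the coefficient of \<open>g\<^sub>1 \<otimes> \<dots> \<otimes> g\<^sub>m\<close> in its action on \<open>1 \<otimes> \<dots> \<otimes> 1\<close> is a
  positive integer, and no other word of the combination contributes to it.
\<close>

section \<open>Products of families satisfying the defining relations\<close>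

text \<open>The unit of \<open>B\<close> is adjoined; it is not the sum of the \<open>E_ii\<close>.

  Two kinds of unwanted terms arise when a word acts on the tensor power of 1. In the coproduct, a
  term with \<open>q\<close> and \<open>r - q\<close> both positive has z-degree
  \<open>(q - 1) + (r - q - 1) = r - 2\<close>, one less than a term in which one site takes the
  whole index; maximal z-degree removes these. Letters that meet at one site multiply without loss
  of z-degree, but then too few sites are occupied; maximal length removes these. This is why
  z-degree is maximised before length, and why a generator counts \<open>r - 1\<close> and not
  \<open>r\<close>.

  No tensor product of superalgebras is formed: its factors are replaced by families of operators in
  one ring that supercommute with each other.

  Independence in the Yangian passes to the graded algebra because rewriting in normal words does
  not raise the degree: a homogeneous normal combination with vanishing symbol is congruent to a
  normal one of smaller degree, and by independence the two are equal.\<close>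

definition coprod_family ::
  "(nat \<Rightarrow> nat) \<Rightarrow> nat set \<Rightarrow> (nat \<Rightarrow> nat \<Rightarrow> 'r::ring_1) \<Rightarrow> (nat \<Rightarrow> nat \<Rightarrow> 'r) \<Rightarrow> nat \<Rightarrow> nat \<Rightarrow> 'r" where
  "coprod_family p I A C i j = (\<Sum>a\<in>I. (-1) ^ ((p i + p a) * (p a + p j)) * (A i a * C a j))"

text \<open>For \<open>A = T(u)\<close> and \<open>B = T(v)\<close> this is the defining relation,
  with \<open>z\<close> in the place of \<open>u - v\<close> and \<open>c\<close> in the place of 1.
  Both are kept abstract, because the relation has to be multiplied by a common factor before it
  becomes one between power series.\<close>

definition rtt_rel ::
  "(nat \<Rightarrow> nat) \<Rightarrow> nat set \<Rightarrow> 'r::ring_1 \<Rightarrow> 'r \<Rightarrow> (nat \<Rightarrow> nat \<Rightarrow> 'r) \<Rightarrow> (nat \<Rightarrow> nat \<Rightarrow> 'r) \<Rightarrow> bool" where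
  "rtt_rel p I z c A B \<longleftrightarrow> (\<forall>i\<in>I. \<forall>j\<in>I. \<forall>k\<in>I. \<forall>l\<in>I.
     (-1) ^ (p i * p k + p i * p l + p k * p l) *
       (z * (A i j * B k l - (-1) ^ ((p i + p j) * (p k + p l)) * (B k l * A i j))) =
     c * (A k j * B i l - B k j * A i l))"

lemma diff_swap: "a - b = c - d \<Longrightarrow> a - c = b - (d :: 'a::ab_group_add)"
  by (simp add: algebra_simps)

lemma coprod_family_mult:
  "coprod_family p I A C i j * coprod_family p I B D k l =
    (\<Sum>a\<in>I. \<Sum>b\<in>I. (-1) ^ ((p i + p a) * (p a + p j)) * (A i a * C a j) *
       ((-1) ^ ((p k + p b) * (p b + p l)) * (B k b * D b l)))"
  by (simp add: coprod_family_def sum_product)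

text \<open>
  One collects the products \<open>A B\<close> on one side of the relation and the products \<open>B A\<close> on the other, and
  uses it in this form first for \<open>A, B\<close> and then for \<open>C, D\<close>; the two pairs supercommute.
\<close>

lemma rtt_rel_coprod:
  fixes A B C D :: "nat \<Rightarrow> nat \<Rightarrow> 'r::ring_1"
  assumes p: "\<And>i. p i = 0 \<or> p i = 1"
    and zc: "\<And>t. z * t = t * z" "\<And>t. c * t = t * c"
    and AB: "rtt_rel p I z c A B" and CD: "rtt_rel p I z c C D"
    and CB: "\<And>a j k b. C a j * B k b = (-1) ^ ((p a + p j) * (p k + p b)) * (B k b * C a j)"
    and DA: "\<And>a j k b. D a j * A k b = (-1) ^ ((p a + p j) * (p k + p b)) * (A k b * D a j)"
    and CA: "\<And>a j k b. C a j * A k b = (-1) ^ ((p a + p j) * (p k + p b)) * (A k b * C a j)"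
    and DB: "\<And>a j k b. D a j * B k b = (-1) ^ ((p a + p j) * (p k + p b)) * (B k b * D a j)"
  shows "rtt_rel p I z c (coprod_family p I A C) (coprod_family p I B D)"
  unfolding rtt_rel_def
proof (intro ballI)
  fix i j k l assume ijkl: "i \<in> I" "j \<in> I" "k \<in> I" "l \<in> I"
  define s :: "nat \<Rightarrow> nat \<Rightarrow> nat \<Rightarrow> 'r" where "s = (\<lambda>i a j. (-1) ^ ((p i + p a) * (p a + p j)))"
  define e :: "nat \<Rightarrow> nat \<Rightarrow> nat \<Rightarrow> 'r" where "e = (\<lambda>i k l. (-1) ^ (p i * p k + p i * p l + p k * p l))"
  define t :: "nat \<Rightarrow> nat \<Rightarrow> nat \<Rightarrow> nat \<Rightarrow> 'r" where "t = (\<lambda>i j k l. (-1) ^ ((p i + p j) * (p k + p l)))"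
  \<comment> \<open>The total sign of the \<open>c\<close>-term after \<open>C a j\<close> has been
    moved past \<open>B i b\<close>. Taken out as a common factor, it leaves the relation for
    \<open>A\<close>, \<open>B\<close> with indices \<open>i a k b\<close>, multiplied from the
    right by \<open>C a j * D b l\<close>.\<close>
  define n :: "nat \<Rightarrow> nat \<Rightarrow> 'r" where "n = (\<lambda>a b. s k a j * s i b l * t a j i b)"
  have zz: "t' * (z * u) = z * (t' * u)" "t' * (c * u) = c * (t' * u)" for t' u
    using zc(1)[of t'] zc(2)[of t'] by (simp_all add: mult.assoc[symmetric])
  have zz2: "A i j * (z * u) = z * (A i j * u)" "B i j * (z * u) = z * (B i j * u)" 
     "A i j * (c * u) = c * (A i j * u)" "B i j * (c * u) = c * (B i j * u)" for i j u
    by (rule zz)+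
  have X: "C a j * (B k b * u) = t a j k b * (B k b * (C a j * u))"
    "C a j * (A k b * u) = t a j k b * (A k b * (C a j * u))"
    "D a j * (A k b * u) = t a j k b * (A k b * (D a j * u))"
    "D a j * (B k b * u) = t a j k b * (B k b * (D a j * u))" for a j k b u
    unfolding t_def
    using CB[of a j k b] CA[of a j k b] DA[of a j k b] DB[of a j k b] by (simp_all add: mult.assoc[symmetric])
  have pp: "p m = 0 \<or> p m = Suc 0" for m
    using p by auto
  \<comment> \<open>\<open>LT\<close>, \<open>RT\<close> and \<open>SW\<close> are identities of
    signs. They involve only the parities of the six indices, so all 64 cases are evaluated.\<close>
  have LT: "e i k l * (z * (s i a j * (A i a * C a j) * (s k b l * (B k b * D b l)))) -
      c * (s k a j * (A k a * C a j) * (s i b l * (B i b * D b l))) =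
      n a b * ((z * (e i k b * (A i a * B k b)) - c * (A k a * B i b)) * (C a j * D b l))" for a b
    using pp[of i] pp[of j] pp[of k] pp[of l] pp[of a] pp[of b] 
    by (elim disjE) (simp_all add: n_def s_def e_def t_def X mult.assoc algebra_simps)
  have RT: "e i k l * (z * (t i j k l * (s k b l * (B k b * D b l) * (s i a j * (A i a * C a j))))) -
      c * (s k b j * (B k b * D b j) * (s i a l * (A i a * C a l))) =
      n a b * (e i k b * (t i a k b * (e a b l * ((B k b * A i a) *
         (z * (e a b l * (t a j b l * (D b l * C a j))) - c * (D b j * C a l))))))" for a b
    using pp[of i] pp[of j] pp[of k] pp[of l] pp[of a] pp[of b] 
    by (elim disjE) (simp_all add: n_def s_def e_def t_def X zz2 mult.assoc algebra_simps)
  have signs: "e i k l = 1 \<or> e i k l = -1" "t i j k l = 1 \<or> t i j k l = -1" for i j k l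
    unfolding e_def t_def by (auto simp: minus_one_power_iff)
  have SW: "n b a = n a b * (e i k b * (t i a k b * e a b l))" for a b
    using pp[of i] pp[of j] pp[of k] pp[of l] pp[of a] pp[of b]
    by (elim disjE) (simp_all add: n_def s_def e_def t_def)
  have R: "z * (e i k l * (A i j * B k l)) - c * (A k j * B i l) =
      z * (e i k l * (t i j k l * (B k l * A i j))) - c * (B k j * A i l)"
    if "i \<in> I" "j \<in> I" "k \<in> I" "l \<in> I" and AB: "rtt_rel p I z c A B" for i j k l and A B :: "nat \<Rightarrow> nat \<Rightarrow> 'r"
  proof -
    have "e i k l * (z * (A i j * B k l - t i j k l * (B k l * A i j))) = c * (A k j * B i l - B k j * A i l)"
      using AB[unfolded rtt_rel_def, rule_format, OF that(1-4)] unfolding e_def t_def .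
    then have "e i k l * (z * (A i j * B k l)) - c * (A k j * B i l) =
      e i k l * (z * (t i j k l * (B k l * A i j))) - c * (B k j * A i l)"
      unfolding right_diff_distrib by (rule diff_swap)
    then show ?thesis
      by (simp only: zz(1)[of "e i k l"])
  qed
  note ABr = R[OF _ _ _ _ AB] and CDr = R[OF _ _ _ _ CD]
  let ?X = "coprod_family p I A C" and ?Y = "coprod_family p I B D"
  have "e i k l * (z * (?X i j * ?Y k l)) - c * (?X k j * ?Y i l) = (\<Sum>a\<in>I. \<Sum>b\<in>I.
      e i k l * (z * (s i a j * (A i a * C a j) * (s k b l * (B k b * D b l)))) -
      c * (s k a j * (A k a * C a j) * (s i b l * (B i b * D b l))))"
    unfolding coprod_family_mult s_def by (simp add: sum_distrib_left sum_subtractf)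
  also have "\<dots> = (\<Sum>a\<in>I. \<Sum>b\<in>I. n a b *
      ((z * (e i k b * (t i a k b * (B k b * A i a))) - c * (B k a * A i b)) * (C a j * D b l)))"
    unfolding LT using ijkl by (intro sum.cong refl) (simp add: ABr)
  also have "\<dots> = (\<Sum>a\<in>I. \<Sum>b\<in>I. n a b *
      (z * (e i k b * (t i a k b * (B k b * A i a))) * (C a j * D b l))) -
      (\<Sum>a\<in>I. \<Sum>b\<in>I. n a b * (c * (B k a * A i b) * (C a j * D b l)))"
    by (simp add: sum_subtractf[symmetric] algebra_simps)
  \<comment> \<open>After \<open>a\<close> and \<open>b\<close> are exchanged in the
    \<open>c\<close>-term, both terms begin with \<open>B k b * A i a\<close>. By \<open>SW\<close>
    the signs then agree with those of the relation for \<open>C\<close>, \<open>D\<close> with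
    indices \<open>a j b l\<close>, which applies to the remaining factors.\<close>
  also have "(\<Sum>a\<in>I. \<Sum>b\<in>I. n a b * (c * (B k a * A i b) * (C a j * D b l))) =
      (\<Sum>a\<in>I. \<Sum>b\<in>I. n b a * (c * (B k b * A i a) * (C b j * D a l)))"
    by (rule sum.swap)
  also have "(\<Sum>a\<in>I. \<Sum>b\<in>I. n a b *
      (z * (e i k b * (t i a k b * (B k b * A i a))) * (C a j * D b l))) - \<dots> =
      (\<Sum>a\<in>I. \<Sum>b\<in>I. n a b * (e i k b * (t i a k b * (e a b l * ((B k b * A i a) *
         (z * (e a b l * (C a j * D b l)) - c * (C b j * D a l)))))))"
  proof -
    have "n a b * (z * (e i k b * (t i a k b * (B k b * A i a))) * (C a j * D b l)) -
        n b a * (c * (B k b * A i a) * (C b j * D a l)) =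
      n a b * (e i k b * (t i a k b * (e a b l * ((B k b * A i a) *
         (z * (e a b l * (C a j * D b l)) - c * (C b j * D a l))))))" for a b
      unfolding SW[of b a] using signs(1)[of i k b] signs(2)[of i a k b] signs(1)[of a b l]
      by (elim disjE) (simp_all add: zz2 algebra_simps)
    then show ?thesis by (simp add: sum_subtractf[symmetric])
  qed
  also have "\<dots> = (\<Sum>a\<in>I. \<Sum>b\<in>I. n a b * (e i k b * (t i a k b * (e a b l * ((B k b * A i a) *
         (z * (e a b l * (t a j b l * (D b l * C a j))) - c * (D b j * C a l)))))))"
    using ijkl by (intro sum.cong refl) (simp add: CDr)
  also have "\<dots> = e i k l * (z * (t i j k l * (\<Sum>a\<in>I. \<Sum>b\<in>I. s k b l * (B k b * D b l) * (s i a j * (A i a * C a j))))) -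
      c * (\<Sum>a\<in>I. \<Sum>b\<in>I. s k b j * (B k b * D b j) * (s i a l * (A i a * C a l)))"
    unfolding RT[symmetric] by (simp add: sum_distrib_left sum_subtractf)
  also have "\<dots> = e i k l * (z * (t i j k l * (?Y k l * ?X i j))) - c * (?Y k j * ?X i l)"
  proof -
    have "?Y k l * ?X i j = (\<Sum>a\<in>I. \<Sum>b\<in>I. s k b l * (B k b * D b l) * (s i a j * (A i a * C a j)))"
      "?Y k j * ?X i l = (\<Sum>a\<in>I. \<Sum>b\<in>I. s k b j * (B k b * D b j) * (s i a l * (A i a * C a l)))"
      unfolding coprod_family_mult s_def by (rule sum.swap)+
    then show ?thesis by simp
  qed
  finally have fin: "e i k l * (z * (?X i j * ?Y k l)) - c * (?X k j * ?Y i l) =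
      e i k l * (z * (t i j k l * (?Y k l * ?X i j))) - c * (?Y k j * ?X i l)" .
  have "e i k l * (z * (?X i j * ?Y k l - t i j k l * (?Y k l * ?X i j))) =
     c * (?X k j * ?Y i l - ?Y k j * ?X i l)"
    unfolding right_diff_distrib using fin by (rule diff_swap)
  then show "(-1) ^ (p i * p k + p i * p l + p k * p l) *
       (z * (?X i j * ?Y k l - (-1) ^ ((p i + p j) * (p k + p l)) * (?Y k l * ?X i j))) =
     c * (?X k j * ?Y i l - ?Y k j * ?X i l)"
    unfolding e_def t_def .
qed

section \<open>Coefficients of the relation and generating series in two variables\<close>

definition comm_coeff :: "(nat \<Rightarrow> nat) \<Rightarrow> (nat \<Rightarrow> nat \<Rightarrow> nat \<Rightarrow> 'r::ring_1) \<Rightarrow>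
    nat \<Rightarrow> nat \<Rightarrow> nat \<Rightarrow> nat \<Rightarrow> nat \<Rightarrow> nat \<Rightarrow> 'r" where
  "comm_coeff p T i j k l r s =
     T i j r * T k l s - (-1) ^ ((p i + p j) * (p k + p l)) * (T k l s * T i j r)"

text \<open>The coefficient of index 0 belongs to the family and is the Kronecker delta. The
  exponents \<open>r\<close>, \<open>s\<close> are natural numbers here; the relations of
  \<open>yangian_rel\<close> with a negative exponent are dealt with in
  \<open>yangian_rep_rel\<close>.\<close>

definition yangian_family :: "(nat \<Rightarrow> nat) \<Rightarrow> nat set \<Rightarrow> (nat \<Rightarrow> nat \<Rightarrow> nat \<Rightarrow> 'r::ring_1) \<Rightarrow> bool" where
  "yangian_family p I T \<longleftrightarrow>
     (\<forall>i\<in>I. \<forall>j\<in>I. T i j 0 = (if i = j then 1 else 0)) \<and>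
     (\<forall>i\<in>I. \<forall>j\<in>I. \<forall>k\<in>I. \<forall>l\<in>I. \<forall>r s.
        (-1) ^ (p i * p k + p i * p l + p k * p l) *
          (comm_coeff p T i j k l (Suc r) s - comm_coeff p T i j k l r (Suc s)) =
        T k j r * T i l s - T k j s * T i l r)"

text \<open>Two commuting variables are modelled by series over series: the outer variable is the
  inverse of \<open>u\<close>, the inner one the inverse of \<open>v\<close>. A series in
  \<open>u\<close> alone has constant coefficients, and a series in \<open>v\<close> alone is a
  constant.\<close>

definition ser_u :: "(nat \<Rightarrow> nat \<Rightarrow> nat \<Rightarrow> 'r::ring_1) \<Rightarrow> nat \<Rightarrow> nat \<Rightarrow> 'r fps fps" where
  "ser_u T i j = Abs_fps (\<lambda>r. fps_const (T i j r))"

definition ser_v :: "(nat \<Rightarrow> nat \<Rightarrow> nat \<Rightarrow> 'r::ring_1) \<Rightarrow> nat \<Rightarrow> nat \<Rightarrow> 'r fps fps" where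
  "ser_v T i j = fps_const (Abs_fps (T i j))"

lemma fps_nth_ser_mult:
  "fps_nth (fps_nth (ser_u S i j * ser_v T k l) r) s = S i j r * T k l s"
  "fps_nth (fps_nth (ser_v T k l * ser_u S i j) r) s = T k l s * S i j r"
  by (simp_all add: ser_u_def ser_v_def)

lemma fps_nth_minus_one_power:
  fixes f :: "'r::ring_1 fps fps"
  shows "fps_nth (fps_nth ((-1) ^ n * f) r) s = (-1) ^ n * fps_nth (fps_nth f r) s"
  by (simp add: minus_one_power_iff)

lemma fps_nth_shift:
  fixes f :: "'r::ring_1 fps fps"
  shows "fps_nth (fps_nth ((fps_const fps_X - fps_X) * f) r) s =
    (if s = 0 then 0 else fps_nth (fps_nth f r) (s - 1)) - (if r = 0 then 0 else fps_nth (fps_nth f (r - 1)) s)"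
  "fps_nth (fps_nth (fps_const fps_X * fps_X * f) r) s =
    (if s = 0 \<or> r = 0 then 0 else fps_nth (fps_nth f (r - 1)) (s - 1))"
  by (simp_all add: algebra_simps mult.assoc)

lemma comm_coeff_0:
  assumes "\<And>i j. i \<in> I \<Longrightarrow> j \<in> I \<Longrightarrow> T i j 0 = (if i = j then 1 else 0)"
    and "i \<in> I" "j \<in> I" "k \<in> I" "l \<in> I"
  shows "comm_coeff p T i j k l 0 s = 0" "comm_coeff p T i j k l r 0 = 0"
proof -
  have ev: "even (p a + p a)" for a by simp
  show "comm_coeff p T i j k l 0 s = 0" "comm_coeff p T i j k l r 0 = 0"
    using assms ev[of i] ev[of k] unfolding comm_coeff_def by (auto simp: minus_one_power_iff)
qed

text \<open>Multiplication of the defining relation by the inverse of \<open>u v\<close> turns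
  \<open>u - v\<close> into the difference of the inner and the outer variable, and turns 1 into
  their product. The coefficients with \<open>r = 0\<close> or \<open>s = 0\<close> vanish on both
  sides, since the coefficient of index 0 is a scalar; the others are the required relations,
  shifted by one in both exponents.\<close>

lemma yangian_family_iff_rtt_rel:
  fixes T :: "nat \<Rightarrow> nat \<Rightarrow> nat \<Rightarrow> 'r::ring_1"
  assumes T0: "\<And>i j. i \<in> I \<Longrightarrow> j \<in> I \<Longrightarrow> T i j 0 = (if i = j then 1 else 0)"
  shows "yangian_family p I T \<longleftrightarrow>
    rtt_rel p I (fps_const fps_X - fps_X) (fps_const fps_X * fps_X) (ser_u T) (ser_v T)"
proof -
  have C: "fps_nth (fps_nth (ser_u T i j * ser_v T k l -
      (-1) ^ ((p i + p j) * (p k + p l)) * (ser_v T k l * ser_u T i j)) r) s = comm_coeff p T i j k l r s"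
    for i j k l r s
    by (simp add: fps_nth_ser_mult fps_nth_minus_one_power comm_coeff_def)
  have "(-1) ^ (p i * p k + p i * p l + p k * p l) *
       ((fps_const fps_X - fps_X) * (ser_u T i j * ser_v T k l -
          (-1) ^ ((p i + p j) * (p k + p l)) * (ser_v T k l * ser_u T i j))) =
     fps_const fps_X * fps_X * (ser_u T k j * ser_v T i l - ser_v T k j * ser_u T i l) \<longleftrightarrow>
     (\<forall>r s. (-1) ^ (p i * p k + p i * p l + p k * p l) *
          (comm_coeff p T i j k l (Suc r) s - comm_coeff p T i j k l r (Suc s)) =
        T k j r * T i l s - T k j s * T i l r)" (is "?L = ?R \<longleftrightarrow> (\<forall>r s. ?P r s)")
    if I: "i \<in> I" "j \<in> I" "k \<in> I" "l \<in> I" for i j k l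
  proof -
    note c0 = comm_coeff_0[of I T, OF T0 I, of p]
    let ?e = "(-1) ^ (p i * p k + p i * p l + p k * p l) :: 'r"
    have nL: "fps_nth (fps_nth ?L r) s = ?e * ((if s = 0 then 0 else comm_coeff p T i j k l r (s - 1)) -
        (if r = 0 then 0 else comm_coeff p T i j k l (r - 1) s))" for r s
      by (simp only: fps_nth_minus_one_power fps_nth_shift C)
    have nR: "fps_nth (fps_nth ?R r) s =
        (if s = 0 \<or> r = 0 then 0 else T k j (r - 1) * T i l (s - 1) - T k j (s - 1) * T i l (r - 1))" for r s
      by (simp only: fps_nth_shift fps_sub_nth fps_nth_ser_mult)
    have "?L = ?R \<longleftrightarrow> (\<forall>r s. fps_nth (fps_nth ?L r) s = fps_nth (fps_nth ?R r) s)"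
      by (simp only: fps_eq_iff) 
    also have "\<dots> \<longleftrightarrow> (\<forall>r s. ?P r s)"
      unfolding nL nR
    proof (intro iffI allI, goal_cases)
      case (1 r s)
      from 1[rule_format, of "Suc s" "Suc r"] show ?case by simp
    next
      case (2 r s)
      show ?case
      proof (cases r; cases s)
        fix r' s' assume "r = Suc r'" "s = Suc s'"
        then show ?thesis using 2[rule_format, of r' s'] by simp
      qed (simp_all add: c0)
    qed
    finally show ?thesis .
  qed
  then show ?thesis
    unfolding yangian_family_def rtt_rel_def using T0 by simp
qed

definition coprod_coeff ::
  "(nat \<Rightarrow> nat) \<Rightarrow> nat set \<Rightarrow> (nat \<Rightarrow> nat \<Rightarrow> nat \<Rightarrow> 'r::ring_1) \<Rightarrow> (nat \<Rightarrow> nat \<Rightarrow> nat \<Rightarrow> 'r) \<Rightarrow>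
    nat \<Rightarrow> nat \<Rightarrow> nat \<Rightarrow> 'r" where
  "coprod_coeff p I S T i j r =
     (\<Sum>a\<in>I. (-1) ^ ((p i + p a) * (p a + p j)) * (\<Sum>q = 0..r. S i a q * T a j (r - q)))"

lemma ser_coprod:
  "ser_u (coprod_coeff p I S T) = coprod_family p I (ser_u S) (ser_u T)"
  "ser_v (coprod_coeff p I S T) = coprod_family p I (ser_v S) (ser_v T)"
proof -
  have 1: "fps_nth (fps_nth (ser_u S i a * ser_u T a j) r) s = (if s = 0 then \<Sum>q = 0..r. S i a q * T a j (r - q) else 0)"
    for i a j r s
    by (simp add: ser_u_def fps_mult_nth fps_sum_nth)
  show "ser_u (coprod_coeff p I S T) = coprod_family p I (ser_u S) (ser_u T)"
    by (intro ext, simp only: fps_eq_iff coprod_family_def fps_sum_nth fps_nth_minus_one_power 1)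
      (auto simp: ser_u_def coprod_coeff_def)
  have 2: "fps_nth (fps_nth (ser_v S i a * ser_v T a j) r) s = (if r = 0 then \<Sum>q = 0..s. S i a q * T a j (s - q) else 0)"
    for i a j r s
    by (simp add: ser_v_def fps_mult_nth)
  show "ser_v (coprod_coeff p I S T) = coprod_family p I (ser_v S) (ser_v T)"
    by (intro ext, simp only: fps_eq_iff coprod_family_def fps_sum_nth fps_nth_minus_one_power 2)
      (auto simp: ser_v_def coprod_coeff_def)
qed

text \<open>The families play the roles of 1 tensor \<open>T\<close> and \<open>S\<close> tensor 1
  in a tensor product of superalgebras. The parity of \<open>T a j q\<close> is that of
  \<open>p a + p j\<close>.\<close>

definition supercommute ::
  "(nat \<Rightarrow> nat) \<Rightarrow> (nat \<Rightarrow> nat \<Rightarrow> nat \<Rightarrow> 'r::ring_1) \<Rightarrow> (nat \<Rightarrow> nat \<Rightarrow> nat \<Rightarrow> 'r) \<Rightarrow> bool" where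
  "supercommute p T S \<longleftrightarrow> (\<forall>a j k b q r.
     T a j q * S k b r = (-1) ^ ((p a + p j) * (p k + p b)) * (S k b r * T a j q))"

lemma fps_ser_supercommute:
  assumes "supercommute p T S"
  shows "ser_u T a j * ser_u S k b = (-1) ^ ((p a + p j) * (p k + p b)) * (ser_u S k b * ser_u T a j)"
    "ser_u T a j * ser_v S k b = (-1) ^ ((p a + p j) * (p k + p b)) * (ser_v S k b * ser_u T a j)"
    "ser_v T a j * ser_u S k b = (-1) ^ ((p a + p j) * (p k + p b)) * (ser_u S k b * ser_v T a j)"
    "ser_v T a j * ser_v S k b = (-1) ^ ((p a + p j) * (p k + p b)) * (ser_v S k b * ser_v T a j)"
proof -
  let ?n = "(p a + p j) * (p k + p b)"
  have e: "T a j q * S k b r = (-1) ^ ?n * (S k b r * T a j q)" for q r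
    using assms unfolding supercommute_def by blast
  \<comment> \<open>Commuting the factors of a convolution exchanges \<open>q\<close> with
    \<open>r - q\<close>, so the order of summation has to be reversed.\<close>
  have sw: "(\<Sum>q = 0..r. f q (r - q)) = (\<Sum>q = 0..r. f (r - q) q)" for f :: "nat \<Rightarrow> nat \<Rightarrow> 'a" and r :: nat
    using sum.nat_diff_reindex[of "\<lambda>q. f (r - q) q" "Suc r"]
    by (auto simp: atLeast0AtMost lessThan_Suc_atMost intro!: sum.cong)
  have uu: "fps_nth (fps_nth (ser_u S i a * ser_u T a' j) r) s = (if s = 0 then \<Sum>q = 0..r. S i a q * T a' j (r - q) else 0)"
    for i a a' j r s and S T :: "nat \<Rightarrow> nat \<Rightarrow> nat \<Rightarrow> 'a"
    by (simp add: ser_u_def fps_mult_nth fps_sum_nth)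
  have vv: "fps_nth (fps_nth (ser_v S i a * ser_v T a' j) r) s = (if r = 0 then \<Sum>q = 0..s. S i a q * T a' j (s - q) else 0)"
    for i a a' j r s and S T :: "nat \<Rightarrow> nat \<Rightarrow> nat \<Rightarrow> 'a"
    by (simp add: ser_v_def fps_mult_nth)
  have c: "(\<Sum>q = 0..r. T a j q * S k b (r - q)) = (-1) ^ ?n * (\<Sum>q = 0..r. S k b q * T a j (r - q))" for r
    unfolding e sum_distrib_left[symmetric] sw[of "\<lambda>q q'. S k b q' * T a j q"] by simp
  show "ser_u T a j * ser_u S k b = (-1) ^ ?n * (ser_u S k b * ser_u T a j)"
    unfolding fps_eq_iff fps_nth_minus_one_power uu c by simp
  show "ser_v T a j * ser_v S k b = (-1) ^ ?n * (ser_v S k b * ser_v T a j)"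
    unfolding fps_eq_iff fps_nth_minus_one_power vv c by simp
  show "ser_u T a j * ser_v S k b = (-1) ^ ?n * (ser_v S k b * ser_u T a j)"
    "ser_v T a j * ser_u S k b = (-1) ^ ?n * (ser_u S k b * ser_v T a j)"
    unfolding fps_eq_iff fps_nth_minus_one_power fps_nth_ser_mult e by simp_all
qed

text \<open>This takes the place of the statement that the coproduct is an algebra homomorphism. The
  four supercommutation hypotheses of \<open>rtt_rel_coprod\<close> are those of \<open>T\<close>
  with \<open>S\<close> for every choice of the two variables.\<close>

lemma yangian_family_coprod:
  assumes p: "\<And>i. p i = 0 \<or> p i = 1" and "finite I"
    and S: "yangian_family p I S" and T: "yangian_family p I T" and TS: "supercommute p T S"
  shows "yangian_family p I (coprod_coeff p I S T)"
proof -
  have S0: "S i j 0 = (if i = j then 1 else 0)" and T0: "T i j 0 = (if i = j then 1 else 0)"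
    if "i \<in> I" "j \<in> I" for i j
    using S T that unfolding yangian_family_def by auto
  have ST0: "coprod_coeff p I S T i j 0 = (if i = j then 1 else 0)" if "i \<in> I" "j \<in> I" for i j
  proof -
    have "coprod_coeff p I S T i j 0 = (\<Sum>a\<in>I. if a = i then (if i = j then 1 else 0) else 0)"
      unfolding coprod_coeff_def using that
      by (intro sum.cong) (auto simp: S0 T0)
    then show ?thesis using that \<open>finite I\<close> by simp
  qed
  have iff: "yangian_family p I (coprod_coeff p I S T) \<longleftrightarrow>
    rtt_rel p I (fps_const fps_X - fps_X) (fps_const fps_X * fps_X)
      (ser_u (coprod_coeff p I S T)) (ser_v (coprod_coeff p I S T))"
    by (rule yangian_family_iff_rtt_rel) (rule ST0)
  show ?thesis
    unfolding iff ser_coprod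
  proof (rule rtt_rel_coprod[OF p])
    show "rtt_rel p I (fps_const fps_X - fps_X) (fps_const fps_X * fps_X) (ser_u S) (ser_v S)"
      using S yangian_family_iff_rtt_rel S0 by blast
    show "rtt_rel p I (fps_const fps_X - fps_X) (fps_const fps_X * fps_X) (ser_u T) (ser_v T)"
      using T yangian_family_iff_rtt_rel T0 by blast
    have 1: "fps_X * t = t * fps_X" and 2: "fps_const fps_X * t = t * fps_const fps_X" for t :: "'a fps fps"
      by (simp_all add: fps_eq_iff)
    show "(fps_const fps_X - fps_X) * t = t * (fps_const fps_X - fps_X)" for t :: "'a fps fps"
      by (simp only: left_diff_distrib right_diff_distrib 1 2)
    show "fps_const fps_X * fps_X * t = t * (fps_const fps_X * fps_X)" for t :: "'a fps fps"
      using 1[of t] 2[of t] by (metis mult.assoc)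
  qed (rule fps_ser_supercommute[OF TS])+
qed

section \<open>A representation on many sites\<close>

text \<open>A type of its own, so that the lemmas about families in a \<open>ring_1\<close> apply to
  operators. The operators act on arbitrary functions, that is on possibly infinite combinations of
  basis vectors, which spares every condition of finite support.\<close>

typedef 'x endo = "{F :: ('x \<Rightarrow> complex) \<Rightarrow> 'x \<Rightarrow> complex.
    (\<forall>f g. F (\<lambda>x. f x + g x) = (\<lambda>x. F f x + F g x)) \<and> (\<forall>c f. F (\<lambda>x. c * f x) = (\<lambda>x. c * F f x))}"
  morphisms app Endo
  by (rule exI[of _ "\<lambda>f. f"]) simp

setup_lifting type_definition_endo

instantiation endo :: (type) ring_1
begin

lift_definition zero_endo :: "'a endo" is "\<lambda>f x. 0" by simp
lift_definition one_endo :: "'a endo" is "\<lambda>f. f" by simp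
lift_definition plus_endo :: "'a endo \<Rightarrow> 'a endo \<Rightarrow> 'a endo" is "\<lambda>F G f x. F f x + G f x"
  by (auto simp: algebra_simps)
lift_definition minus_endo :: "'a endo \<Rightarrow> 'a endo \<Rightarrow> 'a endo" is "\<lambda>F G f x. F f x - G f x"
  by (auto simp: algebra_simps)
lift_definition uminus_endo :: "'a endo \<Rightarrow> 'a endo" is "\<lambda>F f x. - F f x"
  by (auto simp: algebra_simps)
lift_definition times_endo :: "'a endo \<Rightarrow> 'a endo \<Rightarrow> 'a endo" is "\<lambda>F G f. F (G f)"
  by auto

instance
proof
  show "(0 :: 'a endo) \<noteq> 1"
  proof
    assume "(0 :: 'a endo) = 1"
    then have "app (0 :: 'a endo) (\<lambda>x. 1) = app 1 (\<lambda>x. 1)" by simp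
    then show False unfolding zero_endo.rep_eq one_endo.rep_eq by (metis zero_neq_one)
  qed
qed (transfer; auto simp: algebra_simps)+

end

lemma app_add: "app (F + G) f x = app F f x + app G f x"
  and app_diff: "app (F - G) f x = app F f x - app G f x"
  and app_uminus: "app (- F) f x = - app F f x"
  and app_mult: "app (F * G) f = app F (app G f)"
  and app_0: "app 0 f x = 0"
  and app_1: "app 1 f = f"
  by (simp_all add: plus_endo.rep_eq minus_endo.rep_eq uminus_endo.rep_eq times_endo.rep_eq
      zero_endo.rep_eq one_endo.rep_eq)

lemma app_sum: "app (sum F A) f x = (\<Sum>a\<in>A. app (F a) f x)"
  by (induction A rule: infinite_finite_induct) (auto simp: app_0 app_add)

lemma endo_eqI: "(\<And>f x. app F f x = app G f x) \<Longrightarrow> F = G"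
  by (metis app_inject ext)

lemma app_minus_one_power: "app ((-1) ^ n * F) f x = (-1) ^ n * app F f x"
  by (simp add: minus_one_power_iff app_uminus)

lemma app_sign: "app ((-1) ^ n) f = (\<lambda>x. (-1) ^ n * f x)"
  using app_minus_one_power[of n 1 f] by (auto simp: app_1)

lemma app_linear:
  "app F (\<lambda>x. f x + g x) = (\<lambda>x. app F f x + app F g x)" "app F (\<lambda>x. c * f x) = (\<lambda>x. c * app F f x)"
  using app[of F] by auto

lift_definition scalar_endo :: "complex \<Rightarrow> 'x endo" is "\<lambda>c f x. c * f x"
  by (auto simp: algebra_simps)

lemma scalar_endo_simps:
  "scalar_endo (a + b) = scalar_endo a + scalar_endo b"
  "scalar_endo (a * b) = scalar_endo a * scalar_endo b"
  "scalar_endo 0 = 0" "scalar_endo 1 = 1"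
  "scalar_endo a * F = F * scalar_endo a"
  by (transfer; auto simp: algebra_simps)+

lemma app_scalar: "app (scalar_endo c) f x = c * f x"
  by transfer simp

section \<open>The action of the generators on a single tensor site\<close>

type_synonym state = "nat \<Rightarrow> ygen option"

definition opar :: "(nat \<Rightarrow> nat) \<Rightarrow> ygen option \<Rightarrow> nat" where
  "opar p y = (case y of None \<Rightarrow> 0 | Some (i, j, r) \<Rightarrow> p i + p j)"

text \<open>The exponent of the Koszul sign which an odd operator picks up on its way to site
  \<open>k\<close>. Only its parity matters.\<close>

definition spar :: "(nat \<Rightarrow> nat) \<Rightarrow> nat \<Rightarrow> state \<Rightarrow> nat" where
  "spar p k x = (\<Sum>l<k. opar p (x l))"

text \<open>A state is a basis vector of a tensor power of \<open>B\<close>: \<open>None\<close>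
  stands for 1 and \<open>Some (i, j, r)\<close> for \<open>E_ij\<close> times the power
  \<open>r - 1\<close> of \<open>z\<close>. A function on states is a vector given by its
  coefficients, so the value at \<open>x\<close> collects the basis vectors from which left
  multiplication by the image of the generator reaches \<open>x\<close>: the slot was either 1, or
  \<open>E_jl\<close> with an exponent that adds up correctly, whence \<open>t + 1 - r\<close>. A
  slot equal to \<open>None\<close> is not reached for \<open>r > 0\<close>, since no such product
  has a component along 1. The sign with three summands is that of matrix multiplication after
  \<open>E_ij\<close> has been rescaled by \<open>(-1) ^ (p i * p j)\<close>; the outer one is the
  Koszul sign.\<close>

definition site_fun :: "(nat \<Rightarrow> nat) \<Rightarrow> nat \<Rightarrow> nat \<Rightarrow> nat \<Rightarrow> nat \<Rightarrow> (state \<Rightarrow> complex) \<Rightarrow> state \<Rightarrow> complex" where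
  "site_fun p k i j r f x =
     (if r = 0 then (if i = j then f x else 0)
      else case x k of None \<Rightarrow> 0
      | Some (i', l, t) \<Rightarrow> (-1) ^ ((p i + p j) * spar p k x) *
          ((if i' = i \<and> l = j \<and> t = r then f (x(k := None)) else 0) +
           (if i' = i \<and> r \<le> t then (-1) ^ (p i * p j + p i * p l + p j * p l) * f (x(k := Some (j, l, t + 1 - r))) else 0)))"

lift_definition site_op :: "(nat \<Rightarrow> nat) \<Rightarrow> nat \<Rightarrow> nat \<Rightarrow> nat \<Rightarrow> nat \<Rightarrow> state endo" is site_fun
  by (auto simp: site_fun_def fun_eq_iff algebra_simps split: option.splits)

lemma spar_upd_ge: "k \<le> l \<Longrightarrow> spar p k (x(l := y)) = spar p k x"
  by (simp add: spar_def)

lemma spar_upd_less: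
  assumes "k < l"
  shows "spar p l (x(k := y)) + opar p (x k) = spar p l x + opar p y"
proof -
  have k: "k \<in> {..<l}" using assms by simp
  have "(\<Sum>m\<in>{..<l} - {k}. opar p ((x(k := y)) m)) = (\<Sum>m\<in>{..<l} - {k}. opar p (x m))"
    by (intro sum.cong) auto
  then show ?thesis
    unfolding spar_def sum.remove[OF finite_lessThan k] by simp
qed

text \<open>Modulo 2 subtraction is addition, so the parities of the old and of the new content of
  the slot enter alike.\<close>

lemma sign_spar_upd:
  assumes "k < l"
  shows "(-1 :: complex) ^ (n * spar p l (x(k := y))) =
    (-1) ^ (n * spar p l x) * (-1) ^ (n * (opar p (x k) + opar p y))"
proof -
  have "even (n * spar p l (x(k := y)) + n * opar p (x k)) = even (n * spar p l x + n * opar p y)"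
    using spar_upd_less[OF assms, of p x y] by (metis distrib_left)
  then show ?thesis
    by (auto simp: minus_one_power_iff power_add[symmetric] algebra_simps)
qed

lemma site_op_0: "site_op p k i j 0 = (if i = j then 1 else 0)"
  by (rule endo_eqI) (auto simp: site_op.rep_eq site_fun_def app_1 app_0)

text \<open>Left multiplications compose like the elements of \<open>B\<close>: the powers of
  \<open>z\<close> add up to \<open>(r - 1) + (s - 1)\<close>, which is the power of the generator
  with index \<open>r + s - 1\<close>.\<close>

lemma site_op_mult:
  assumes "r \<noteq> 0" "s \<noteq> 0"
  shows "site_op p k i j r * site_op p k j' l s =
    (if j = j' then (-1) ^ (p i * p j + p i * p l + p j * p l) * site_op p k i l (r + s - 1) else 0)"
proof (rule endo_eqI)
  fix f x
  show "app (site_op p k i j r * site_op p k j' l s) f x =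
    app (if j = j' then (-1) ^ (p i * p j + p i * p l + p j * p l) * site_op p k i l (r + s - 1) else 0) f x"
  proof (cases "x k")
    case None
    then show ?thesis using assms
      by (simp add: app_mult app_0 site_op.rep_eq site_fun_def app_sign)
  next
    case (Some y)
    obtain i' m t where y: "y = (i', m, t)" by (cases y)
    \<comment> \<open>The Koszul signs multiply correctly because \<open>p j\<close> occurs twice
      and cancels modulo 2.\<close>
    have sA: "(-1 :: complex) ^ ((p i + p j) * n) * ((-1) ^ ((p j + p l) * n) * c) = (-1) ^ ((p i + p l) * n) * c" for n c
      by (simp add: minus_one_power_iff)
    \<comment> \<open>Associativity of the twisted multiplication: both sides are the sign of
      \<open>E_ij E_jl E_lm\<close>, for its two bracketings.\<close>
    have sB: "(-1 :: complex) ^ (p i * p j + p i * p m + p j * p m) * (-1) ^ (p j * p l + p j * p m + p l * p m) =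
      (-1) ^ (p i * p j + p i * p l + p j * p l) * (-1) ^ (p i * p l + p i * p m + p l * p m)"
      unfolding power_add[symmetric]
      by (cases "even (p i)"; cases "even (p j)"; cases "even (p l)"; cases "even (p m)") (simp_all add: minus_one_power_iff)
    show ?thesis
    proof (cases "j = j' \<and> i' = i \<and> r \<le> t")
      case True
      then have j: "j' = j" "i' = i" "r \<le> t" by auto
      let ?n = "spar p k x"
      define a where "a = (if m = l \<and> t + 1 - r = s then f (x(k := None)) else 0)"
      define b where "b = (if s \<le> t + 1 - r then f (x(k := Some (l, m, t + 1 - r + 1 - s))) else 0)"
      have "app (site_op p k i j r * site_op p k j' l s) f x =
        (-1) ^ ((p i + p j) * ?n) * ((-1) ^ (p i * p j + p i * p m + p j * p m) *
         ((-1) ^ ((p j + p l) * ?n) * (a + (-1) ^ (p j * p l + p j * p m + p l * p m) * b)))"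
        using assms by (auto simp add: app_mult site_op.rep_eq site_fun_def Some y j spar_upd_ge a_def b_def)
      also have "\<dots> = (-1) ^ ((p i + p l) * ?n) * ((-1) ^ (p i * p j + p i * p m + p j * p m) *
          (a + (-1) ^ (p j * p l + p j * p m + p l * p m) * b))"
        unfolding sA[symmetric] by (simp only: mult.left_commute)
      also have "\<dots> = (-1) ^ ((p i + p l) * ?n) * ((-1) ^ (p i * p j + p i * p l + p j * p l) * a +
          (-1) ^ (p i * p j + p i * p l + p j * p l) * (-1) ^ (p i * p l + p i * p m + p l * p m) * b)"
        unfolding sB[symmetric] by (simp add: a_def distrib_left mult.assoc)
      also have "\<dots> = app ((-1) ^ (p i * p j + p i * p l + p j * p l) * site_op p k i l (r + s - 1)) f x"
      proof -
        have e: "(m = l \<and> t + 1 - r = s) = (l = m \<and> t = r + s - 1)" "(s \<le> t + 1 - r) = (r + s - 1 \<le> t)"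
          using j assms by auto
        have e': "t + 1 - r + 1 - s = t + 1 - (r + s - 1)" if "r + s - 1 \<le> t"
          using j assms that by linarith
        have "a = (if m = l \<and> t = r + s - 1 then f (x(k := None)) else 0)"
          unfolding a_def e by auto
        moreover have "b = (if r + s - 1 \<le> t then f (x(k := Some (l, m, t + 1 - (r + s - 1)))) else 0)"
          unfolding b_def e by (intro if_cong refl) (simp only: e')
        moreover have "r + s - 1 \<noteq> 0" using assms by simp
        ultimately show ?thesis
          using assms by (auto simp add: app_mult site_op.rep_eq site_fun_def app_sign Some y j distrib_left mult.left_commute 
            mult.assoc)
      qed
      finally show ?thesis using j by simp
    next
      case False
      then show ?thesis using assms
        by (cases "j = j'"; cases "i' = i"; cases "r \<le> t")
          (simp_all add: app_mult app_0 site_op.rep_eq site_fun_def Some y app_sign)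
    qed
  qed
qed

text \<open>Products, and hence supercommutators, of operators with positive indices depend only on
  the sum of the indices. For \<open>r\<close>, \<open>s\<close> positive both sides of the relation
  are therefore zero. If one of them is 0, one commutator drops out, and what remains is the
  commutator of matrix units.\<close>

lemma yangian_family_site:
  assumes p: "\<And>i. p i = 0 \<or> p i = 1"
  shows "yangian_family p I (site_op p k)"
proof -
  let ?E = "site_op p k"
  let ?e = "\<lambda>i k l. (-1) ^ (p i * p k + p i * p l + p k * p l) :: state endo"
  have pp: "p m = 0 \<or> p m = Suc 0" for m
    using p by auto
  have c0: "comm_coeff p ?E i j k' l 0 s = 0" "comm_coeff p ?E i j k' l r 0 = 0" for i j k' l r s
    by (rule comm_coeff_0[of UNIV]; simp add: site_op_0)+
  have c: "?e i k' l * comm_coeff p ?E i j k' l r s =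
      (if j = k' then ?E i l (r + s - 1) else 0) - (if i = l then ?E k' j (r + s - 1) else 0)"
    if "r \<noteq> 0" "s \<noteq> 0" for i j k' l r s
    unfolding comm_coeff_def site_op_mult[OF that] site_op_mult[OF that(2,1)] add.commute[of s r]
    by (cases "even (p i)"; cases "even (p j)"; cases "even (p k')"; cases "even (p l)"; cases "j = k'"; cases "i = l")
      (simp_all add: minus_one_power_iff del: One_nat_def)
  have "?e i k' l * (comm_coeff p ?E i j k' l (Suc r) s - comm_coeff p ?E i j k' l r (Suc s)) =
      ?E k' j r * ?E i l s - ?E k' j s * ?E i l r" for i j k' l r s
  proof (cases "r = 0"; cases "s = 0")
    assume "r \<noteq> 0" "s \<noteq> 0"
    then show ?thesis
      unfolding right_diff_distrib by (simp add: c site_op_mult add.commute[of s r])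
  next
    assume "r = 0" "s \<noteq> 0"
    then show ?thesis
      unfolding right_diff_distrib by (simp add: c c0 site_op_0)
  next
    assume "r \<noteq> 0" "s = 0"
    then show ?thesis
      unfolding right_diff_distrib by (simp add: c c0 site_op_0)
  next
    assume "r = 0" "s = 0"
    then show ?thesis
      unfolding right_diff_distrib by (simp add: c c0 site_op_0)
  qed
  then show ?thesis
    unfolding yangian_family_def by (simp add: site_op_0)
qed

text \<open>An operator at site \<open>k\<close> changes the parity of the slot \<open>k\<close> by
  its own parity, and the Koszul sign of the operator at \<open>k'\<close> counts that slot. An
  operator at \<open>k'\<close> leaves the sign at \<open>k\<close> alone, because \<open>k\<close>
  lies to its left. The two orders thus differ by exactly one sign.\<close>

lemma supercommute_site_less:
  assumes kk: "k < k'"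
  shows "site_op p k i j r * site_op p k' i' j' s =
    (-1) ^ ((p i + p j) * (p i' + p j')) * (site_op p k' i' j' s * site_op p k i j r)"
proof -
  let ?g = "p i + p j" and ?h = "p i' + p j'"
  consider "r = 0" | "s = 0" | "r \<noteq> 0" "s \<noteq> 0" by blast
  then show ?thesis
  proof cases
    case 3
    show ?thesis
    proof (rule endo_eqI)
      fix f x
      have s1: "(-1 :: complex) ^ (?h * spar p k' (x(k := None))) = (-1) ^ (?h * spar p k' x) * (-1) ^ (?g * ?h)"
        if "x k = Some (i, j, r)"
        unfolding sign_spar_upd[OF kk] that by (simp add: opar_def mult.commute)
      have s2: "(-1 :: complex) ^ (?h * spar p k' (x(k := Some (j, m, t')))) = (-1) ^ (?h * spar p k' x) * (-1) ^ (?g * ?h)"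
        if "x k = Some (i, m, t)" for m t t'
        unfolding sign_spar_upd[OF kk] that
        by (cases "even (p i)"; cases "even (p j)"; cases "even (p m)") (simp_all add: opar_def minus_one_power_iff)
      show "app (site_op p k i j r * site_op p k' i' j' s) f x =
        app ((-1) ^ (?g * ?h) * (site_op p k' i' j' s * site_op p k i j r)) f x"
      proof (cases "x k"; cases "x k'")
        fix y y' assume y: "x k = Some y" "x k' = Some y'"
        obtain a m t where ya: "y = (a, m, t)" by (cases y)
        obtain a' m' t' where ya': "y' = (a', m', t')" by (cases y')
        define A B where "A \<longleftrightarrow> a = i \<and> m = j \<and> t = r" and "B \<longleftrightarrow> a = i \<and> r \<le> t"
        define A' B' where "A' \<longleftrightarrow> a' = i' \<and> m' = j' \<and> t' = s" and "B' \<longleftrightarrow> a' = i' \<and> s \<le> t'"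
        define e e' :: complex where "e = (-1) ^ (p i * p j + p i * p m + p j * p m)"
          and "e' = (-1) ^ (p i' * p j' + p i' * p m' + p j' * p m')"
        define w w' :: "ygen option" where "w = Some (j, m, t + 1 - r)" and "w' = Some (j', m', t' + 1 - s)"
        define c c' d :: complex where "c = (-1) ^ (?g * spar p k x)" and "c' = (-1) ^ (?h * spar p k' x)"
          and "d = (-1) ^ (?g * ?h)"
        have H: "app (site_op p k i j r) f z =
            c * ((if A then f (z(k := None)) else 0) + (if B then e * f (z(k := w)) else 0))"
          if "z k = x k" "spar p k z = spar p k x" for z f
          using 3 that y ya by (simp add: site_op.rep_eq site_fun_def A_def B_def e_def w_def c_def)
        have H': "app (site_op p k' i' j' s) f z = (-1) ^ (?h * spar p k' z) *
            ((if A' then f (z(k' := None)) else 0) + (if B' then e' * f (z(k' := w')) else 0))"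
          if "z k' = x k'" for z f
          using 3 that y ya' by (simp add: site_op.rep_eq site_fun_def A'_def B'_def e'_def w'_def)
        \<comment> \<open>All terms on either side are values of \<open>f\<close> at
          \<open>x\<close> with the slots \<open>k\<close> and \<open>k'\<close> replaced. Indexing
          them by the two new contents makes the order of the updates invisible.\<close>
        define g where "g = (\<lambda>u u'. f (x(k := u, k' := u')))"
        have g: "f (x(k' := u', k := u)) = g u u'" "f (x(k := u, k' := u')) = g u u'" for u u'
          using kk by (simp_all add: g_def fun_upd_twist[of k k'])
        have F1: "app (site_op p k' i' j' s) f (x(k := None)) =
            c' * d * ((if A' then g None None else 0) + (if B' then e' * g None w' else 0))" if A
          using that kk y ya by (subst H') (auto simp: s1 A_def g c'_def d_def)
        have F2: "app (site_op p k' i' j' s) f (x(k := w)) =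
            c' * d * ((if A' then g w None else 0) + (if B' then e' * g w w' else 0))" if B
          using that kk y ya by (subst H') (auto simp: s2 B_def g c'_def d_def w_def)
        have L: "app (site_op p k i j r * site_op p k' i' j' s) f x = c * ((if A then
            c' * d * ((if A' then g None None else 0) + (if B' then e' * g None w' else 0)) else 0) +
            (if B then e * (c' * d * ((if A' then g w None else 0) + (if B' then e' * g w w' else 0))) else 0))"
          by (simp add: app_mult H F1 F2)
        have H1: "app (site_op p k i j r) f (x(k' := u)) =
            c * ((if A then g None u else 0) + (if B then e * g w u else 0))" for u
          using kk by (subst H) (simp_all add: g spar_upd_ge)
        have R: "app ((-1) ^ (?g * ?h) * (site_op p k' i' j' s * site_op p k i j r)) f x = d * (c' *
            ((if A' then c * ((if A then g None None else 0) + (if B then e * g w None else 0)) else 0) +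
             (if B' then e' * (c * ((if A then g None w' else 0) + (if B then e * g w w' else 0))) else 0)))"
          by (simp add: app_mult app_sign H' H1 c'_def d_def)
        show ?thesis
          unfolding L R by (cases A; cases B; cases A'; cases B') (simp_all add: algebra_simps)
      qed (use 3 kk in \<open>auto simp: app_mult site_op.rep_eq site_fun_def app_sign split: option.splits prod.splits\<close>)
    qed
  qed (auto simp: site_op_0)
qed

lemma supercommute_site:
  assumes "k \<noteq> k'"
  shows "supercommute p (site_op p k) (site_op p k')"
proof (cases "k < k'")
  case True
  then show ?thesis unfolding supercommute_def using supercommute_site_less by blast
next
  case False
  then have "k' < k" using assms by simp
  have "site_op p k a j q * site_op p k' b j' r =
      (-1) ^ ((p a + p j) * (p b + p j')) * (site_op p k' b j' r * site_op p k a j q)" for a j q b j' r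
    unfolding supercommute_site_less[OF \<open>k' < k\<close>] mult.commute[of "p b + p j'"]
    by (simp add: minus_one_power_iff)
  then show ?thesis unfolding supercommute_def by blast
qed

text \<open>The iterated coproduct, which adds one site on the right at each step. It starts from
  the counit, which sends all coefficients of positive index to 0.\<close>

definition multi_site :: "(nat \<Rightarrow> nat) \<Rightarrow> nat set \<Rightarrow> nat \<Rightarrow> nat \<Rightarrow> nat \<Rightarrow> nat \<Rightarrow> state endo" where
  "multi_site p I m = rec_nat (\<lambda>i j r. if r = 0 \<and> i = j then 1 else 0)
     (\<lambda>n T. coprod_coeff p I T (site_op p n)) m"

lemma multi_site_simps:
  "multi_site p I 0 i j r = (if r = 0 \<and> i = j then 1 else 0)"
  "multi_site p I (Suc n) = coprod_coeff p I (multi_site p I n) (site_op p n)"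
  by (simp_all add: multi_site_def)

lemma supercommute_multi_site:
  assumes "n \<le> k"
  shows "supercommute p (site_op p k) (multi_site p I n)"
  using assms
proof (induction n)
  case 0
  have "even (p i + p i)" for i by simp
  then show ?case by (auto simp: supercommute_def multi_site_simps minus_one_power_iff)
next
  case (Suc n)
  have *: "supercommute p (site_op p k) (multi_site p I n)" "supercommute p (site_op p k) (site_op p n)"
    using Suc supercommute_site[of k n] by auto
  show ?case
    unfolding supercommute_def
  proof (intro allI)
    fix a j b l q r
    let ?S = "site_op p k a j q" and ?n = "\<lambda>b c. (p a + p j) * (p b + p c)"
    \<comment> \<open>The intermediate index \<open>c\<close> contributes its parity twice, so the
      signs for \<open>b c\<close> and \<open>c l\<close> combine to the one for
      \<open>b l\<close>.\<close>
    have e: "?S * (multi_site p I n b c q' * site_op p n c l r') =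
      (-1) ^ ?n b l * (multi_site p I n b c q' * site_op p n c l r' * ?S)" for c q' r'
    proof -
      have "?S * (multi_site p I n b c q' * site_op p n c l r') =
          (-1) ^ ?n b c * (multi_site p I n b c q' * (?S * site_op p n c l r'))"
        using *(1) unfolding supercommute_def by (simp add: mult.assoc[symmetric])
      also have "\<dots> = (-1) ^ ?n b c * (multi_site p I n b c q' * ((-1) ^ ?n c l * (site_op p n c l r' * ?S)))"
        using *(2) unfolding supercommute_def by simp
      also have "\<dots> = (-1) ^ ?n b l * (multi_site p I n b c q' * site_op p n c l r' * ?S)"
        by (cases "even (p a)"; cases "even (p j)"; cases "even (p b)"; cases "even (p c)"; cases "even (p l)")
          (simp_all add: minus_one_power_iff mult.assoc)
      finally show ?thesis .
    qed
    have L: "?S * ((-1) ^ m * sum f Q) = (-1) ^ n' * ((-1) ^ m * sum f Q * ?S)"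
      if "\<And>q. ?S * f q = (-1) ^ n' * (f q * ?S)" for m n' f and Q :: "nat set"
    proof -
      have "?S * sum f Q = (-1) ^ n' * (sum f Q * ?S)"
        unfolding sum_distrib_left that by (simp add: sum_distrib_left sum_distrib_right)
      then show ?thesis
        by (cases "even m"; cases "even n'") (simp_all add: minus_one_power_iff)
    qed
    have "?S * ((-1) ^ ((p b + p c) * (p c + p l)) * (\<Sum>q' = 0..r. multi_site p I n b c q' * site_op p n c l (r - q'))) =
      (-1) ^ ?n b l * ((-1) ^ ((p b + p c) * (p c + p l)) *
        (\<Sum>q' = 0..r. multi_site p I n b c q' * site_op p n c l (r - q')) * ?S)" for c
      by (rule L) (rule e)
    then show "?S * multi_site p I (Suc n) b l r = (-1) ^ ?n b l * (multi_site p I (Suc n) b l r * ?S)"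
      unfolding multi_site_simps coprod_coeff_def sum_distrib_left[of ?S] sum_distrib_right
        sum_distrib_left[of "(-1) ^ ?n b l"] by simp
  qed
qed

lemma yangian_family_multi_site:
  assumes p: "\<And>i. p i = 0 \<or> p i = 1" and "finite I"
  shows "yangian_family p I (multi_site p I m)"
proof (induction m)
  case 0
  show ?case
    by (auto simp: yangian_family_def comm_coeff_def multi_site_simps)
next
  case (Suc m)
  show ?case
    unfolding multi_site_simps
    by (rule yangian_family_coprod[OF p \<open>finite I\<close> Suc yangian_family_site[OF p] supercommute_multi_site]) simp
qed

section \<open>Leading terms and the independence of normal words\<close>

text \<open>The total exponent of \<open>z\<close> on the first \<open>m\<close> sites. It is an
  integer because the bounds below subtract from it and may become negative.\<close>

definition zdeg :: "nat \<Rightarrow> state \<Rightarrow> int" where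
  "zdeg m x = (\<Sum>k<m. case x k of None \<Rightarrow> 0 | Some (i, j, r) \<Rightarrow> int r - 1)"

definition zbounded :: "nat \<Rightarrow> int \<Rightarrow> (state \<Rightarrow> complex) \<Rightarrow> bool" where
  "zbounded m d f \<longleftrightarrow> (\<forall>x. f x \<noteq> 0 \<longrightarrow> zdeg m x \<le> d)"

definition op_zdeg :: "nat \<Rightarrow> int \<Rightarrow> state endo \<Rightarrow> bool" where
  "op_zdeg m e F \<longleftrightarrow> (\<forall>d f. zbounded m d f \<longrightarrow> zbounded m (d + e) (app F f))"

lemma zdeg_upd:
  assumes "k < m"
  shows "zdeg m (x(k := y)) = zdeg m x - (case x k of None \<Rightarrow> 0 | Some (i, j, r) \<Rightarrow> int r - 1)
    + (case y of None \<Rightarrow> 0 | Some (i, j, r) \<Rightarrow> int r - 1)"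
proof -
  let ?g = "\<lambda>y :: ygen option. case y of None \<Rightarrow> 0 | Some (i, j, r) \<Rightarrow> int r - 1"
  have k: "k \<in> {..<m}" using assms by simp
  have "(\<Sum>l\<in>{..<m} - {k}. ?g ((x(k := y)) l)) = (\<Sum>l\<in>{..<m} - {k}. ?g (x l))"
    by (intro sum.cong) auto
  then show ?thesis
    unfolding zdeg_def sum.remove[OF finite_lessThan k] by simp
qed

lemma zbounded_mono: "zbounded m d f \<Longrightarrow> d \<le> d' \<Longrightarrow> zbounded m d' f"
  unfolding zbounded_def by force

lemma zbounded_diff: "zbounded m d f \<Longrightarrow> zbounded m d g \<Longrightarrow> zbounded m d (\<lambda>x. f x - g x)"
  unfolding zbounded_def by (metis diff_self)

lemma op_zdeg_mono: "op_zdeg m e F \<Longrightarrow> e \<le> e' \<Longrightarrow> op_zdeg m e' F"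
  unfolding op_zdeg_def using zbounded_mono by (meson add_left_mono)

lemma op_zdeg_0: "op_zdeg m e 0"
  by (simp add: op_zdeg_def zbounded_def app_0)

lemma op_zdeg_1: "op_zdeg m 0 1"
  by (simp add: op_zdeg_def zbounded_def app_1)

lemma op_zdeg_add: "op_zdeg m e F \<Longrightarrow> op_zdeg m e G \<Longrightarrow> op_zdeg m e (F + G)"
  unfolding op_zdeg_def zbounded_def app_add by (metis add_0)

lemma op_zdeg_uminus: "op_zdeg m e F \<Longrightarrow> op_zdeg m e (- F)"
  unfolding op_zdeg_def zbounded_def app_uminus by simp

lemma op_zdeg_sign: "op_zdeg m e F \<Longrightarrow> op_zdeg m e ((-1) ^ n * F)"
  by (simp add: minus_one_power_iff op_zdeg_uminus)

lemma op_zdeg_sum: "(\<And>a. a \<in> A \<Longrightarrow> op_zdeg m e (F a)) \<Longrightarrow> op_zdeg m e (sum F A)"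
  by (induction A rule: infinite_finite_induct) (auto simp: op_zdeg_0 op_zdeg_add)

lemma op_zdeg_mult: "op_zdeg m e F \<Longrightarrow> op_zdeg m e' G \<Longrightarrow> op_zdeg m (e + e') (F * G)"
  unfolding op_zdeg_def app_mult by (metis add.assoc add.commute)

lemma op_zdeg_site:
  assumes "k < m" "r \<noteq> 0"
  shows "op_zdeg m (int r - 1) (site_op p k i j r)"
  unfolding op_zdeg_def zbounded_def
proof (intro allI impI)
  fix d f x
  assume f: "\<forall>x. f x \<noteq> 0 \<longrightarrow> zdeg m x \<le> d" and x: "app (site_op p k i j r) f x \<noteq> 0"
  then obtain i' l t where y: "x k = Some (i', l, t)"
    using assms by (auto simp: site_op.rep_eq site_fun_def split: option.splits)
  have "t = r \<and> f (x(k := None)) \<noteq> 0 \<or> r \<le> t \<and> f (x(k := Some (j, l, t + 1 - r))) \<noteq> 0"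
    using x assms y by (auto simp: site_op.rep_eq site_fun_def split: if_splits)
  then have "t = r \<and> zdeg m (x(k := None)) \<le> d \<or> r \<le> t \<and> zdeg m (x(k := Some (j, l, t + 1 - r))) \<le> d"
    using f by blast
  then show "zdeg m x \<le> d + (int r - 1)"
    using y by (auto simp: zdeg_upd[OF assms(1)] of_nat_diff)
qed

text \<open>A summand of the coproduct carries indices \<open>q\<close> and \<open>r - q\<close> on
  its two factors. For \<open>q = 0\<close> and \<open>q = r\<close> one factor is a Kronecker
  delta, and these summands add up to the new site operator and the previous
  \<open>multi_site\<close>. Every other summand raises the z-degree by at most
  \<open>(q - 1) + (r - q - 1) = r - 2\<close>.\<close>

lemma op_zdeg_multi_site:
  assumes "n \<le> m"
  shows "op_zdeg m (if r = 0 then 0 else int r - 1) (multi_site p I n i j r)"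
    and "i \<in> I \<Longrightarrow> j \<in> I \<Longrightarrow> finite I \<Longrightarrow> r \<noteq> 0 \<Longrightarrow>
      op_zdeg m (int r - 2) (multi_site p I n i j r - (\<Sum>k<n. site_op p k i j r))"
proof -
  let ?d = "\<lambda>r. if r = 0 then 0 else int r - 1"
  have site: "op_zdeg m (?d r) (site_op p k i j r)" if "k < m" for i j r k
    using op_zdeg_site[OF that] op_zdeg_0 op_zdeg_1 by (auto simp: site_op_0)
  have mult: "op_zdeg m (?d r) (F * G)" if "op_zdeg m (?d q) F" "op_zdeg m (?d (r - q)) G" "q \<le> r" for F G q r
    by (rule op_zdeg_mono[OF op_zdeg_mult[OF that(1,2)]]) (use that(3) in auto)
  have 1: "op_zdeg m (?d r) (multi_site p I n i j r)" if "n \<le> m" for n i j r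
    using that
  proof (induction n arbitrary: i j r)
    case 0
    then show ?case by (auto simp: multi_site_simps op_zdeg_0 op_zdeg_1)
  next
    case (Suc n)
    have "op_zdeg m (?d r) (multi_site p I n i a q * site_op p n a j (r - q))" if "q \<le> r" for a q
      using Suc that by (intro mult[of q] Suc.IH site) auto
    then show ?case
      unfolding multi_site_simps coprod_coeff_def
      by (intro op_zdeg_sum op_zdeg_sign) auto
  qed
  show "op_zdeg m (if r = 0 then 0 else int r - 1) (multi_site p I n i j r)"
    using 1 assms by blast
  show "op_zdeg m (int r - 2) (multi_site p I n i j r - (\<Sum>k<n. site_op p k i j r))"
    if "i \<in> I" "j \<in> I" "finite I" "r \<noteq> 0"
    using assms that
  proof (induction n arbitrary: i j)
    case 0
    then show ?case by (simp add: multi_site_simps op_zdeg_0)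
  next
    case (Suc n)
    let ?t = "\<lambda>a q. multi_site p I n i a q * site_op p n a j (r - q)"
    have T0: "multi_site p I n i a 0 = (if i = a then 1 else 0)" if "a \<in> I" for a
    proof -
      have "multi_site p I n i a 0 = (if i = a then 1 else 0)" if "i \<in> I" "a \<in> I" for i a
        using that
      proof (induction n arbitrary: i a)
        case (Suc n)
        have "multi_site p I (Suc n) i a 0 = (\<Sum>b\<in>I. if b = i then (if i = a then 1 else 0) else 0)"
          unfolding multi_site_simps coprod_coeff_def using Suc
          by (intro sum.cong) (auto simp: site_op_0)
        then show ?case using Suc.prems \<open>finite I\<close> by simp
      qed (simp add: multi_site_simps)
      then show ?thesis using Suc.prems that by blast
    qed
    have "(\<Sum>q = 0..r. ?t a q) = ?t a 0 + ?t a r + (\<Sum>q\<in>{1..<r}. ?t a q)" for a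
    proof -
      have "{0..r} = insert 0 (insert r {1..<r})" using Suc.prems by auto
      then show ?thesis using Suc.prems by simp
    qed
    then have "multi_site p I (Suc n) i j r =
      (\<Sum>a\<in>I. (-1) ^ ((p i + p a) * (p a + p j)) * ?t a 0) +
      (\<Sum>a\<in>I. (-1) ^ ((p i + p a) * (p a + p j)) * ?t a r) +
      (\<Sum>a\<in>I. (-1) ^ ((p i + p a) * (p a + p j)) * (\<Sum>q\<in>{1..<r}. ?t a q))"
      unfolding multi_site_simps coprod_coeff_def by (simp add: distrib_left sum.distrib)
    also have "(\<Sum>a\<in>I. (-1) ^ ((p i + p a) * (p a + p j)) * ?t a 0) = site_op p n i j r"
    proof -
      have "(\<Sum>a\<in>I. (-1) ^ ((p i + p a) * (p a + p j)) * ?t a 0) =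
          (\<Sum>a\<in>I. if a = i then site_op p n i j r else 0)"
        using T0 by (intro sum.cong) (auto simp: mult.assoc[symmetric])
      then show ?thesis using Suc.prems by simp
    qed
    also have "(\<Sum>a\<in>I. (-1) ^ ((p i + p a) * (p a + p j)) * ?t a r) = multi_site p I n i j r"
    proof -
      have "(\<Sum>a\<in>I. (-1) ^ ((p i + p a) * (p a + p j)) * ?t a r) =
          (\<Sum>a\<in>I. if a = j then multi_site p I n i j r else 0)"
        by (intro sum.cong) (auto simp: site_op_0)
      then show ?thesis using Suc.prems by simp
    qed
    finally have E: "multi_site p I (Suc n) i j r - (\<Sum>k<Suc n. site_op p k i j r) =
       (multi_site p I n i j r - (\<Sum>k<n. site_op p k i j r)) +
       (\<Sum>a\<in>I. (-1) ^ ((p i + p a) * (p a + p j)) * (\<Sum>q\<in>{1..<r}. ?t a q))"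
      by simp
    have D: "op_zdeg m (int r - 2) (?t a q)" if "q \<in> {1..<r}" for a q
    proof (rule op_zdeg_mono)
      show "op_zdeg m (?d q + ?d (r - q)) (?t a q)"
        using Suc.prems by (intro op_zdeg_mult 1 site) auto
    qed (use that in auto)
    show ?case
      unfolding E by (intro op_zdeg_add op_zdeg_sum op_zdeg_sign D Suc.IH) (use Suc.prems in auto)
  qed
qed


section \<open>Words acting on the vacuum vector and their leading terms\<close>

definition word_op :: "(nat \<Rightarrow> nat \<Rightarrow> nat \<Rightarrow> 'r::monoid_mult) \<Rightarrow> ygen list \<Rightarrow> 'r" where
  "word_op T w = prod_list (map (\<lambda>(i, j, r). T i j r) w)"

lemma word_op_simps:
  "word_op T [] = 1" "word_op T ((i, j, r) # w) = T i j r * word_op T w"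
  "word_op T (v @ w) = word_op T v * word_op T w"
  by (simp_all add: word_op_def)

definition vacuum :: "state \<Rightarrow> complex" where
  "vacuum x = (if x = (\<lambda>_. None) then 1 else 0)"

text \<open>The z-degree which a word can reach. It differs from the filtration degree: every letter
  counts one less than its index.\<close>

definition zword :: "ygen list \<Rightarrow> int" where
  "zword w = (\<Sum>(i, j, r)\<leftarrow>w. int r - 1)"

text \<open>The leading part of \<open>multi_site\<close> with respect to \<open>zdeg\<close>,
  according to \<open>op_zdeg_multi_site\<close>: a generator acts like a primitive element, on one
  site at a time.\<close>

definition sum_site :: "(nat \<Rightarrow> nat) \<Rightarrow> nat \<Rightarrow> nat \<Rightarrow> nat \<Rightarrow> nat \<Rightarrow> state endo" where
  "sum_site p m i j r = (\<Sum>k<m. site_op p k i j r)"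

definition gens_over :: "nat set \<Rightarrow> ygen set" where
  "gens_over I = {(i, j, r). i \<in> I \<and> j \<in> I \<and> 1 \<le> r}"

lemma app_diff_arg: "app F (\<lambda>x. f x - g x) x = app F f x - app F g x"
  using app_linear(1)[of F f "\<lambda>x. (-1) * g x"] unfolding app_linear(2) by (simp add: fun_eq_iff)

text \<open>The operators of the letters are replaced by their leading parts one after the other,
  and each replacement costs at least one in the z-degree. The induction also carries the bound for
  the word in the leading parts.\<close>

lemma zbounded_word:
  assumes "set w \<subseteq> gens_over I" and I: "finite I"
  shows "zbounded m (zword w) (app (word_op (multi_site p I m) w) vacuum)"
    and "zbounded m (zword w - 1) (\<lambda>x. app (word_op (multi_site p I m) w) vacuum x -
      app (word_op (sum_site p m) w) vacuum x)"
proof -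
  let ?T = "multi_site p I m" and ?S = "sum_site p m"
  have "zbounded m (zword w) (app (word_op ?T w) vacuum) \<and>
    zbounded m (zword w) (app (word_op ?S w) vacuum) \<and>
    zbounded m (zword w - 1) (\<lambda>x. app (word_op ?T w) vacuum x - app (word_op ?S w) vacuum x)"
    using assms(1)
  proof (induction w)
    case Nil
    have "zbounded m 0 vacuum"
      by (auto simp: zbounded_def vacuum_def zdeg_def)
    then show ?case by (simp add: word_op_simps app_1 zword_def) (simp add: zbounded_def)
  next
    case (Cons g w)
    obtain i j r where g: "g = (i, j, r)" by (cases g)
    have r: "i \<in> I" "j \<in> I" "r \<noteq> 0" using Cons.prems g by (auto simp: gens_over_def)
    let ?u = "app (word_op ?T w) vacuum" and ?v = "app (word_op ?S w) vacuum"
    have T: "op_zdeg m (int r - 1) (?T i j r)"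
      using op_zdeg_multi_site(1)[of m m r p I i j] r by simp
    have S: "op_zdeg m (int r - 1) (?S i j r)"
      unfolding sum_site_def using r by (intro op_zdeg_sum op_zdeg_site) auto
    have D: "op_zdeg m (int r - 2) (?T i j r - ?S i j r)"
      unfolding sum_site_def using r I by (intro op_zdeg_multi_site(2)) auto
    have z: "zword (g # w) = zword w + (int r - 1)" by (simp add: zword_def g)
    have w: "zbounded m (zword w) ?u" "zbounded m (zword w) ?v" "zbounded m (zword w - 1) (\<lambda>x. ?u x - ?v x)"
      using Cons by auto
    \<comment> \<open>The telescoping step: \<open>T u - S v\<close> is \<open>T (u - v)\<close>
      plus \<open>(T - S) v\<close>, and in each summand one factor loses a degree.\<close>
    have e: "app (?T i j r) ?u x - app (?S i j r) ?v x =
      app (?T i j r) (\<lambda>x. ?u x - ?v x) x - (- app (?T i j r - ?S i j r) ?v x)" for x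
      by (simp add: app_diff_arg app_diff)
    have "zbounded m (zword (g # w) - 1) (app (?T i j r) (\<lambda>x. ?u x - ?v x))"
    proof (rule zbounded_mono)
      show "zbounded m (zword w - 1 + (int r - 1)) (app (?T i j r) (\<lambda>x. ?u x - ?v x))"
        using T w(3) unfolding op_zdeg_def by blast
    qed (simp add: z)
    moreover have "zbounded m (zword (g # w) - 1) (app (?T i j r - ?S i j r) ?v)"
    proof (rule zbounded_mono)
      show "zbounded m (zword w + (int r - 2)) (app (?T i j r - ?S i j r) ?v)"
        using D w(2) unfolding op_zdeg_def by blast
    qed (simp add: z)
    ultimately have "zbounded m (zword (g # w) - 1) (\<lambda>x. app (?T i j r) ?u x - app (?S i j r) ?v x)"
      unfolding e by (intro zbounded_diff) (auto simp: zbounded_def)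
    then show ?case
      using T S w(1,2) unfolding g word_op_simps app_mult op_zdeg_def z[unfolded g] by blast
  qed
  then show "zbounded m (zword w) (app (word_op (multi_site p I m) w) vacuum)"
    and "zbounded m (zword w - 1) (\<lambda>x. app (word_op (multi_site p I m) w) vacuum x -
      app (word_op (sum_site p m) w) vacuum x)"
    by auto
qed

text \<open>The contribution in which every letter fills an empty slot, read backwards from the
  final state: the first letter of the word acts last and is therefore the first to be taken
  out.\<close>

fun creation :: "(nat \<Rightarrow> nat) \<Rightarrow> nat \<Rightarrow> ygen list \<Rightarrow> state \<Rightarrow> complex" where
  "creation p m [] x = vacuum x"
| "creation p m ((i, j, r) # w) x = (\<Sum>k<m. if x k = Some (i, j, r)
     then (-1) ^ ((p i + p j) * spar p k x) * creation p m w (x(k := None)) else 0)"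

definition contents :: "nat \<Rightarrow> state \<Rightarrow> ygen list" where
  "contents m x = concat (map (\<lambda>k. case x k of None \<Rightarrow> [] | Some g \<Rightarrow> [g]) [0..<m])"

lemma contents_split:
  assumes "k < m"
  obtains us vs where "\<And>y. contents m (x(k := y)) = us @ (case y of None \<Rightarrow> [] | Some g \<Rightarrow> [g]) @ vs"
    and "us = contents k x"
proof
  have "[0..<m] = [0..<k] @ k # [Suc k..<m]"
    using assms upt_add_eq_append[of 0 k "m - k"] upt_conv_Cons[of k m] by simp
  then have "contents m z = contents k z @ (case z k of None \<Rightarrow> [] | Some g \<Rightarrow> [g]) @
      concat (map (\<lambda>k. case z k of None \<Rightarrow> [] | Some g \<Rightarrow> [g]) [Suc k..<m])" for z
    unfolding contents_def by simp
  moreover have "contents k (x(k := y)) = contents k x" for y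
    unfolding contents_def by (intro arg_cong[of _ _ concat] map_cong) auto
  moreover have "map (\<lambda>l. case (x(k := y)) l of None \<Rightarrow> [] | Some g \<Rightarrow> [g]) [Suc k..<m] =
      map (\<lambda>l. case x l of None \<Rightarrow> [] | Some g \<Rightarrow> [g]) [Suc k..<m]" for y
    by (intro map_cong) auto
  ultimately show "contents m (x(k := y)) = contents k x @ (case y of None \<Rightarrow> [] | Some g \<Rightarrow> [g]) @
      concat (map (\<lambda>k. case x k of None \<Rightarrow> [] | Some g \<Rightarrow> [g]) [Suc k..<m])" for y
    by (simp only: fun_upd_same)
qed simp

lemma contents_Some:
  assumes "k < m" "x k = Some g"
  obtains us vs where "contents m x = us @ g # vs" "contents m (x(k := None)) = us @ vs"
    "\<And>y. contents m (x(k := Some y)) = us @ y # vs" "us = contents k x"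
proof -
  obtain us vs where u: "\<And>y. contents m (x(k := y)) = us @ (case y of None \<Rightarrow> [] | Some g \<Rightarrow> [g]) @ vs"
    "us = contents k x"
    using contents_split[OF assms(1)] by blast
  have "x(k := Some g) = x" using assms by auto
  then show thesis
    using that[of us vs] u(1)[of "Some g"] u(1)[of None] u(1)[of "Some _"] u(2) by simp
qed

lemma creation_nonzero_mset: "creation p m w x \<noteq> 0 \<Longrightarrow> mset (contents m x) = mset w"
proof (induction p m w x rule: creation.induct)
  case (1 p m x)
  then have "x = (\<lambda>_. None)" by (auto simp: vacuum_def split: if_splits)
  then show ?case by (simp add: contents_def)
next
  case (2 p m i j r w x)
  then obtain k where k: "k < m" "x k = Some (i, j, r)" "creation p m w (x(k := None)) \<noteq> 0"
    by (auto elim!: sum.not_neutral_contains_not_neutral split: if_splits)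
  then have "mset (contents m (x(k := None))) = mset w"
    using 2 by blast
  with contents_Some[of k m x "(i, j, r)", OF k(1,2)] show ?case
    by (metis add_mset_add_single mset.simps(2) mset_append union_mset_add_mset_right)
qed

text \<open>A letter either fills an empty slot or multiplies into an occupied one, and the latter
  does not increase the number of occupied slots. If the word has no more letters than
  \<open>x\<close> has occupied slots, no letter can be spent on an occupied slot.\<close>

lemma word_sum_site_eq_creation:
  assumes "length w \<le> length (contents m x)" "set w \<subseteq> gens_over I"
  shows "app (word_op (sum_site p m) w) vacuum x = creation p m w x"
  using assms
proof (induction w arbitrary: x)
  case Nil
  then show ?case by (simp add: word_op_simps app_1)
next
  case (Cons g w)
  obtain i j r where g: "g = (i, j, r)" by (cases g)
  have r: "r \<noteq> 0" using Cons.prems g by (auto simp: gens_over_def)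
  let ?f = "app (word_op (sum_site p m) w) vacuum"
  have "app (site_op p k i j r) ?f x =
      (if x k = Some (i, j, r) then (-1) ^ ((p i + p j) * spar p k x) * creation p m w (x(k := None)) else 0)"
    if "k < m" for k
  proof (cases "x k")
    case None
    then show ?thesis using r by (simp add: site_op.rep_eq site_fun_def)
  next
    case (Some y)
    obtain us vs where u: "contents m x = us @ y # vs" "contents m (x(k := None)) = us @ vs"
      "\<And>y. contents m (x(k := Some y)) = us @ y # vs"
      using contents_Some[of k m x y, OF \<open>k < m\<close> Some] by metis
    have "?f (x(k := None)) = creation p m w (x(k := None))"
      using Cons.prems u by (intro Cons.IH) (auto simp del: fun_upd_apply)
    \<comment> \<open>Here \<open>g\<close> would have been multiplied into the slot
      \<open>k\<close>. The shorter word \<open>w\<close> would then have to fill as many slots as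
      \<open>x\<close> has, which \<open>creation_nonzero_mset\<close> excludes.\<close>
    moreover have "?f (x(k := Some z)) = 0" for z
    proof -
      have "?f (x(k := Some z)) = creation p m w (x(k := Some z))"
        using Cons.prems u by (intro Cons.IH) (auto simp del: fun_upd_apply)
      moreover have "length (contents m (x(k := Some z))) \<noteq> length w"
        using Cons.prems u by (auto simp del: fun_upd_apply)
      ultimately show ?thesis
        using creation_nonzero_mset mset_eq_length by metis
    qed
    ultimately show ?thesis
      using r Some by (cases y) (auto simp: site_op.rep_eq site_fun_def)
  qed
  then show ?case
    unfolding g word_op_simps app_mult by (simp add: sum_site_def app_sum)
qed

section \<open>Normal words and their linear independence\<close>

definition gen_odd :: "(nat \<Rightarrow> nat) \<Rightarrow> ygen \<Rightarrow> bool" where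
  "gen_odd p = (\<lambda>(i, j, r). odd (p i + p j))"

definition normal_word :: "(nat \<Rightarrow> nat) \<Rightarrow> ygen list \<Rightarrow> bool" where
  "normal_word p w \<longleftrightarrow> (\<exists>u v. w = u @ v \<and> sorted u \<and> (\<forall>g\<in>set u. \<not> gen_odd p g) \<and>
     sorted v \<and> distinct v \<and> (\<forall>g\<in>set v. gen_odd p g))"

text \<open>At top degree the action on the vacuum determines only the multiset of the letters.
  Sorting both halves makes a normal word recoverable from this multiset.\<close>

lemma normal_word_filter:
  assumes "normal_word p w"
  shows "w = sorted_list_of_multiset (filter_mset (\<lambda>g. \<not> gen_odd p g) (mset w)) @
    sorted_list_of_multiset (filter_mset (gen_odd p) (mset w))"
proof -
  obtain u v where uv: "w = u @ v" "sorted u" "\<forall>g\<in>set u. \<not> gen_odd p g" "sorted v" "\<forall>g\<in>set v. gen_odd p g"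
    using assms by (auto simp: normal_word_def)
  have "filter (\<lambda>g. \<not> gen_odd p g) w = u" "filter (gen_odd p) w = v"
    using uv by (auto simp: filter_id_conv filter_empty_conv)
  then have "filter_mset (\<lambda>g. \<not> gen_odd p g) (mset w) = mset u" "filter_mset (gen_odd p) (mset w) = mset v"
    by (metis mset_filter)+
  then show ?thesis
    using uv by (simp add: sorted_sort_id sorted_list_of_multiset_mset)
qed

lemma normal_word_mset_inj: "normal_word p w \<Longrightarrow> normal_word p w' \<Longrightarrow> mset w = mset w' \<Longrightarrow> w = w'"
  using normal_word_filter by metis

text \<open>
  Every term of the coefficient has sign \<open>+\<close>: an even letter produces no sign, and an odd letter is
  created to the left of all odd letters that are present already.
\<close>

lemma creation_pos:
  assumes "mset (contents m x) = mset (u @ v)" "filter (gen_odd p) (contents m x) = v"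
    and "\<forall>g\<in>set u. \<not> gen_odd p g" "\<forall>g\<in>set v. gen_odd p g" "distinct v"
    and "\<forall>k\<ge>m. x k = None"
  shows "\<exists>n>0. creation p m (u @ v) x = of_nat n"
  using assms
proof (induction "length u + length v" arbitrary: u v x)
  case 0
  then have c: "contents m x = []" by simp
  have "x k = None" for k
  proof (cases "k < m")
    case True
    then show ?thesis
      using c by (cases "x k") (auto simp: contents_def dest!: bspec[of _ _ k])
  qed (use 0 in simp)
  then have "x = (\<lambda>_. None)" by auto
  then show ?case using 0 by (auto simp: vacuum_def intro!: exI[of _ 1])
next
  case (Suc L)
  obtain g u' v' where w: "u @ v = g # u' @ v'" "if u = [] then u' = [] \<and> v = g # v' else u = g # u' \<and> v' = v"
    using Suc.hyps(2) by (cases u; cases v) auto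
  obtain i j r where g: "g = (i, j, r)" by (cases g)
  have step: "(-1 :: complex) ^ ((p i + p j) * spar p k x) = 1 \<and>
      (\<exists>n>0. creation p m (u' @ v') (x(k := None)) = of_nat n)"
    if k: "k < m" "x k = Some g" for k
  proof -
    obtain us vs where uv: "contents m x = us @ g # vs" "contents m (x(k := None)) = us @ vs" "us = contents k x"
      using contents_Some[of k m x g, OF k] by metis
    have ms: "mset (contents m (x(k := None))) = mset (u' @ v')"
      using uv Suc.prems(1) w(1) by simp
    have both: "(-1 :: complex) ^ ((p i + p j) * spar p k x) = 1 \<and>
        filter (gen_odd p) (contents m (x(k := None))) = v'"
    \<comment> \<open>Once the even letters have been taken out, \<open>g\<close> is the first of
      the odd letters, and these stand in \<open>x\<close> in the order of \<open>v\<close>. No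
      occupied slot lies to the left of \<open>k\<close>, so the Koszul exponent is 0.\<close>
    proof (cases "u = []")
      case True
      then have v: "v = g # v'" "u' = []" using w by auto
      have "set (contents m x) = set v"
        using Suc.prems(1) True by (metis append_Nil set_mset_mset)
      then have all: "filter (gen_odd p) (contents m x) = contents m x"
        using Suc.prems(4) by (auto intro: filter_True)
      then have c: "us @ g # vs = g # v'" using uv Suc.prems(2) v by simp
      \<comment> \<open>A nonempty \<open>us\<close> would begin with \<open>g\<close>, and
        \<open>g\<close> would then occur again at the slot \<open>k\<close>, against the
        distinctness of \<open>v\<close>.\<close>
      have us: "us = []"
      proof (cases us)
        case (Cons a us')
        then show ?thesis using c Suc.prems(5) v by auto
      qed
      have "x l = None" if "l < k" for l
        using us uv(3) that by (cases "x l") (auto simp: contents_def dest!: bspec[of _ _ l])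
      then have "spar p k x = 0" by (simp add: spar_def opar_def)
      moreover have "vs = v'" using c us by simp
      ultimately show ?thesis using uv us all Suc.prems(4) v by (simp add: filter_True)
    next
      case False
      then have "\<not> gen_odd p g" "v' = v" using w Suc.prems(3) by auto
      then show ?thesis using uv Suc.prems(2) by (auto simp: gen_odd_def g minus_one_power_iff)
    qed
    have "\<exists>n>0. creation p m (u' @ v') (x(k := None)) = of_nat n"
    proof (rule Suc.hyps(1))
      show "L = length u' + length v'"
        using Suc.hyps(2) w by (auto split: if_splits)
      show "\<forall>g\<in>set u'. \<not> gen_odd p g" "\<forall>g\<in>set v'. gen_odd p g" "distinct v'"
        using w Suc.prems(3-5) by (auto split: if_splits)
      show "\<forall>l\<ge>m. (x(k := None)) l = None" using Suc.prems(6) by simp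
    qed (use both ms in auto)
    then show ?thesis using both by blast
  qed
  have "\<exists>n. k < m \<longrightarrow> x k = Some g \<longrightarrow> 0 < n \<and>
      (-1) ^ ((p i + p j) * spar p k x) * creation p m (u' @ v') (x(k := None)) = of_nat n" for k
  proof (cases "k < m \<and> x k = Some g")
    case True
    then obtain n where "n > 0" "creation p m (u' @ v') (x(k := None)) = of_nat n"
      "(-1 :: complex) ^ ((p i + p j) * spar p k x) = 1"
      using step[of k] by blast
    then have "(-1) ^ ((p i + p j) * spar p k x) * creation p m (u' @ v') (x(k := None)) = of_nat n"
      by (simp only: mult_1_left)
    then show ?thesis using \<open>n > 0\<close> by blast
  qed blast
  then obtain N where N: "\<And>k. k < m \<Longrightarrow> x k = Some g \<Longrightarrow> 0 < N k \<and>
      (-1) ^ ((p i + p j) * spar p k x) * creation p m (u' @ v') (x(k := None)) = of_nat (N k)"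
    by metis
  have "creation p m (u @ v) x = (\<Sum>k<m. if x k = Some g then of_nat (N k) else 0)"
    unfolding w(1) g creation.simps using N by (intro sum.cong) (auto simp: g)
  also have "\<dots> = of_nat (\<Sum>k<m. if x k = Some g then N k else 0)"
    unfolding of_nat_sum by (intro sum.cong) auto
  finally have e: "creation p m (u @ v) x = of_nat (\<Sum>k<m. if x k = Some g then N k else 0)" .
  have "g \<in> set (contents m x)"
    using Suc.prems(1) w(1) by (metis list.set_intros(1) set_mset_mset)
  then obtain k where k: "k < m" "x k = Some g"
    by (auto simp: contents_def split: option.splits)
  then have "(\<Sum>k<m. if x k = Some g then N k else 0) > 0"
    using N[OF k] by (intro sum_pos2[of _ k]) auto
  then show ?case using e by blast
qed

text \<open>The number \<open>m\<close> of sites is chosen after \<open>f\<close>: it is the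
  representations for all \<open>m\<close> together that separate the normal combinations.\<close>

theorem normal_words_independent:
  fixes f :: "ygen list \<Rightarrow>\<^sub>0 complex"
  assumes I: "finite I" and f: "f \<noteq> 0"
    and keys: "\<And>w. w \<in> Poly_Mapping.keys f \<Longrightarrow> normal_word p w \<and> set w \<subseteq> gens_over I"
  obtains m x where "(\<Sum>w\<in>Poly_Mapping.keys f.
    Poly_Mapping.lookup f w * app (word_op (multi_site p I m) w) vacuum x) \<noteq> 0"
proof -
  let ?K = "Poly_Mapping.keys f"
  define D where "D = Max (zword ` ?K)"
  have K: "finite ?K" "?K \<noteq> {}" using f by auto
  have D: "D \<in> zword ` ?K" "\<And>w. w \<in> ?K \<Longrightarrow> zword w \<le> D"
    unfolding D_def using K by auto
  define K' where "K' = {w \<in> ?K. zword w = D}"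
  have K': "finite K'" "K' \<noteq> {}" using K D(1) by (auto simp: K'_def)
  define m where "m = Max (length ` K')"
  have m: "m \<in> length ` K'" "\<And>w. w \<in> K' \<Longrightarrow> length w \<le> m"
    unfolding m_def using K' by auto
  then obtain w0 where w0: "w0 \<in> ?K" "zword w0 = D" "length w0 = m"
    by (auto simp: K'_def)
  \<comment> \<open>The letters of \<open>w0\<close> in order, one on each site; the odd ones then
    appear from left to right as in \<open>w0\<close>, which \<open>creation_pos\<close>
    requires.\<close>
  define x where "x = (\<lambda>k. if k < m then Some (w0 ! k) else None)"
  have cx: "contents m x = w0"
  proof -
    have "contents m x = concat (map (\<lambda>k. [w0 ! k]) [0..<m])"
      unfolding contents_def by (intro arg_cong[of _ _ concat] map_cong) (auto simp: x_def)
    also have "\<dots> = map (\<lambda>k. w0 ! k) [0..<m]" by (induction m) auto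
    finally show ?thesis using w0(3) map_nth by metis
  qed
  have xm: "\<forall>k\<ge>m. x k = None" by (simp add: x_def)
  have zx: "zdeg m x = D"
  proof -
    have "zdeg m x = (\<Sum>k<m. (case w0 ! k of (i, j, r) \<Rightarrow> int r - 1))"
      unfolding zdeg_def x_def by (intro sum.cong) auto
    also have "\<dots> = zword w0"
      unfolding zword_def using w0(3) by (simp add: sum_list_sum_nth atLeast0LessThan)
    finally show ?thesis using w0 by simp
  qed
  \<comment> \<open>A word of smaller z-degree does not reach \<open>x\<close>. A word of the same
    z-degree has at most \<open>m\<close> letters, so only creation counts, and this forces the
    multiset of its letters to be that of \<open>w0\<close>.\<close>
  have other: "app (word_op (multi_site p I m) w) vacuum x = 0" if w: "w \<in> ?K" "w \<noteq> w0" for w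
  proof (cases "zword w = D")
    case False
    then have "zword w < D" using D w by force
    then show ?thesis
      using zbounded_word(1)[of w I m p] keys[OF w(1)] I zx unfolding zbounded_def by force
  next
    case True
    then have "app (word_op (multi_site p I m) w) vacuum x = app (word_op (sum_site p m) w) vacuum x"
      using zbounded_word(2)[of w I m p] keys[OF w(1)] I zx unfolding zbounded_def by force
    also have "\<dots> = creation p m w x"
      using True w m(2) keys[OF w(1)] w0(3) by (intro word_sum_site_eq_creation) (auto simp: cx K'_def)
    also have "\<dots> = 0"
      using creation_nonzero_mset[of p m w x] cx normal_word_mset_inj keys w w0 by metis
    finally show ?thesis .
  qed
  have this_w: "app (word_op (multi_site p I m) w0) vacuum x \<noteq> 0"
  proof -
    have "app (word_op (multi_site p I m) w0) vacuum x = app (word_op (sum_site p m) w0) vacuum x"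
      using zbounded_word(2)[of w0 I m p] keys[OF w0(1)] I zx w0 unfolding zbounded_def by force
    also have "\<dots> = creation p m w0 x"
      using keys[OF w0(1)] by (intro word_sum_site_eq_creation) (auto simp: cx)
    finally have e: "app (word_op (multi_site p I m) w0) vacuum x = creation p m w0 x" .
    obtain u v where uv: "w0 = u @ v" "\<forall>g\<in>set u. \<not> gen_odd p g" "distinct v" "\<forall>g\<in>set v. gen_odd p g"
      using keys[OF w0(1)] by (auto simp: normal_word_def)
    then have "\<exists>n>0. creation p m (u @ v) x = of_nat n"
      using xm by (intro creation_pos) (auto simp: cx filter_empty_conv filter_id_conv)
    then show ?thesis using e uv(1) by auto
  qed
  have "(\<Sum>w\<in>?K. Poly_Mapping.lookup f w * app (word_op (multi_site p I m) w) vacuum x) =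
    Poly_Mapping.lookup f w0 * app (word_op (multi_site p I m) w0) vacuum x"
    unfolding sum.remove[OF K(1) w0(1)] by (subst sum.neutral) (use other in auto)
  then have "(\<Sum>w\<in>?K. Poly_Mapping.lookup f w * app (word_op (multi_site p I m) w) vacuum x) \<noteq> 0"
    using this_w w0(1) by (simp add: in_keys_iff)
  then show thesis by (rule that)
qed

section \<open>Algebras, quotients and monoid algebras\<close>

lemma complex_ring_simps [simp]:
  "carrier complex_ring = UNIV" "mult complex_ring = (*)" "one complex_ring = 1"
  "zero complex_ring = 0" "add complex_ring = (+)"
  by (simp_all add: complex_ring_def)

lemma cring_complex_ring: "cring complex_ring"
proof (rule cringI)
  show "abelian_group complex_ring"
  proof (rule abelian_groupI)
    fix x :: complex
    show "\<exists>y\<in>carrier complex_ring. y \<oplus>\<^bsub>complex_ring\<^esub> x = \<zero>\<^bsub>complex_ring\<^esub>"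
      by (intro bexI[of _ "- x"]) auto
  qed auto
  show "Group.comm_monoid complex_ring"
    by (rule comm_monoidI) auto
qed (auto simp: algebra_simps)

locale complex_algebra =
  fixes A :: "(complex, 'a) module" (structure)
  assumes assoc_algebra: "assoc_algebra A"
begin

sublocale ring A
  using assoc_algebra by (simp add: assoc_algebra_def)

sublocale mod: module complex_ring A
  using assoc_algebra by (simp add: assoc_algebra_def)

lemma smult_closedC [simp, intro]: "x \<in> carrier A \<Longrightarrow> c \<odot> x \<in> carrier A"
  by (rule mod.smult_closed) simp_all

lemma smult_l_distrC: "x \<in> carrier A \<Longrightarrow> (a + b) \<odot> x = a \<odot> x \<oplus> b \<odot> x"
  using mod.smult_l_distr[of a b x] by simp

lemma smult_r_distrC: "x \<in> carrier A \<Longrightarrow> y \<in> carrier A \<Longrightarrow> a \<odot> (x \<oplus> y) = a \<odot> x \<oplus> a \<odot> y"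
  using mod.smult_r_distr[of a x y] by simp

lemma smult_assocC: "x \<in> carrier A \<Longrightarrow> (a * b) \<odot> x = a \<odot> (b \<odot> x)"
  using mod.smult_assoc1[of a b x] by simp

lemma smult_oneC [simp]: "x \<in> carrier A \<Longrightarrow> 1 \<odot> x = x"
  using mod.smult_one[of x] by simp

lemma smult_mult_left: "x \<in> carrier A \<Longrightarrow> y \<in> carrier A \<Longrightarrow> (c \<odot> x) \<otimes> y = c \<odot> (x \<otimes> y)"
  and smult_mult_right: "x \<in> carrier A \<Longrightarrow> y \<in> carrier A \<Longrightarrow> x \<otimes> (c \<odot> y) = c \<odot> (x \<otimes> y)"
  using assoc_algebra by (auto simp: assoc_algebra_def)

lemma smult_zero_left [simp]: "x \<in> carrier A \<Longrightarrow> 0 \<odot> x = \<zero>"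
  using mod.smult_l_null[of x] by simp

lemma smult_zero_right [simp]: "c \<odot> \<zero> = \<zero>"
  using mod.smult_r_null[of c] by simp

lemma smult_minus_one: "x \<in> carrier A \<Longrightarrow> (-1) \<odot> x = \<ominus> x"
proof -
  assume x: "x \<in> carrier A"
  have "(-1) \<odot> x \<oplus> x = (-1 + 1) \<odot> x" using x smult_l_distrC[of x "-1" 1] by simp
  also have "\<dots> = \<zero>" using x by simp
  finally show ?thesis using x minus_equality[of "(-1) \<odot> x" x] by simp
qed

lemma smult_via_mult: "x \<in> carrier A \<Longrightarrow> c \<odot> x = (c \<odot> \<one>) \<otimes> x"
  by (simp add: smult_mult_left)

text \<open>Scalars act through multiples of the unit, so ring ideals are subspaces, and the ideals
  of HOL-Algebra suffice for algebras.\<close>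

lemma ideal_smult_closed: "ideal I A \<Longrightarrow> x \<in> I \<Longrightarrow> c \<odot> x \<in> I"
  by (metis ideal.I_l_closed ideal.Icarr one_closed smult_closedC smult_via_mult)

end

definition alg_hom :: "(complex, 'a) module \<Rightarrow> (complex, 'b) module \<Rightarrow> ('a \<Rightarrow> 'b) set" where
  "alg_hom A B = {h \<in> ring_hom A B. \<forall>c. \<forall>x\<in>carrier A. h (c \<odot>\<^bsub>A\<^esub> x) = c \<odot>\<^bsub>B\<^esub> h x}"

lemma alg_homI:
  assumes "\<And>x. x \<in> carrier A \<Longrightarrow> h x \<in> carrier B"
    "\<And>x y. x \<in> carrier A \<Longrightarrow> y \<in> carrier A \<Longrightarrow> h (x \<otimes>\<^bsub>A\<^esub> y) = h x \<otimes>\<^bsub>B\<^esub> h y"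
    "\<And>x y. x \<in> carrier A \<Longrightarrow> y \<in> carrier A \<Longrightarrow> h (x \<oplus>\<^bsub>A\<^esub> y) = h x \<oplus>\<^bsub>B\<^esub> h y"
    "h \<one>\<^bsub>A\<^esub> = \<one>\<^bsub>B\<^esub>"
    "\<And>c x. x \<in> carrier A \<Longrightarrow> h (c \<odot>\<^bsub>A\<^esub> x) = c \<odot>\<^bsub>B\<^esub> h x"
  shows "h \<in> alg_hom A B"
  using assms unfolding alg_hom_def by (auto intro: ring_hom_memI)

lemma alg_homD:
  assumes "h \<in> alg_hom A B"
  shows "\<And>x. x \<in> carrier A \<Longrightarrow> h x \<in> carrier B"
    "\<And>x y. x \<in> carrier A \<Longrightarrow> y \<in> carrier A \<Longrightarrow> h (x \<otimes>\<^bsub>A\<^esub> y) = h x \<otimes>\<^bsub>B\<^esub> h y"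
    "\<And>x y. x \<in> carrier A \<Longrightarrow> y \<in> carrier A \<Longrightarrow> h (x \<oplus>\<^bsub>A\<^esub> y) = h x \<oplus>\<^bsub>B\<^esub> h y"
    "h \<one>\<^bsub>A\<^esub> = \<one>\<^bsub>B\<^esub>"
    "\<And>c x. x \<in> carrier A \<Longrightarrow> h (c \<odot>\<^bsub>A\<^esub> x) = c \<odot>\<^bsub>B\<^esub> h x"
  using assms unfolding alg_hom_def by (auto simp: ring_hom_closed ring_hom_mult ring_hom_add ring_hom_one)

lemma alg_hom_comp: "h \<in> alg_hom A B \<Longrightarrow> k \<in> alg_hom B C \<Longrightarrow> (\<lambda>x. k (h x)) \<in> alg_hom A C"
  by (rule alg_homI) (auto simp: alg_homD)

lemma alg_hom_ring_hom_ring: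
  assumes "assoc_algebra A" "assoc_algebra B" "h \<in> alg_hom A B"
  shows "ring_hom_ring A B h"
  using assms by (intro ring_hom_ringI2) (auto simp: assoc_algebra_def alg_hom_def)

lemma alg_hom_zero_minus:
  assumes "assoc_algebra A" "assoc_algebra B" "h \<in> alg_hom A B"
  shows "h \<zero>\<^bsub>A\<^esub> = \<zero>\<^bsub>B\<^esub>"
    "x \<in> carrier A \<Longrightarrow> h (\<ominus>\<^bsub>A\<^esub> x) = \<ominus>\<^bsub>B\<^esub> h x"
    "x \<in> carrier A \<Longrightarrow> y \<in> carrier A \<Longrightarrow> h (x \<ominus>\<^bsub>A\<^esub> y) = h x \<ominus>\<^bsub>B\<^esub> h y"
proof -
  interpret ring_hom_ring A B h by (rule alg_hom_ring_hom_ring[OF assms])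
  show "h \<zero>\<^bsub>A\<^esub> = \<zero>\<^bsub>B\<^esub>" "x \<in> carrier A \<Longrightarrow> h (\<ominus>\<^bsub>A\<^esub> x) = \<ominus>\<^bsub>B\<^esub> h x" by simp_all
  show "x \<in> carrier A \<Longrightarrow> y \<in> carrier A \<Longrightarrow> h (x \<ominus>\<^bsub>A\<^esub> y) = h x \<ominus>\<^bsub>B\<^esub> h y"
    by (simp add: a_minus_def)
qed

text \<open>The kernel is an ideal. In this form the universal property of a presentation is used
  for the Yangian, the parity automorphism, tensor products and exterior algebras.\<close>

lemma alg_hom_vanish_genideal:
  assumes "assoc_algebra A" "assoc_algebra B" "h \<in> alg_hom A B"
    and "G \<subseteq> carrier A" "\<And>g. g \<in> G \<Longrightarrow> h g = \<zero>\<^bsub>B\<^esub>" and x: "x \<in> Idl\<^bsub>A\<^esub> G"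
  shows "h x = \<zero>\<^bsub>B\<^esub>"
proof -
  interpret ring_hom_ring A B h by (rule alg_hom_ring_hom_ring[OF assms(1-3)])
  have "G \<subseteq> a_kernel A B h"
    unfolding a_kernel_def' using assms(4,5) by blast
  then have "Idl\<^bsub>A\<^esub> G \<subseteq> a_kernel A B h"
    by (rule R.genideal_minimal[OF kernel_is_ideal])
  then have "x \<in> a_kernel A B h"
    using x by (rule subsetD)
  then show ?thesis unfolding a_kernel_def' by blast
qed

text \<open>The axioms are transported along a surjection, so they are verified once for quotient
  algebras and for the graded algebra, whose operations are defined through representatives.\<close>

lemma assoc_algebra_image:
  fixes A :: "(complex, 'a) module" and B :: "(complex, 'b) module"
  assumes "assoc_algebra A" and onto: "carrier B = \<phi> ` carrier A"
    and mult: "\<And>x y. x \<in> carrier A \<Longrightarrow> y \<in> carrier A \<Longrightarrow> \<phi> x \<otimes>\<^bsub>B\<^esub> \<phi> y = \<phi> (x \<otimes>\<^bsub>A\<^esub> y)"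
    and add: "\<And>x y. x \<in> carrier A \<Longrightarrow> y \<in> carrier A \<Longrightarrow> \<phi> x \<oplus>\<^bsub>B\<^esub> \<phi> y = \<phi> (x \<oplus>\<^bsub>A\<^esub> y)"
    and one: "\<one>\<^bsub>B\<^esub> = \<phi> \<one>\<^bsub>A\<^esub>" and zero: "\<zero>\<^bsub>B\<^esub> = \<phi> \<zero>\<^bsub>A\<^esub>"
    and smult: "\<And>c x. x \<in> carrier A \<Longrightarrow> c \<odot>\<^bsub>B\<^esub> \<phi> x = \<phi> (c \<odot>\<^bsub>A\<^esub> x)"
  shows "assoc_algebra B" "\<phi> \<in> alg_hom A B"
proof -
  interpret A: complex_algebra A by unfold_locales fact
  have ab: "abelian_group B"
  proof (rule abelian_groupI)
    fix x assume "x \<in> carrier B"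
    then obtain a where a: "a \<in> carrier A" "x = \<phi> a" by (auto simp: onto)
    then have "\<phi> (\<ominus>\<^bsub>A\<^esub> a) \<oplus>\<^bsub>B\<^esub> x = \<zero>\<^bsub>B\<^esub>" by (simp add: add zero A.l_neg)
    then show "\<exists>y\<in>carrier B. y \<oplus>\<^bsub>B\<^esub> x = \<zero>\<^bsub>B\<^esub>" using a by (auto simp: onto)
  qed (auto simp: onto add zero A.a_assoc intro!: arg_cong[of _ _ \<phi>] A.a_comm)
  have mon: "Group.monoid B"
    by (rule monoidI) (auto simp: onto mult one A.m_assoc)
  have "ring B"
    by (rule ringI[OF ab mon]) (auto simp: onto mult add A.l_distr A.r_distr)
  moreover have "module complex_ring B"
    by (rule moduleI[OF cring_complex_ring ab])
      (auto simp: onto mult add smult A.smult_l_distrC A.smult_r_distrC A.smult_assocC)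
  ultimately show "assoc_algebra B"
    unfolding assoc_algebra_def by (auto simp: onto mult smult A.smult_mult_left A.smult_mult_right)
  show "\<phi> \<in> alg_hom A B"
    by (rule alg_homI) (auto simp: onto mult add one smult)
qed

lemma quot_algebra_simps:
  "carrier (quot_algebra A I) = a_rcosets\<^bsub>A\<^esub> I" "mult (quot_algebra A I) = rcoset_mult A I"
  "one (quot_algebra A I) = I +>\<^bsub>A\<^esub> \<one>\<^bsub>A\<^esub>" "zero (quot_algebra A I) = I" "add (quot_algebra A I) = set_add A"
  "smult (quot_algebra A I) = (\<lambda>c C. \<Union>x\<in>C. I +>\<^bsub>A\<^esub> (c \<odot>\<^bsub>A\<^esub> x))"
  by (simp_all add: quot_algebra_def FactRing_def ring.defs module.defs)

context
  fixes A :: "(complex, 'a) module" and I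
  assumes A: "assoc_algebra A" and I: "ideal I A"
begin

interpretation complex_algebra A by unfold_locales (rule A)
interpretation ideal I A by (rule I)

lemma rcos_eq_iff: "x \<in> carrier A \<Longrightarrow> y \<in> carrier A \<Longrightarrow> I +>\<^bsub>A\<^esub> x = I +>\<^bsub>A\<^esub> y \<longleftrightarrow> x \<ominus>\<^bsub>A\<^esub> y \<in> I"
  using quotient_eq_iff_same_a_r_cos[OF I] by auto

text \<open>The union in \<open>quot_algebra\<close> runs over cosets which all coincide.\<close>

lemma quot_smult: "x \<in> carrier A \<Longrightarrow> (\<Union>y\<in>I +>\<^bsub>A\<^esub> x. I +>\<^bsub>A\<^esub> (c \<odot>\<^bsub>A\<^esub> y)) = I +>\<^bsub>A\<^esub> (c \<odot>\<^bsub>A\<^esub> x)"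
proof -
  assume x: "x \<in> carrier A"
  have "I +>\<^bsub>A\<^esub> (c \<odot>\<^bsub>A\<^esub> y) = I +>\<^bsub>A\<^esub> (c \<odot>\<^bsub>A\<^esub> x)" if y: "y \<in> I +>\<^bsub>A\<^esub> x" for y
  proof -
    obtain i where i: "i \<in> I" "y = i \<oplus>\<^bsub>A\<^esub> x" using y by (auto simp: a_r_coset_def')
    then have "c \<odot>\<^bsub>A\<^esub> y = c \<odot>\<^bsub>A\<^esub> i \<oplus>\<^bsub>A\<^esub> c \<odot>\<^bsub>A\<^esub> x" using x by (simp add: smult_r_distrC)
    then have "c \<odot>\<^bsub>A\<^esub> y \<in> I +>\<^bsub>A\<^esub> (c \<odot>\<^bsub>A\<^esub> x)"
      using i ideal_smult_closed[OF I] by (auto simp: a_r_coset_def')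
    then show ?thesis using x a_repr_independence' by (metis smult_closedC)
  qed
  moreover have "x \<in> I +>\<^bsub>A\<^esub> x" using x a_rcos_self by blast
  ultimately show ?thesis by blast
qed

lemma quot_algebra_proj:
  shows "assoc_algebra (quot_algebra A I)" "(\<lambda>x. I +>\<^bsub>A\<^esub> x) \<in> alg_hom A (quot_algebra A I)"
    "carrier (quot_algebra A I) = (\<lambda>x. I +>\<^bsub>A\<^esub> x) ` carrier A"
proof -
  show c: "carrier (quot_algebra A I) = (\<lambda>x. I +>\<^bsub>A\<^esub> x) ` carrier A"
    unfolding quot_algebra_simps A_RCOSETS_def' by auto
  have z: "I = I +>\<^bsub>A\<^esub> \<zero>\<^bsub>A\<^esub>" using a_rcos_zero[OF I] additive_subgroup.zero_closed[OF ideal.axioms(1)[OF I]] by simp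
  show "assoc_algebra (quot_algebra A I)" "(\<lambda>x. I +>\<^bsub>A\<^esub> x) \<in> alg_hom A (quot_algebra A I)"
    using assoc_algebra_image[OF A c] z by (simp_all add: quot_algebra_simps rcoset_mult_add a_rcos_sum quot_smult)
qed

lemma quot_algebra_lift:
  assumes B: "assoc_algebra B" and h: "h \<in> alg_hom A B" and hI: "\<And>x. x \<in> I \<Longrightarrow> h x = \<zero>\<^bsub>B\<^esub>"
  obtains k where "k \<in> alg_hom (quot_algebra A I) B" "\<And>x. x \<in> carrier A \<Longrightarrow> k (I +>\<^bsub>A\<^esub> x) = h x"
proof
  interpret B: complex_algebra B by unfold_locales (rule B)
  \<comment> \<open>\<open>h\<close> is constant on each coset, so the image of a coset is a
    singleton.\<close>
  define k where "k = (\<lambda>C. the_elem (h ` C))"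
  show k: "k (I +>\<^bsub>A\<^esub> x) = h x" if x: "x \<in> carrier A" for x
  proof -
    have "h y = h x" if y: "y \<in> I +>\<^bsub>A\<^esub> x" for y
    proof -
      obtain i where i: "i \<in> I" "y = i \<oplus>\<^bsub>A\<^esub> x" using y by (auto simp: a_r_coset_def')
      then show ?thesis using x alg_homD[OF h] hI[of i] by (simp add: Icarr)
    qed
    then have "h ` (I +>\<^bsub>A\<^esub> x) = {h x}" using a_rcos_self[OF x] by blast
    then show ?thesis by (simp add: k_def)
  qed
  let ?Q = "quot_algebra A I"
  note p = alg_homD[OF quot_algebra_proj(2)]
  have rep: "\<exists>x\<in>carrier A. X = I +>\<^bsub>A\<^esub> x" if "X \<in> carrier ?Q" for X
    using that unfolding quot_algebra_proj(3) by blast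
  show "k \<in> alg_hom ?Q B"
  proof (rule alg_homI)
    fix X assume "X \<in> carrier ?Q"
    then obtain x where x: "x \<in> carrier A" "X = I +>\<^bsub>A\<^esub> x" using rep by blast
    then show "k X \<in> carrier B" by (simp add: k alg_homD(1)[OF h])
    show "k (c \<odot>\<^bsub>?Q\<^esub> X) = c \<odot>\<^bsub>B\<^esub> k X" for c
      using x by (simp add: p(5)[symmetric] k alg_homD(5)[OF h])
    fix Y assume "Y \<in> carrier ?Q"
    then obtain y where y: "y \<in> carrier A" "Y = I +>\<^bsub>A\<^esub> y" using rep by blast
    show "k (X \<otimes>\<^bsub>?Q\<^esub> Y) = k X \<otimes>\<^bsub>B\<^esub> k Y"
      using x y by (simp add: p(2)[symmetric] k alg_homD(2)[OF h])
    show "k (X \<oplus>\<^bsub>?Q\<^esub> Y) = k X \<oplus>\<^bsub>B\<^esub> k Y"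
      using x y by (simp add: p(3)[symmetric] k alg_homD(3)[OF h])
  next
    show "k \<one>\<^bsub>?Q\<^esub> = \<one>\<^bsub>B\<^esub>" by (simp add: p(4)[symmetric] k alg_homD(4)[OF h])
  qed
qed

end

section \<open>Monoid algebras and their universal property\<close>

lemma lookup_scale: "Poly_Mapping.lookup (Poly_Mapping.map ((*) c) f) x = (c :: complex) * Poly_Mapping.lookup f x"
  by (simp add: Poly_Mapping.map.rep_eq when_def)

lemma scale_single: "Poly_Mapping.map ((*) c) (Poly_Mapping.single x a) = Poly_Mapping.single x ((c :: complex) * a)"
  by (rule poly_mapping_eqI) (simp add: lookup_scale lookup_single when_def)

lemma sum_monomials: "(\<Sum>x\<in>Poly_Mapping.keys f. Poly_Mapping.single x (Poly_Mapping.lookup f x)) = f"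
  by (rule poly_mapping_eqI) (auto simp: lookup_sum lookup_single when_def in_keys_iff sum.delta)

text \<open>Linear extension from a basis: what is additive needs a check only on multiples of the
  basis elements in \<open>K\<close>.\<close>

lemma poly_mapping_keys_induct [consumes 1, case_names zero single add]:
  fixes f :: "'a \<Rightarrow>\<^sub>0 'b::comm_monoid_add"
  assumes "Poly_Mapping.keys f \<subseteq> K" and "P 0" "\<And>x c. x \<in> K \<Longrightarrow> P (Poly_Mapping.single x c)"
    "\<And>f g. Poly_Mapping.keys f \<subseteq> K \<Longrightarrow> Poly_Mapping.keys g \<subseteq> K \<Longrightarrow> P f \<Longrightarrow> P g \<Longrightarrow> P (f + g)"
  shows "P f"
proof -
  have "Poly_Mapping.keys (\<Sum>x\<in>X. Poly_Mapping.single x (Poly_Mapping.lookup f x)) \<subseteq> K \<and>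
      P (\<Sum>x\<in>X. Poly_Mapping.single x (Poly_Mapping.lookup f x))"
    if "finite X" "X \<subseteq> K" for X
    using that
  proof (induction X)
    case (insert x X)
    let ?s = "Poly_Mapping.single x (Poly_Mapping.lookup f x)"
    have s: "Poly_Mapping.keys ?s \<subseteq> K" using insert by simp
    have "P (?s + (\<Sum>x\<in>X. Poly_Mapping.single x (Poly_Mapping.lookup f x)))"
      using insert s by (intro assms(4)[OF s _ assms(3)]) auto
    moreover have "Poly_Mapping.keys (?s + (\<Sum>x\<in>X. Poly_Mapping.single x (Poly_Mapping.lookup f x))) \<subseteq> K"
      using insert s Poly_Mapping.keys_add[of ?s "\<Sum>x\<in>X. Poly_Mapping.single x (Poly_Mapping.lookup f x)"]
      by auto
    ultimately show ?case using insert by simp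
  qed (simp add: assms(2))
  from this[of "Poly_Mapping.keys f"] show ?thesis using assms(1) by (simp add: sum_monomials)
qed

lemma monoid_algebra_simps:
  "carrier (monoid_algebra S) = {f. Poly_Mapping.keys f \<subseteq> carrier S}"
  "zero (monoid_algebra S) = 0" "add (monoid_algebra S) = (+)"
  "one (monoid_algebra S) = Poly_Mapping.single \<one>\<^bsub>S\<^esub> 1"
  "smult (monoid_algebra S) = (\<lambda>c. Poly_Mapping.map ((*) c))"
  by (simp_all add: monoid_algebra_def)

text \<open>Cancellation may shrink the support of a sum. Bilinearity is therefore proved with all
  products written over common finite supports.\<close>

lemma monoid_algebra_mult:
  assumes "finite X" "finite Y" "Poly_Mapping.keys f \<subseteq> X" "Poly_Mapping.keys g \<subseteq> Y"
  shows "f \<otimes>\<^bsub>monoid_algebra S\<^esub> g =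
    (\<Sum>x\<in>X. \<Sum>y\<in>Y. Poly_Mapping.single (x \<otimes>\<^bsub>S\<^esub> y) (Poly_Mapping.lookup f x * Poly_Mapping.lookup g y))"
proof -
  have "f \<otimes>\<^bsub>monoid_algebra S\<^esub> g = (\<Sum>x\<in>Poly_Mapping.keys f. \<Sum>y\<in>Poly_Mapping.keys g.
      Poly_Mapping.single (x \<otimes>\<^bsub>S\<^esub> y) (Poly_Mapping.lookup f x * Poly_Mapping.lookup g y))"
    by (simp add: monoid_algebra_def)
  also have "\<dots> = (\<Sum>x\<in>X. \<Sum>y\<in>Poly_Mapping.keys g.
      Poly_Mapping.single (x \<otimes>\<^bsub>S\<^esub> y) (Poly_Mapping.lookup f x * Poly_Mapping.lookup g y))"
    using assms by (intro sum.mono_neutral_left) (auto simp: in_keys_iff)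
  also have "\<dots> = (\<Sum>x\<in>X. \<Sum>y\<in>Y. Poly_Mapping.single (x \<otimes>\<^bsub>S\<^esub> y) (Poly_Mapping.lookup f x * Poly_Mapping.lookup g y))"
    using assms by (intro sum.cong refl sum.mono_neutral_left) (auto simp: in_keys_iff)
  finally show ?thesis .
qed

lemma monoid_algebra_distrib:
  "(f + f') \<otimes>\<^bsub>monoid_algebra S\<^esub> g = f \<otimes>\<^bsub>monoid_algebra S\<^esub> g + f' \<otimes>\<^bsub>monoid_algebra S\<^esub> g"
  "f \<otimes>\<^bsub>monoid_algebra S\<^esub> (g + g') = f \<otimes>\<^bsub>monoid_algebra S\<^esub> g + f \<otimes>\<^bsub>monoid_algebra S\<^esub> g'"
proof -
  define X where "X = Poly_Mapping.keys f \<union> Poly_Mapping.keys f'"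
  define Y where "Y = Poly_Mapping.keys g \<union> Poly_Mapping.keys g'"
  have X: "finite X" "Poly_Mapping.keys f \<subseteq> X" "Poly_Mapping.keys f' \<subseteq> X" "Poly_Mapping.keys (f + f') \<subseteq> X"
    using Poly_Mapping.keys_add[of f f'] by (auto simp: X_def)
  have Y: "finite Y" "Poly_Mapping.keys g \<subseteq> Y" "Poly_Mapping.keys g' \<subseteq> Y" "Poly_Mapping.keys (g + g') \<subseteq> Y"
    using Poly_Mapping.keys_add[of g g'] by (auto simp: Y_def)
  show "(f + f') \<otimes>\<^bsub>monoid_algebra S\<^esub> g = f \<otimes>\<^bsub>monoid_algebra S\<^esub> g + f' \<otimes>\<^bsub>monoid_algebra S\<^esub> g"
    using X Y by (simp add: monoid_algebra_mult[of X Y] lookup_add distrib_right single_add sum.distrib)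
  show "f \<otimes>\<^bsub>monoid_algebra S\<^esub> (g + g') = f \<otimes>\<^bsub>monoid_algebra S\<^esub> g + f \<otimes>\<^bsub>monoid_algebra S\<^esub> g'"
    using X Y by (simp add: monoid_algebra_mult[of X Y] lookup_add distrib_left single_add sum.distrib)
qed

lemma monoid_algebra_mult_single:
  "Poly_Mapping.single x a \<otimes>\<^bsub>monoid_algebra S\<^esub> Poly_Mapping.single y b = Poly_Mapping.single (x \<otimes>\<^bsub>S\<^esub> y) (a * b)"
  by (subst monoid_algebra_mult[of "{x}" "{y}"]) auto

lemma monoid_algebra_mult_zero:
  "0 \<otimes>\<^bsub>monoid_algebra S\<^esub> g = 0" "f \<otimes>\<^bsub>monoid_algebra S\<^esub> 0 = 0"
  by (simp_all add: monoid_algebra_def)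

definition ma_lift :: "(complex, 'b) module \<Rightarrow> ('a \<Rightarrow> 'b) \<Rightarrow> ('a \<Rightarrow>\<^sub>0 complex) \<Rightarrow> 'b" where
  "ma_lift B \<phi> f = (\<Oplus>\<^bsub>B\<^esub>x\<in>Poly_Mapping.keys f. Poly_Mapping.lookup f x \<odot>\<^bsub>B\<^esub> \<phi> x)"

context
  fixes S :: "('a, 'm) monoid_scheme"
  assumes S: "Group.monoid S"
begin

interpretation S: Group.monoid S by (rule S)

lemma monoid_algebra_closed:
  assumes "Poly_Mapping.keys f \<subseteq> carrier S" "Poly_Mapping.keys g \<subseteq> carrier S"
  shows "Poly_Mapping.keys (f \<otimes>\<^bsub>monoid_algebra S\<^esub> g) \<subseteq> carrier S"
  using assms(1)
proof (induction rule: poly_mapping_keys_induct)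
  case (single x c)
  show ?case using assms(2)
  proof (induction rule: poly_mapping_keys_induct)
    case (add f g)
    then show ?case unfolding monoid_algebra_distrib by (intro order_trans[OF Poly_Mapping.keys_add]) simp
  qed (use single in \<open>auto simp: monoid_algebra_mult_single monoid_algebra_mult_zero\<close>)
next
  case (add f g)
  then show ?case unfolding monoid_algebra_distrib by (intro order_trans[OF Poly_Mapping.keys_add]) simp
qed (simp add: monoid_algebra_mult_zero)

lemma monoid_algebra_assoc:
  assumes "Poly_Mapping.keys f \<subseteq> carrier S" "Poly_Mapping.keys g \<subseteq> carrier S" "Poly_Mapping.keys h \<subseteq> carrier S"
  shows "f \<otimes>\<^bsub>monoid_algebra S\<^esub> g \<otimes>\<^bsub>monoid_algebra S\<^esub> h = f \<otimes>\<^bsub>monoid_algebra S\<^esub> (g \<otimes>\<^bsub>monoid_algebra S\<^esub> h)"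
  using assms(1)
proof (induction rule: poly_mapping_keys_induct)
  case (single x c)
  show ?case using assms(2)
  proof (induction rule: poly_mapping_keys_induct)
    case (single y d)
    show ?case using assms(3)
      by (induction rule: poly_mapping_keys_induct)
        (use \<open>x \<in> _\<close> single in \<open>auto simp: monoid_algebra_mult_single monoid_algebra_mult_zero monoid_algebra_distrib S.m_assoc mult.assoc\<close>)
  qed (auto simp: monoid_algebra_mult_zero monoid_algebra_distrib)
qed (auto simp: monoid_algebra_mult_zero monoid_algebra_distrib)

lemma monoid_algebra_one_left:
  "Poly_Mapping.keys f \<subseteq> carrier S \<Longrightarrow> Poly_Mapping.single \<one>\<^bsub>S\<^esub> 1 \<otimes>\<^bsub>monoid_algebra S\<^esub> f = f"
  by (induction rule: poly_mapping_keys_induct)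
    (simp_all add: monoid_algebra_mult_single monoid_algebra_mult_zero monoid_algebra_distrib)

lemma monoid_algebra_one_right:
  "Poly_Mapping.keys f \<subseteq> carrier S \<Longrightarrow> f \<otimes>\<^bsub>monoid_algebra S\<^esub> Poly_Mapping.single \<one>\<^bsub>S\<^esub> 1 = f"
  by (induction rule: poly_mapping_keys_induct)
    (simp_all add: monoid_algebra_mult_single monoid_algebra_mult_zero monoid_algebra_distrib)

lemmas monoid_algebra_one = monoid_algebra_one_left monoid_algebra_one_right

lemma scale_mult:
  "Poly_Mapping.map ((*) c) f \<otimes>\<^bsub>monoid_algebra S\<^esub> g = Poly_Mapping.map ((*) c) (f \<otimes>\<^bsub>monoid_algebra S\<^esub> g)"
  "f \<otimes>\<^bsub>monoid_algebra S\<^esub> Poly_Mapping.map ((*) c) g = Poly_Mapping.map ((*) c) (f \<otimes>\<^bsub>monoid_algebra S\<^esub> g)"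
proof -
  have k: "Poly_Mapping.keys (Poly_Mapping.map ((*) c) f) \<subseteq> Poly_Mapping.keys f" for f :: "'a \<Rightarrow>\<^sub>0 complex"
    by (auto simp: in_keys_iff lookup_scale)
  have s: "Poly_Mapping.map ((*) c) (sum F X) = (\<Sum>x\<in>X. Poly_Mapping.map ((*) c) (F x))" for F :: "'c \<Rightarrow> 'a \<Rightarrow>\<^sub>0 complex" and X
    by (rule poly_mapping_eqI) (simp add: lookup_scale lookup_sum sum_distrib_left)
  have f: "f \<otimes>\<^bsub>monoid_algebra S\<^esub> g = (\<Sum>x\<in>Poly_Mapping.keys f. \<Sum>y\<in>Poly_Mapping.keys g.
      Poly_Mapping.single (x \<otimes>\<^bsub>S\<^esub> y) (Poly_Mapping.lookup f x * Poly_Mapping.lookup g y))"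
    by (rule monoid_algebra_mult) auto
  show "Poly_Mapping.map ((*) c) f \<otimes>\<^bsub>monoid_algebra S\<^esub> g = Poly_Mapping.map ((*) c) (f \<otimes>\<^bsub>monoid_algebra S\<^esub> g)"
    by (subst monoid_algebra_mult[OF finite_keys finite_keys k subset_refl])
      (simp add: f s scale_single lookup_scale mult.assoc)
  show "f \<otimes>\<^bsub>monoid_algebra S\<^esub> Poly_Mapping.map ((*) c) g = Poly_Mapping.map ((*) c) (f \<otimes>\<^bsub>monoid_algebra S\<^esub> g)"
    by (subst monoid_algebra_mult[OF finite_keys finite_keys subset_refl k])
      (simp add: f s scale_single lookup_scale mult.left_commute)
qed

lemma assoc_algebra_monoid_algebra: "assoc_algebra (monoid_algebra S)"
proof -
  note simps = monoid_algebra_simps monoid_algebra_mult_zero monoid_algebra_distrib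
  have k: "Poly_Mapping.keys (Poly_Mapping.map ((*) c) f) \<subseteq> carrier S" if "Poly_Mapping.keys f \<subseteq> carrier S" for f :: "'a \<Rightarrow>\<^sub>0 complex" and c
    using that by (auto simp: in_keys_iff lookup_scale)
  have ab: "abelian_group (monoid_algebra S)"
  proof (rule abelian_groupI)
    fix f assume "f \<in> carrier (monoid_algebra S)"
    then show "\<exists>g\<in>carrier (monoid_algebra S). g \<oplus>\<^bsub>monoid_algebra S\<^esub> f = \<zero>\<^bsub>monoid_algebra S\<^esub>"
      by (intro bexI[of _ "- f"]) (auto simp: simps)
  qed (auto simp: simps ac_simps dest!: Poly_Mapping.keys_add[THEN subsetD])
  have mon: "Group.monoid (monoid_algebra S)"
    by (rule monoidI) (auto simp: simps monoid_algebra_assoc monoid_algebra_one dest: monoid_algebra_closed[THEN subsetD])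
  have "ring (monoid_algebra S)"
    by (rule ringI[OF ab mon]) (auto simp: simps)
  moreover have "module complex_ring (monoid_algebra S)"
    by (rule moduleI[OF cring_complex_ring ab])
      (auto simp: simps lookup_scale lookup_add algebra_simps intro!: poly_mapping_eqI dest: k[THEN subsetD])
  ultimately show ?thesis
    by (simp add: assoc_algebra_def simps scale_mult)
qed

text \<open>The universal property of the monoid algebra: a monoid homomorphism into the
  multiplicative monoid of \<open>B\<close> extends linearly. It is applied to the monoids of words,
  of multisets and of pairs.\<close>

lemma ma_lift_alg_hom:
  assumes B: "assoc_algebra B" and \<phi>: "\<And>x. x \<in> carrier S \<Longrightarrow> \<phi> x \<in> carrier B"
    and \<phi>_mult: "\<And>x y. x \<in> carrier S \<Longrightarrow> y \<in> carrier S \<Longrightarrow> \<phi> (x \<otimes>\<^bsub>S\<^esub> y) = \<phi> x \<otimes>\<^bsub>B\<^esub> \<phi> y"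
    and \<phi>_one: "\<phi> \<one>\<^bsub>S\<^esub> = \<one>\<^bsub>B\<^esub>"
  shows "ma_lift B \<phi> \<in> alg_hom (monoid_algebra S) B"
    and "\<And>x c. x \<in> carrier S \<Longrightarrow> ma_lift B \<phi> (Poly_Mapping.single x c) = c \<odot>\<^bsub>B\<^esub> \<phi> x"
proof -
  interpret B: complex_algebra B by unfold_locales (rule B)
  interpret MA: complex_algebra "monoid_algebra S" by unfold_locales (rule assoc_algebra_monoid_algebra)
  have sup: "ma_lift B \<phi> f = (\<Oplus>\<^bsub>B\<^esub>x\<in>X. Poly_Mapping.lookup f x \<odot>\<^bsub>B\<^esub> \<phi> x)"
    if "finite X" "Poly_Mapping.keys f \<subseteq> X" "X \<subseteq> carrier S" for f X
    unfolding ma_lift_def using that \<phi>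
    by (intro B.add.finprod_mono_neutral_cong_left) (auto simp: in_keys_iff)
  have lift_single: "ma_lift B \<phi> (Poly_Mapping.single x c) = c \<odot>\<^bsub>B\<^esub> \<phi> x" if "x \<in> carrier S" for x c
    using that \<phi> by (subst sup[of "{x}"]) auto
  have lift_add: "ma_lift B \<phi> (f + g) = ma_lift B \<phi> f \<oplus>\<^bsub>B\<^esub> ma_lift B \<phi> g"
    if "Poly_Mapping.keys f \<subseteq> carrier S" "Poly_Mapping.keys g \<subseteq> carrier S" for f g
  proof -
    let ?X = "Poly_Mapping.keys f \<union> Poly_Mapping.keys g"
    have X: "finite ?X" "Poly_Mapping.keys (f + g) \<subseteq> ?X" "?X \<subseteq> carrier S"
      using that Poly_Mapping.keys_add[of f g] by auto
    have "ma_lift B \<phi> (f + g) = (\<Oplus>\<^bsub>B\<^esub>x\<in>?X. Poly_Mapping.lookup f x \<odot>\<^bsub>B\<^esub> \<phi> x \<oplus>\<^bsub>B\<^esub> Poly_Mapping.lookup g x \<odot>\<^bsub>B\<^esub> \<phi> x)"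
      unfolding sup[OF X] using X \<phi>
      by (intro B.add.finprod_cong') (auto simp: lookup_add B.smult_l_distrC)
    also have "\<dots> = ma_lift B \<phi> f \<oplus>\<^bsub>B\<^esub> ma_lift B \<phi> g"
      using X \<phi> by (subst B.finsum_addf) (auto simp: sup[of ?X])
    finally show ?thesis .
  qed
  have zero: "ma_lift B \<phi> 0 = \<zero>\<^bsub>B\<^esub>" by (simp add: ma_lift_def)
  have closed: "ma_lift B \<phi> f \<in> carrier B" if "Poly_Mapping.keys f \<subseteq> carrier S" for f
    unfolding ma_lift_def using that \<phi> by (intro B.finsum_closed) auto
  have smult: "ma_lift B \<phi> (Poly_Mapping.map ((*) c) f) = c \<odot>\<^bsub>B\<^esub> ma_lift B \<phi> f"
    if "Poly_Mapping.keys f \<subseteq> carrier S" for f c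
  proof -
    have k: "Poly_Mapping.keys (Poly_Mapping.map ((*) c) f) \<subseteq> Poly_Mapping.keys f"
      by (auto simp: in_keys_iff lookup_scale)
    have "ma_lift B \<phi> (Poly_Mapping.map ((*) c) f) =
        (\<Oplus>\<^bsub>B\<^esub>x\<in>Poly_Mapping.keys f. c \<odot>\<^bsub>B\<^esub> (Poly_Mapping.lookup f x \<odot>\<^bsub>B\<^esub> \<phi> x))"
      unfolding sup[OF finite_keys k that] using that \<phi>
      by (intro B.add.finprod_cong') (auto simp: lookup_scale B.smult_assocC)
    moreover have "(\<lambda>x. Poly_Mapping.lookup f x \<odot>\<^bsub>B\<^esub> \<phi> x) \<in> Poly_Mapping.keys f \<rightarrow> carrier B"
      using that \<phi> by auto
    ultimately show ?thesis
      using B.mod.finsum_smult_ldistr[of "Poly_Mapping.keys f" c "\<lambda>x. Poly_Mapping.lookup f x \<odot>\<^bsub>B\<^esub> \<phi> x"]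
      by (simp add: ma_lift_def)
  qed
  have mult: "ma_lift B \<phi> (f \<otimes>\<^bsub>monoid_algebra S\<^esub> g) = ma_lift B \<phi> f \<otimes>\<^bsub>B\<^esub> ma_lift B \<phi> g"
    if f: "Poly_Mapping.keys f \<subseteq> carrier S" and g: "Poly_Mapping.keys g \<subseteq> carrier S" for f g
    using f
  proof (induction rule: poly_mapping_keys_induct)
    case (single x c)
    show ?case using g
    proof (induction rule: poly_mapping_keys_induct)
      case (single y d)
      then show ?case using \<open>x \<in> carrier S\<close> \<phi>
        by (simp add: monoid_algebra_mult_single lift_single \<phi>_mult B.smult_mult_left B.smult_mult_right
            B.smult_assocC[symmetric] mult.commute)
    next
      case (add f g)
      then show ?case
        using \<open>x \<in> carrier S\<close> closed monoid_algebra_closed[of "Poly_Mapping.single x c"] \<phi>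
        by (simp add: monoid_algebra_distrib lift_add B.r_distr)
    qed (use \<open>x \<in> carrier S\<close> in \<open>simp add: monoid_algebra_mult_zero zero closed\<close>)
  next
    case (add f f')
    then show ?case
      using closed monoid_algebra_closed[OF _ g] g
      by (simp add: monoid_algebra_distrib lift_add B.l_distr)
  qed (use g in \<open>simp add: monoid_algebra_mult_zero zero closed\<close>)
  show "ma_lift B \<phi> \<in> alg_hom (monoid_algebra S) B"
    by (rule alg_homI) (auto simp: monoid_algebra_simps closed mult lift_add smult lift_single \<phi>_one)
  show "ma_lift B \<phi> (Poly_Mapping.single x c) = c \<odot>\<^bsub>B\<^esub> \<phi> x" if "x \<in> carrier S" for x c
    using lift_single that .
qed

lemma alg_hom_eqI:
  assumes "assoc_algebra B" "h \<in> alg_hom (monoid_algebra S) B" "k \<in> alg_hom (monoid_algebra S) B"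
    and hk: "\<And>x. x \<in> carrier S \<Longrightarrow> h (Poly_Mapping.single x 1) = k (Poly_Mapping.single x 1)"
    and "f \<in> carrier (monoid_algebra S)"
  shows "h f = k f"
proof -
  note z = alg_hom_zero_minus(1)[OF assoc_algebra_monoid_algebra assms(1)]
  have "Poly_Mapping.keys f \<subseteq> carrier S" using assms(5) by (simp add: monoid_algebra_simps)
  then show ?thesis
  proof (induction rule: poly_mapping_keys_induct)
    case zero
    then show ?case using z[OF assms(2)] z[OF assms(3)] by (simp add: monoid_algebra_simps)
  next
    case (single x c)
    have s: "Poly_Mapping.single x c = c \<odot>\<^bsub>monoid_algebra S\<^esub> Poly_Mapping.single x 1"
      by (simp add: monoid_algebra_simps scale_single)
    have m: "Poly_Mapping.single x 1 \<in> carrier (monoid_algebra S)"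
      using single by (simp add: monoid_algebra_simps)
    show ?case
      unfolding s alg_homD(5)[OF assms(2) m] alg_homD(5)[OF assms(3) m] hk[OF single] ..
  next
    case (add f g)
    then show ?case
      using alg_homD(3)[OF assms(2), of f g] alg_homD(3)[OF assms(3), of f g] by (simp add: monoid_algebra_simps)
  qed
qed

end

section \<open>The free algebra on the generators\<close>

text \<open>The projection onto the span of the basis elements that satisfy \<open>P\<close>.
  Homogeneous parts for the degree and for the parity are both of this kind and hence
  commute.\<close>

definition pm_filter :: "('a \<Rightarrow> bool) \<Rightarrow> ('a \<Rightarrow>\<^sub>0 complex) \<Rightarrow> 'a \<Rightarrow>\<^sub>0 complex" where
  "pm_filter P f = Poly_Mapping.mapp (\<lambda>k v. if P k then v else 0) f"

lemma lookup_pm_filter: "Poly_Mapping.lookup (pm_filter P f) k = (if P k then Poly_Mapping.lookup f k else 0)"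
  by (simp add: pm_filter_def lookup_mapp when_def in_keys_iff)

lemma keys_pm_filter: "Poly_Mapping.keys (pm_filter P f) = {k \<in> Poly_Mapping.keys f. P k}"
  by (auto simp: in_keys_iff lookup_pm_filter split: if_splits)

lemma pm_filter_simps:
  "pm_filter P 0 = 0" "pm_filter P (f + g) = pm_filter P f + pm_filter P g"
  "pm_filter P (f - g) = pm_filter P f - pm_filter P g"
  "pm_filter P (Poly_Mapping.single k c) = (if P k then Poly_Mapping.single k c else 0)"
  "pm_filter P (Poly_Mapping.map ((*) c) f) = Poly_Mapping.map ((*) c) (pm_filter P f)"
  by (rule poly_mapping_eqI; auto simp: lookup_pm_filter lookup_add lookup_minus lookup_single lookup_scale when_def)+

lemma pm_filter_sum: "pm_filter P (sum F X) = (\<Sum>x\<in>X. pm_filter P (F x))"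
  by (induction X rule: infinite_finite_induct) (simp_all add: pm_filter_simps)

lemma pm_filter_id: "(\<And>k. k \<in> Poly_Mapping.keys f \<Longrightarrow> P k) \<Longrightarrow> pm_filter P f = f"
  by (rule poly_mapping_eqI) (auto simp: lookup_pm_filter in_keys_iff)

lemma pm_filter_none: "(\<And>k. k \<in> Poly_Mapping.keys f \<Longrightarrow> \<not> P k) \<Longrightarrow> pm_filter P f = 0"
  by (rule poly_mapping_eqI) (auto simp: lookup_pm_filter in_keys_iff)

lemma pm_filter_filter: "pm_filter P (pm_filter Q f) = pm_filter (\<lambda>k. P k \<and> Q k) f"
  by (rule poly_mapping_eqI) (auto simp: lookup_pm_filter)

lemma monoid_free: "Group.monoid \<lparr>carrier = lists G, mult = (@), one = []\<rparr>"
  by (rule monoidI) auto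

lemma free_algebra_alg: "assoc_algebra (free_algebra G)"
  unfolding free_algebra_def by (rule assoc_algebra_monoid_algebra[OF monoid_free])

lemma free_algebra_simps:
  "carrier (free_algebra G) = {f. Poly_Mapping.keys f \<subseteq> lists G}"
  "zero (free_algebra G) = 0" "add (free_algebra G) = (+)"
  "one (free_algebra G) = Poly_Mapping.single [] 1"
  "smult (free_algebra G) = (\<lambda>c. Poly_Mapping.map ((*) c))"
  by (simp_all add: free_algebra_def monoid_algebra_simps)

lemma free_algebra_mult:
  "Poly_Mapping.single x a \<otimes>\<^bsub>free_algebra G\<^esub> Poly_Mapping.single y b = Poly_Mapping.single (x @ y) (a * b)"
  "(f + f') \<otimes>\<^bsub>free_algebra G\<^esub> g = f \<otimes>\<^bsub>free_algebra G\<^esub> g + f' \<otimes>\<^bsub>free_algebra G\<^esub> g"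
  "f \<otimes>\<^bsub>free_algebra G\<^esub> (g + g') = f \<otimes>\<^bsub>free_algebra G\<^esub> g + f \<otimes>\<^bsub>free_algebra G\<^esub> g'"
  "0 \<otimes>\<^bsub>free_algebra G\<^esub> g = 0" "f \<otimes>\<^bsub>free_algebra G\<^esub> 0 = 0"
  by (simp_all add: free_algebra_def monoid_algebra_mult_single monoid_algebra_distrib monoid_algebra_mult_zero)

lemma free_algebra_keys_mult:
  assumes "k \<in> Poly_Mapping.keys (f \<otimes>\<^bsub>free_algebra G\<^esub> g)"
  obtains v w where "k = v @ w" "v \<in> Poly_Mapping.keys f" "w \<in> Poly_Mapping.keys g"
proof -
  let ?s = "\<lambda>v w. Poly_Mapping.single (v @ w) (Poly_Mapping.lookup f v * Poly_Mapping.lookup g w)"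
  have "f \<otimes>\<^bsub>free_algebra G\<^esub> g = (\<Sum>v\<in>Poly_Mapping.keys f. \<Sum>w\<in>Poly_Mapping.keys g. ?s v w)"
    by (simp add: free_algebra_def monoid_algebra_def)
  then obtain v where v: "v \<in> Poly_Mapping.keys f" "k \<in> Poly_Mapping.keys (\<Sum>w\<in>Poly_Mapping.keys g. ?s v w)"
    using assms Poly_Mapping.keys_sum[of "\<lambda>v. \<Sum>w\<in>Poly_Mapping.keys g. ?s v w" "Poly_Mapping.keys f"] by auto
  then obtain w where w: "w \<in> Poly_Mapping.keys g" "k \<in> Poly_Mapping.keys (?s v w)"
    using Poly_Mapping.keys_sum[of "?s v" "Poly_Mapping.keys g"] by auto
  then have "k = v @ w" by (auto split: if_splits)
  then show thesis using that v w by blast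
qed

lemma free_algebra_uminus:
  assumes "f \<in> carrier (free_algebra G)"
  shows "\<ominus>\<^bsub>free_algebra G\<^esub> f = - f"
proof -
  interpret complex_algebra "free_algebra G" by unfold_locales (rule free_algebra_alg)
  have m: "- f \<in> carrier (free_algebra G)" using assms by (simp add: free_algebra_simps)
  have "- f \<oplus>\<^bsub>free_algebra G\<^esub> f = \<zero>\<^bsub>free_algebra G\<^esub>" by (simp add: free_algebra_simps)
  from minus_equality[OF this assms m] show ?thesis .
qed

lemma free_algebra_minus:
  assumes "f \<in> carrier (free_algebra G)" "g \<in> carrier (free_algebra G)"
  shows "f \<ominus>\<^bsub>free_algebra G\<^esub> g = f - g"
  unfolding a_minus_def free_algebra_uminus[OF assms(2)] by (simp add: free_algebra_simps)

section \<open>The degree of words and of their combinations\<close>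

definition gdeg :: "ygen \<Rightarrow> nat" where
  "gdeg = (\<lambda>(i, j, r). r)"

definition wdeg :: "ygen list \<Rightarrow> nat" where
  "wdeg w = (\<Sum>(i, j, r)\<leftarrow>w. r)"

lemma wdeg_simps [simp]: "wdeg [] = 0" "wdeg (g # w) = gdeg g + wdeg w" "wdeg (v @ w) = wdeg v + wdeg w"
  by (simp_all add: wdeg_def gdeg_def split: prod.splits)

abbreviation deg_part :: "nat \<Rightarrow> (ygen list \<Rightarrow>\<^sub>0 complex) \<Rightarrow> ygen list \<Rightarrow>\<^sub>0 complex" where
  "deg_part d \<equiv> pm_filter (\<lambda>w. wdeg w = d)"

definition deg_le :: "nat \<Rightarrow> (ygen list \<Rightarrow>\<^sub>0 complex) \<Rightarrow> bool" where
  "deg_le d f \<longleftrightarrow> (\<forall>w\<in>Poly_Mapping.keys f. wdeg w \<le> d)"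

definition deg_lt :: "nat \<Rightarrow> (ygen list \<Rightarrow>\<^sub>0 complex) \<Rightarrow> bool" where
  "deg_lt d f \<longleftrightarrow> (\<forall>w\<in>Poly_Mapping.keys f. wdeg w < d)"

lemma deg_bounds:
  "deg_lt d 0" "deg_lt d f \<Longrightarrow> deg_lt d g \<Longrightarrow> deg_lt d (f + g)" "deg_lt d f \<Longrightarrow> deg_lt d g \<Longrightarrow> deg_lt d (f - g)"
  "deg_lt d f \<Longrightarrow> deg_lt d (Poly_Mapping.map ((*) c) f)" "deg_lt d f \<Longrightarrow> deg_lt d (- f)"
  "deg_le d 0" "deg_le d f \<Longrightarrow> deg_le d g \<Longrightarrow> deg_le d (f + g)"
  "deg_lt d f \<Longrightarrow> deg_le d f" "deg_le d (deg_part d f)"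
  "deg_le d f \<Longrightarrow> deg_le d (pm_filter P f)" "deg_lt d f \<Longrightarrow> deg_lt d (pm_filter P f)"
  using Poly_Mapping.keys_add[of f g] Poly_Mapping.keys_diff[of f g]
  by (auto simp: deg_lt_def deg_le_def keys_pm_filter in_keys_iff lookup_scale)

lemma deg_mult:
  "deg_le a f \<Longrightarrow> deg_le b g \<Longrightarrow> deg_le (a + b) (f \<otimes>\<^bsub>free_algebra G\<^esub> g)"
  "deg_lt a f \<Longrightarrow> deg_le b g \<Longrightarrow> deg_lt (a + b) (f \<otimes>\<^bsub>free_algebra G\<^esub> g)"
  "deg_le a f \<Longrightarrow> deg_lt b g \<Longrightarrow> deg_lt (a + b) (f \<otimes>\<^bsub>free_algebra G\<^esub> g)"
  unfolding deg_le_def deg_lt_def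
  by (auto elim!: free_algebra_keys_mult simp: add_le_mono add_less_le_mono add_le_less_mono)

lemma deg_sum:
  "(\<And>x. x \<in> X \<Longrightarrow> deg_lt d (F x)) \<Longrightarrow> deg_lt d (sum F X)"
  by (induction X rule: infinite_finite_induct) (auto intro: deg_bounds)

lemma deg_le_minus_part: "deg_le d f \<Longrightarrow> deg_lt d (f - deg_part d f)"
  unfolding deg_le_def deg_lt_def by (force simp: in_keys_iff lookup_minus lookup_pm_filter split: if_splits)

text \<open>The convolution on the right is the one by which \<open>gr_algebra\<close> multiplies;
  this makes \<open>gr_proj\<close> multiplicative.\<close>

lemma deg_part_mult:
  assumes "f \<in> carrier (free_algebra G)" "g \<in> carrier (free_algebra G)"
  shows "deg_part d (f \<otimes>\<^bsub>free_algebra G\<^esub> g) = (\<Sum>p\<le>d. deg_part p f \<otimes>\<^bsub>free_algebra G\<^esub> deg_part (d - p) g)"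
proof -
  have f: "Poly_Mapping.keys f \<subseteq> UNIV" and g: "Poly_Mapping.keys g \<subseteq> UNIV" by auto
  show ?thesis using f
  proof (induction rule: poly_mapping_keys_induct)
    case (single v a)
    show ?case using g
    proof (induction rule: poly_mapping_keys_induct)
      case (single w b)
      have "(\<Sum>p\<le>d. deg_part p (Poly_Mapping.single v a) \<otimes>\<^bsub>free_algebra G\<^esub> deg_part (d - p) (Poly_Mapping.single w b)) =
        (\<Sum>p\<le>d. if p = wdeg v then (if wdeg w = d - wdeg v then Poly_Mapping.single (v @ w) (a * b) else 0) else 0)"
        by (intro sum.cong) (auto simp: pm_filter_simps free_algebra_mult)
      then show ?case by (auto simp: free_algebra_mult pm_filter_simps)
    qed (simp_all add: free_algebra_mult pm_filter_simps sum.distrib)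
  qed (simp_all add: free_algebra_mult pm_filter_simps sum.distrib)
qed

section \<open>The graded algebra as a quotient of the free algebra\<close>

context
  fixes M N :: nat
begin

abbreviation "FA \<equiv> free_algebra (ygens M N)"
abbreviation "YI \<equiv> yangian_ideal M N"
abbreviation "YA \<equiv> yangian M N"
abbreviation "proj \<equiv> yangian_proj M N"
abbreviation "YB \<equiv> filt_below YA (yangian_filt M N)"
abbreviation "GY \<equiv> gr_yangian M N"

interpretation FA: complex_algebra FA by unfold_locales (rule free_algebra_alg)

lemma T_coeff_carrier:
  "i \<in> {1..M + N} \<Longrightarrow> j \<in> {1..M + N} \<Longrightarrow> T_coeff i j r \<in> carrier FA"
  by (auto simp: T_coeff_def free_algebra_simps free_gen_def ygens_def)

lemma T_supercomm_carrier:
  assumes "i \<in> {1..M + N}" "j \<in> {1..M + N}" "k \<in> {1..M + N}" "l \<in> {1..M + N}"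
  shows "T_supercomm M N i j k l r s \<in> carrier FA"
proof -
  have 1: "T_coeff i j r \<otimes>\<^bsub>FA\<^esub> T_coeff k l s \<in> carrier FA" "T_coeff k l s \<otimes>\<^bsub>FA\<^esub> T_coeff i j r \<in> carrier FA"
    using assms by (auto intro!: FA.m_closed T_coeff_carrier)
  show ?thesis
    unfolding T_supercomm_def Let_def
    using FA.minus_closed[OF 1(1) FA.smult_closedC[OF 1(2)]] free_algebra_minus[OF 1(1) FA.smult_closedC[OF 1(2)]]
    by simp
qed

lemma FA_diff_closed: "f \<in> carrier FA \<Longrightarrow> g \<in> carrier FA \<Longrightarrow> f - g \<in> carrier FA"
  using FA.minus_closed[of f g] free_algebra_minus[of f _ g] by simp

lemma yangian_rel_carrier:
  assumes "i \<in> {1..M + N}" "j \<in> {1..M + N}" "k \<in> {1..M + N}" "l \<in> {1..M + N}"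
  shows "yangian_rel M N i j k l r s \<in> carrier FA"
  unfolding yangian_rel_def Let_def using assms
  by (intro FA_diff_closed FA.smult_closedC T_supercomm_carrier FA.m_closed T_coeff_carrier)

lemma yangian_gens_carrier:
  "{yangian_rel M N i j k l r s | i j k l r s.
        i \<in> {1..M + N} \<and> j \<in> {1..M + N} \<and> k \<in> {1..M + N} \<and> l \<in> {1..M + N}} \<subseteq> carrier FA"
  using yangian_rel_carrier by blast

lemma yangian_ideal: "ideal YI FA"
  unfolding yangian_ideal_def by (rule FA.genideal_ideal[OF yangian_gens_carrier])

lemma yangian_rel_in_ideal:
  assumes "i \<in> {1..M + N}" "j \<in> {1..M + N}" "k \<in> {1..M + N}" "l \<in> {1..M + N}"
  shows "yangian_rel M N i j k l r s \<in> YI"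
  unfolding yangian_ideal_def using FA.genideal_self[OF yangian_gens_carrier] assms by blast

lemma yangian_alg: "assoc_algebra YA"
  unfolding yangian_def by (rule quot_algebra_proj(1)[OF free_algebra_alg yangian_ideal])

interpretation YA: complex_algebra YA by unfold_locales (rule yangian_alg)

lemma proj_eq: "proj = (\<lambda>f. YI +>\<^bsub>FA\<^esub> f)"
  by (rule ext) (simp add: yangian_proj_def)

lemma proj_alg_hom: "proj \<in> alg_hom FA YA"
  unfolding yangian_def proj_eq by (rule quot_algebra_proj(2)[OF free_algebra_alg yangian_ideal])

lemmas projD = alg_homD[OF proj_alg_hom]

lemma proj_eq_iff: "f \<in> carrier FA \<Longrightarrow> g \<in> carrier FA \<Longrightarrow> proj f = proj g \<longleftrightarrow> f - g \<in> YI"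
  unfolding proj_eq using rcos_eq_iff[OF free_algebra_alg yangian_ideal] free_algebra_minus[of f _ g] by simp

lemma proj_add: "f \<in> carrier FA \<Longrightarrow> g \<in> carrier FA \<Longrightarrow> proj (f + g) = proj f \<oplus>\<^bsub>YA\<^esub> proj g"
  using projD(3)[of f g] by (simp add: free_algebra_simps)

lemma proj_diff: "f \<in> carrier FA \<Longrightarrow> g \<in> carrier FA \<Longrightarrow> proj (f - g) = proj f \<ominus>\<^bsub>YA\<^esub> proj g"
  using alg_hom_zero_minus(3)[OF free_algebra_alg yangian_alg proj_alg_hom, of f g] free_algebra_minus[of f _ g] by simp

lemma proj_zero: "proj 0 = \<zero>\<^bsub>YA\<^esub>"
  using alg_hom_zero_minus(1)[OF free_algebra_alg yangian_alg proj_alg_hom] by (simp add: free_algebra_simps)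

lemma proj_smult: "f \<in> carrier FA \<Longrightarrow> proj (Poly_Mapping.map ((*) c) f) = c \<odot>\<^bsub>YA\<^esub> proj f"
  using projD(5)[of f c] by (simp add: free_algebra_simps)

lemma proj_ideal: "f \<in> YI \<Longrightarrow> proj f = \<zero>\<^bsub>YA\<^esub>"
  using proj_eq_iff[of f 0] ideal.Icarr[OF yangian_ideal] proj_zero by (simp add: free_algebra_simps)

lemma filt_eq: "yangian_filt M N d = proj ` {f \<in> carrier FA. deg_le d f}"
  unfolding yangian_filt_def deg_le_def wdeg_def by simp

text \<open>With a strict bound on the degree the case \<open>d = 0\<close> is no exception: no word
  has degree below 0, so only the zero combination is left, as \<open>filt_below\<close>
  prescribes.\<close>

lemma below_eq: "YB d = proj ` {f \<in> carrier FA. deg_lt d f}"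
proof (cases d)
  case 0
  have "{f \<in> carrier FA. deg_lt 0 f} = {0}"
    by (auto simp: deg_lt_def free_algebra_simps)
  then show ?thesis using 0 proj_zero by (simp add: filt_below_def)
next
  case (Suc e)
  have "deg_lt d f = deg_le e f" for f using Suc by (auto simp: deg_lt_def deg_le_def)
  then show ?thesis using Suc by (simp add: filt_below_def filt_eq)
qed

lemma below_closed:
  assumes "x \<in> YB d" "y \<in> YB d"
  shows "x \<in> carrier YA" "x \<oplus>\<^bsub>YA\<^esub> y \<in> YB d" "x \<ominus>\<^bsub>YA\<^esub> y \<in> YB d" "c \<odot>\<^bsub>YA\<^esub> x \<in> YB d" "\<zero>\<^bsub>YA\<^esub> \<in> YB d"
proof -
  obtain f g where fg: "f \<in> carrier FA" "deg_lt d f" "x = proj f" "g \<in> carrier FA" "deg_lt d g" "y = proj g"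
    using assms unfolding below_eq by blast
  note c = FA_diff_closed[of f g] FA.add.m_closed[of f g, unfolded free_algebra_simps monoid.simps]
  show "x \<in> carrier YA" using fg by (simp add: projD)
  show "x \<oplus>\<^bsub>YA\<^esub> y \<in> YB d"
    unfolding below_eq using fg by (intro image_eqI[of _ _ "f + g"])
      (auto simp: proj_add deg_bounds free_algebra_simps dest!: Poly_Mapping.keys_add[THEN subsetD])
  show "x \<ominus>\<^bsub>YA\<^esub> y \<in> YB d"
    unfolding below_eq using fg by (intro image_eqI[of _ _ "f - g"]) (auto simp: proj_diff deg_bounds FA_diff_closed)
  show "c \<odot>\<^bsub>YA\<^esub> x \<in> YB d"
    unfolding below_eq using fg FA.smult_closedC[of f c]
    by (intro image_eqI[of _ _ "Poly_Mapping.map ((*) c) f"]) (auto simp: proj_smult deg_bounds free_algebra_simps)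
  show "\<zero>\<^bsub>YA\<^esub> \<in> YB d"
    unfolding below_eq by (intro image_eqI[of _ _ 0]) (auto simp: proj_zero deg_bounds free_algebra_simps)
qed

lemma zero_below: "\<zero>\<^bsub>YA\<^esub> \<in> YB d"
  unfolding below_eq by (intro image_eqI[of _ _ 0]) (auto simp: proj_zero deg_bounds free_algebra_simps)

lemma below_coset_iff:
  assumes "x \<in> carrier YA" "y \<in> carrier YA"
  shows "YB d +>\<^bsub>YA\<^esub> x = YB d +>\<^bsub>YA\<^esub> y \<longleftrightarrow> x \<ominus>\<^bsub>YA\<^esub> y \<in> YB d"
proof
  assume "YB d +>\<^bsub>YA\<^esub> x = YB d +>\<^bsub>YA\<^esub> y"
  moreover have "x \<in> YB d +>\<^bsub>YA\<^esub> x"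
    using zero_below assms by (auto simp: a_r_coset_def' intro!: bexI[of _ "\<zero>\<^bsub>YA\<^esub>"])
  ultimately obtain b where b: "b \<in> YB d" "x = b \<oplus>\<^bsub>YA\<^esub> y" by (auto simp: a_r_coset_def')
  then have "x \<ominus>\<^bsub>YA\<^esub> y = b"
    using assms below_closed(1)[OF b(1) b(1)] by (simp add: a_minus_def YA.a_assoc YA.r_neg)
  then show "x \<ominus>\<^bsub>YA\<^esub> y \<in> YB d" using b by simp
next
  assume d: "x \<ominus>\<^bsub>YA\<^esub> y \<in> YB d"
  have sub: "YB d +>\<^bsub>YA\<^esub> x \<subseteq> YB d +>\<^bsub>YA\<^esub> y" if d: "x \<ominus>\<^bsub>YA\<^esub> y \<in> YB d" and c: "x \<in> carrier YA" "y \<in> carrier YA" for x y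
  proof
    fix z assume "z \<in> YB d +>\<^bsub>YA\<^esub> x"
    then obtain b where b: "b \<in> YB d" "z = b \<oplus>\<^bsub>YA\<^esub> x" by (auto simp: a_r_coset_def')
    have "x = (x \<ominus>\<^bsub>YA\<^esub> y) \<oplus>\<^bsub>YA\<^esub> y"
      using c by (simp add: a_minus_def YA.a_assoc YA.l_neg)
    then have "z = (b \<oplus>\<^bsub>YA\<^esub> (x \<ominus>\<^bsub>YA\<^esub> y)) \<oplus>\<^bsub>YA\<^esub> y"
      using b c below_closed(1)[OF b(1) b(1)] YA.a_assoc[of b "x \<ominus>\<^bsub>YA\<^esub> y" y] by simp
    then show "z \<in> YB d +>\<^bsub>YA\<^esub> y"
      using below_closed(2)[OF b(1) d] by (auto simp: a_r_coset_def')
  qed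
  have "y \<ominus>\<^bsub>YA\<^esub> x = \<ominus>\<^bsub>YA\<^esub> (x \<ominus>\<^bsub>YA\<^esub> y)"
    using assms by (simp add: a_minus_def YA.minus_add YA.a_comm)
  also have "\<dots> = \<zero>\<^bsub>YA\<^esub> \<ominus>\<^bsub>YA\<^esub> (x \<ominus>\<^bsub>YA\<^esub> y)"
    using assms by (simp add: a_minus_def)
  finally have "y \<ominus>\<^bsub>YA\<^esub> x \<in> YB d" using below_closed(3)[OF zero_below d] by simp
  then show "YB d +>\<^bsub>YA\<^esub> x = YB d +>\<^bsub>YA\<^esub> y"
    using sub[OF d assms] sub[of y x] assms by blast
qed

lemma below_coset_mem_iff:
  assumes "y \<in> carrier YA"
  shows "x \<in> YB d +>\<^bsub>YA\<^esub> y \<longleftrightarrow> x \<in> carrier YA \<and> x \<ominus>\<^bsub>YA\<^esub> y \<in> YB d"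
proof
  assume "x \<in> YB d +>\<^bsub>YA\<^esub> y"
  then obtain b where b: "b \<in> YB d" "x = b \<oplus>\<^bsub>YA\<^esub> y" by (auto simp: a_r_coset_def')
  then have "x \<ominus>\<^bsub>YA\<^esub> y = b" "x \<in> carrier YA"
    using assms below_closed(1)[OF b(1) b(1)] by (simp_all add: a_minus_def YA.a_assoc YA.r_neg)
  then show "x \<in> carrier YA \<and> x \<ominus>\<^bsub>YA\<^esub> y \<in> YB d" using b by simp
next
  assume x: "x \<in> carrier YA \<and> x \<ominus>\<^bsub>YA\<^esub> y \<in> YB d"
  then have "x = (x \<ominus>\<^bsub>YA\<^esub> y) \<oplus>\<^bsub>YA\<^esub> y"
    using assms by (simp add: a_minus_def YA.a_assoc YA.l_neg)
  then show "x \<in> YB d +>\<^bsub>YA\<^esub> y" using x unfolding a_r_coset_def' by blast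
qed

text \<open>Equality in a graded component becomes a statement in the free algebra: by
  \<open>below_pre_iff\<close>, membership means congruence modulo the Yangian ideal to a
  combination of smaller degree.\<close>

definition below_pre :: "nat \<Rightarrow> (ygen list \<Rightarrow>\<^sub>0 complex) set" where
  "below_pre d = {f \<in> carrier FA. proj f \<in> YB d}"

lemma below_pre_iff: "f \<in> below_pre d \<longleftrightarrow> f \<in> carrier FA \<and> (\<exists>b\<in>carrier FA. deg_lt d b \<and> f - b \<in> YI)"
  unfolding below_pre_def below_eq using proj_eq_iff by (auto simp: image_iff)

lemma FA_add_closed: "f \<in> carrier FA \<Longrightarrow> g \<in> carrier FA \<Longrightarrow> f + g \<in> carrier FA"
  using FA.a_closed[of f g] by (simp add: free_algebra_simps)

lemma FA_smult_closed: "f \<in> carrier FA \<Longrightarrow> Poly_Mapping.map ((*) c) f \<in> carrier FA"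
  using FA.smult_closedC[of f c] by (simp add: free_algebra_simps)

lemma FA_filter_closed: "f \<in> carrier FA \<Longrightarrow> pm_filter P f \<in> carrier FA"
  by (auto simp: free_algebra_simps keys_pm_filter)

lemma FA_zero_closed: "0 \<in> carrier FA"
  by (simp add: free_algebra_simps)

lemma FA_sum_closed: "(\<And>x. x \<in> X \<Longrightarrow> F x \<in> carrier FA) \<Longrightarrow> sum F X \<in> carrier FA"
  by (induction X rule: infinite_finite_induct) (auto intro: FA_add_closed FA_zero_closed)

lemma below_pre_closed:
  "f \<in> below_pre d \<Longrightarrow> f \<in> carrier FA"
  "f \<in> below_pre d \<Longrightarrow> g \<in> below_pre d \<Longrightarrow> f + g \<in> below_pre d"
  "f \<in> below_pre d \<Longrightarrow> g \<in> below_pre d \<Longrightarrow> f - g \<in> below_pre d"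
  "f \<in> below_pre d \<Longrightarrow> Poly_Mapping.map ((*) c) f \<in> below_pre d"
  "f \<in> carrier FA \<Longrightarrow> deg_lt d f \<Longrightarrow> f \<in> below_pre d"
  "f \<in> YI \<Longrightarrow> f \<in> below_pre d"
  "0 \<in> below_pre d"
  unfolding below_pre_def
  using ideal.Icarr[OF yangian_ideal]
  by (auto simp: proj_add proj_diff proj_smult below_closed proj_ideal zero_below FA_add_closed FA_diff_closed
      FA_smult_closed FA_zero_closed proj_zero) (auto simp: below_eq)

text \<open>The free algebra is graded, whereas the Yangian is only filtered. Sending every
  homogeneous part to its symbol is therefore multiplicative and presents the graded algebra as a
  quotient of the free algebra.\<close>

definition gr_proj :: "(ygen list \<Rightarrow>\<^sub>0 complex) \<Rightarrow> nat \<Rightarrow> (ygen list \<Rightarrow>\<^sub>0 complex) set set" where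
  "gr_proj f d = YB d +>\<^bsub>YA\<^esub> proj (deg_part d f)"

lemma gr_proj_eq_iff:
  assumes "f \<in> carrier FA" "g \<in> carrier FA"
  shows "gr_proj f = gr_proj g \<longleftrightarrow> (\<forall>d. deg_part d (f - g) \<in> below_pre d)"
  unfolding fun_eq_iff gr_proj_def using assms
  by (simp add: below_coset_iff projD FA_filter_closed below_pre_def proj_diff pm_filter_simps FA_diff_closed)

lemma below_coset_zero: "YB d +>\<^bsub>YA\<^esub> \<zero>\<^bsub>YA\<^esub> = YB d"
  using below_closed(1) by (force simp: a_r_coset_def')

lemma deg_part_deg_part: "deg_part d (deg_part e f) = (if d = e then deg_part d f else 0)"
  by (rule poly_mapping_eqI) (auto simp: lookup_pm_filter)

lemma below_coset_deg_part:
  assumes "f \<in> carrier FA" "deg_le d f"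
  shows "YB d +>\<^bsub>YA\<^esub> proj f = YB d +>\<^bsub>YA\<^esub> proj (deg_part d f)"
proof -
  have "proj (f - deg_part d f) \<in> YB d"
    unfolding below_eq using assms deg_le_minus_part by (intro imageI) (simp add: FA_diff_closed FA_filter_closed)
  then show ?thesis
    using assms by (simp add: below_coset_iff projD FA_filter_closed proj_diff)
qed

text \<open>One free combination represents all components at once. The predicate \<open>R\<close>
  is trivial when the carrier is described and records the parity of words in
  \<open>gr_parity_eq\<close>.\<close>

lemma gr_assemble:
  assumes a: "\<And>d. \<exists>f\<in>carrier FA. deg_le d f \<and> (\<forall>w\<in>Poly_Mapping.keys f. R w) \<and> a d = YB d +>\<^bsub>YA\<^esub> proj f"
    and fin: "finite {d. a d \<noteq> YB d}"
  obtains f where "f \<in> carrier FA" "\<forall>w\<in>Poly_Mapping.keys f. R w" "gr_proj f = a"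
proof -
  obtain h where h: "\<And>d. h d \<in> carrier FA" "\<And>d. deg_le d (h d)" "\<And>d. \<forall>w\<in>Poly_Mapping.keys (h d). R w"
    "\<And>d. a d = YB d +>\<^bsub>YA\<^esub> proj (h d)"
    using a by metis
  define D where "D = {d. a d \<noteq> YB d}"
  \<comment> \<open>From the representative of degree \<open>e\<close> only its top part is kept;
    its lower terms would disturb the components of smaller degree.\<close>
  define f where "f = (\<Sum>e\<in>D. deg_part e (h e))"
  have "finite D" using fin by (simp add: D_def)
  have part: "deg_part d f = (if d \<in> D then deg_part d (h d) else 0)" for d
  proof -
    have "deg_part d f = (\<Sum>e\<in>D. if e = d then deg_part d (h d) else 0)"
      unfolding f_def pm_filter_sum by (intro sum.cong) (auto simp: deg_part_deg_part)
    then show ?thesis using \<open>finite D\<close> by simp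
  qed
  have "f \<in> carrier FA"
    unfolding f_def by (intro FA_sum_closed FA_filter_closed h)
  moreover have "\<forall>w\<in>Poly_Mapping.keys f. R w"
  proof
    fix w assume "w \<in> Poly_Mapping.keys f"
    then obtain e where "w \<in> Poly_Mapping.keys (deg_part e (h e))"
      unfolding f_def using Poly_Mapping.keys_sum[of "\<lambda>e. deg_part e (h e)" D] by auto
    then show "R w" using h(3) by (auto simp: keys_pm_filter)
  qed
  moreover have "gr_proj f = a"
  proof
    fix d
    show "gr_proj f d = a d"
    proof (cases "d \<in> D")
      case True
      then show ?thesis
        using below_coset_deg_part[OF h(1,2), of d] h(4)[of d] by (simp add: gr_proj_def part)
    next
      case False
      then show ?thesis by (simp add: gr_proj_def part proj_zero below_coset_zero D_def)
    qed
  qed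
  ultimately show thesis by (rule that)
qed

lemma gr_yangian_simps:
  "carrier GY = {a. (\<forall>d. \<exists>x\<in>yangian_filt M N d. a d = YB d +>\<^bsub>YA\<^esub> x) \<and> finite {d. a d \<noteq> YB d}}"
  "a \<otimes>\<^bsub>GY\<^esub> b = (\<lambda>d. \<Union>{YB d +>\<^bsub>YA\<^esub> (\<Oplus>\<^bsub>YA\<^esub>p\<in>{..d}. x p \<otimes>\<^bsub>YA\<^esub> y (d - p)) | x y.
                (\<forall>p. x p \<in> a p) \<and> (\<forall>q. y q \<in> b q)})"
  "\<one>\<^bsub>GY\<^esub> = gr_symbol YA (yangian_filt M N) 0 \<one>\<^bsub>YA\<^esub>"
  "\<zero>\<^bsub>GY\<^esub> = YB"
  "a \<oplus>\<^bsub>GY\<^esub> b = (\<lambda>d. a d <+>\<^bsub>YA\<^esub> b d)"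
  "c \<odot>\<^bsub>GY\<^esub> a = (\<lambda>d. \<Union>x\<in>a d. YB d +>\<^bsub>YA\<^esub> (c \<odot>\<^bsub>YA\<^esub> x))"
  by (simp_all add: gr_yangian_def gr_algebra_def)

lemma gr_proj_nontrivial: 
  assumes "f \<in> carrier FA"
  shows "finite {d. gr_proj f d \<noteq> YB d}"
proof (rule finite_subset)
  show "{d. gr_proj f d \<noteq> YB d} \<subseteq> wdeg ` Poly_Mapping.keys f"
  proof
    fix d assume d: "d \<in> {d. gr_proj f d \<noteq> YB d}"
    show "d \<in> wdeg ` Poly_Mapping.keys f"
    proof (rule ccontr)
      assume "d \<notin> wdeg ` Poly_Mapping.keys f"
      then have "deg_part d f = 0" by (intro pm_filter_none) auto
      then show False using d by (simp add: gr_proj_def proj_zero below_coset_zero)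
    qed
  qed
qed simp

lemma gr_carrier: "carrier GY = gr_proj ` carrier FA"
proof (intro equalityI subsetI)
  fix a assume a: "a \<in> carrier GY"
  have F: "\<exists>f\<in>carrier FA. deg_le d f \<and> (\<forall>w\<in>Poly_Mapping.keys f. True) \<and> a d = YB d +>\<^bsub>YA\<^esub> proj f" for d
    using a unfolding gr_yangian_simps filt_eq by blast
  have fin: "finite {d. a d \<noteq> YB d}" using a by (simp add: gr_yangian_simps)
  obtain f where "f \<in> carrier FA" "gr_proj f = a"
    using gr_assemble[OF F fin] by blast
  then show "a \<in> gr_proj ` carrier FA" by blast
next
  fix a assume "a \<in> gr_proj ` carrier FA"
  then obtain f where f: "f \<in> carrier FA" "a = gr_proj f" by blast
  have "\<exists>x\<in>yangian_filt M N d. a d = YB d +>\<^bsub>YA\<^esub> x" for d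
    unfolding f gr_proj_def filt_eq using f by (blast intro: FA_filter_closed deg_bounds)
  then show "a \<in> carrier GY"
    using f gr_proj_nontrivial by (simp add: gr_yangian_simps)
qed

lemma gr_zero: "\<zero>\<^bsub>GY\<^esub> = gr_proj 0"
  unfolding gr_yangian_simps by (rule ext) (simp add: gr_proj_def pm_filter_simps proj_zero below_coset_zero)

lemma gr_one: "\<one>\<^bsub>GY\<^esub> = gr_proj \<one>\<^bsub>FA\<^esub>"
  unfolding gr_yangian_simps
proof
  fix d
  show "gr_symbol YA (yangian_filt M N) 0 \<one>\<^bsub>YA\<^esub> d = gr_proj \<one>\<^bsub>FA\<^esub> d"
    using projD(4) by (auto simp: gr_symbol_def gr_proj_def free_algebra_simps pm_filter_simps proj_zero below_coset_zero)
qed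

lemma gr_add:
  assumes "f \<in> carrier FA" "g \<in> carrier FA"
  shows "gr_proj f \<oplus>\<^bsub>GY\<^esub> gr_proj g = gr_proj (f + g)"
  unfolding gr_yangian_simps
proof
  fix d
  let ?x = "proj (deg_part d f)" and ?y = "proj (deg_part d g)"
  have c: "?x \<in> carrier YA" "?y \<in> carrier YA" using assms by (auto simp: projD FA_filter_closed)
  have "YB d +>\<^bsub>YA\<^esub> ?x <+>\<^bsub>YA\<^esub> (YB d +>\<^bsub>YA\<^esub> ?y) = YB d +>\<^bsub>YA\<^esub> (?x \<oplus>\<^bsub>YA\<^esub> ?y)"
  proof (intro equalityI subsetI)
    fix z assume "z \<in> YB d +>\<^bsub>YA\<^esub> ?x <+>\<^bsub>YA\<^esub> (YB d +>\<^bsub>YA\<^esub> ?y)"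
    then obtain b b' where b: "b \<in> YB d" "b' \<in> YB d" "z = (b \<oplus>\<^bsub>YA\<^esub> ?x) \<oplus>\<^bsub>YA\<^esub> (b' \<oplus>\<^bsub>YA\<^esub> ?y)"
      by (auto simp: set_add_def' a_r_coset_def')
    then have "z = (b \<oplus>\<^bsub>YA\<^esub> b') \<oplus>\<^bsub>YA\<^esub> (?x \<oplus>\<^bsub>YA\<^esub> ?y)"
      using c below_closed(1)[OF b(1) b(1)] below_closed(1)[OF b(2) b(2)] by (simp add: YA.add.m_ac)
    then show "z \<in> YB d +>\<^bsub>YA\<^esub> (?x \<oplus>\<^bsub>YA\<^esub> ?y)"
      using below_closed(2)[OF b(1,2)] by (auto simp: a_r_coset_def')
  next
    fix z assume "z \<in> YB d +>\<^bsub>YA\<^esub> (?x \<oplus>\<^bsub>YA\<^esub> ?y)"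
    then obtain b where b: "b \<in> YB d" "z = b \<oplus>\<^bsub>YA\<^esub> (?x \<oplus>\<^bsub>YA\<^esub> ?y)" by (auto simp: a_r_coset_def')
    then have "z = (b \<oplus>\<^bsub>YA\<^esub> ?x) \<oplus>\<^bsub>YA\<^esub> (\<zero>\<^bsub>YA\<^esub> \<oplus>\<^bsub>YA\<^esub> ?y)"
      using c below_closed(1)[OF b(1) b(1)] by (simp add: YA.a_assoc)
    then show "z \<in> YB d +>\<^bsub>YA\<^esub> ?x <+>\<^bsub>YA\<^esub> (YB d +>\<^bsub>YA\<^esub> ?y)"
      using b(1) zero_below unfolding set_add_def' a_r_coset_def' by blast
  qed
  then show "gr_proj f d <+>\<^bsub>YA\<^esub> gr_proj g d = gr_proj (f + g) d"
    using assms by (simp add: gr_proj_def pm_filter_simps proj_add FA_filter_closed)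
qed

lemma gr_smult:
  assumes "f \<in> carrier FA"
  shows "c \<odot>\<^bsub>GY\<^esub> gr_proj f = gr_proj (Poly_Mapping.map ((*) c) f)"
  unfolding gr_yangian_simps
proof
  fix d
  let ?x = "proj (deg_part d f)"
  have x: "?x \<in> carrier YA" using assms by (simp add: projD FA_filter_closed)
  have "YB d +>\<^bsub>YA\<^esub> (c \<odot>\<^bsub>YA\<^esub> y) = YB d +>\<^bsub>YA\<^esub> (c \<odot>\<^bsub>YA\<^esub> ?x)" if "y \<in> gr_proj f d" for y
  proof -
    have y: "y \<in> carrier YA" "y \<ominus>\<^bsub>YA\<^esub> ?x \<in> YB d"
      using that below_coset_mem_iff[OF x] by (auto simp: gr_proj_def)
    have "c \<odot>\<^bsub>YA\<^esub> (y \<ominus>\<^bsub>YA\<^esub> ?x) = c \<odot>\<^bsub>YA\<^esub> y \<ominus>\<^bsub>YA\<^esub> c \<odot>\<^bsub>YA\<^esub> ?x"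
      using x y(1) YA.mod.smult_r_minus[of c ?x] by (simp add: a_minus_def YA.smult_r_distrC)
    then have "c \<odot>\<^bsub>YA\<^esub> y \<ominus>\<^bsub>YA\<^esub> c \<odot>\<^bsub>YA\<^esub> ?x \<in> YB d"
      using below_closed(4)[OF y(2) y(2), of c] by simp
    then show ?thesis using x y by (simp add: below_coset_iff)
  qed
  moreover have "?x \<in> gr_proj f d"
    unfolding gr_proj_def below_coset_mem_iff[OF x] using x zero_below by (simp add: a_minus_def YA.r_neg)
  ultimately have "(\<Union>y\<in>gr_proj f d. YB d +>\<^bsub>YA\<^esub> (c \<odot>\<^bsub>YA\<^esub> y)) = YB d +>\<^bsub>YA\<^esub> (c \<odot>\<^bsub>YA\<^esub> ?x)"
    by blast
  then show "(\<Union>y\<in>gr_proj f d. YB d +>\<^bsub>YA\<^esub> (c \<odot>\<^bsub>YA\<^esub> y)) = gr_proj (Poly_Mapping.map ((*) c) f) d"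
    using assms by (simp add: gr_proj_def pm_filter_simps proj_smult FA_filter_closed)
qed

lemma gr_proj_repr:
  assumes f: "f \<in> carrier FA" and x: "x \<in> gr_proj f p"
  shows "\<exists>u\<in>carrier FA. x = proj u \<and> deg_lt p (u - deg_part p f)"
proof -
  have c: "proj (deg_part p f) \<in> carrier YA" using f by (simp add: projD FA_filter_closed)
  then have "x \<in> carrier YA" "x \<ominus>\<^bsub>YA\<^esub> proj (deg_part p f) \<in> YB p"
    using x below_coset_mem_iff by (auto simp: gr_proj_def)
  then obtain b where b: "b \<in> carrier FA" "deg_lt p b" "x \<ominus>\<^bsub>YA\<^esub> proj (deg_part p f) = proj b"
    unfolding below_eq by auto
  have "x = (x \<ominus>\<^bsub>YA\<^esub> proj (deg_part p f)) \<oplus>\<^bsub>YA\<^esub> proj (deg_part p f)"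
    using c \<open>x \<in> carrier YA\<close> by (simp add: a_minus_def YA.a_assoc YA.l_neg)
  also have "\<dots> = proj (b + deg_part p f)"
    using b f by (simp add: proj_add FA_filter_closed)
  finally show ?thesis
    using b f by (intro bexI[of _ "b + deg_part p f"]) (auto intro: FA_add_closed FA_filter_closed)
qed

lemma FA_mult_closed: "f \<in> carrier FA \<Longrightarrow> g \<in> carrier FA \<Longrightarrow> f \<otimes>\<^bsub>FA\<^esub> g \<in> carrier FA"
  by (rule FA.m_closed)

lemma finsum_proj:
  assumes "finite P" "\<And>p. u p \<in> carrier FA" "\<And>p. v p \<in> carrier FA"
  shows "(\<Oplus>\<^bsub>YA\<^esub>p\<in>P. proj (u p) \<otimes>\<^bsub>YA\<^esub> proj (v p)) = proj (\<Sum>p\<in>P. u p \<otimes>\<^bsub>FA\<^esub> v p)"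
  using assms(1)
proof (induction P)
  case (insert p P)
  then show ?case
    using assms by (subst YA.finsum_insert)
      (auto simp: projD proj_add FA_sum_closed FA_mult_closed)
qed (simp add: proj_zero)

text \<open>The product in \<open>gr_algebra\<close> is a union over all choices of representatives.
  All choices give the same coset, and the choice of the homogeneous parts themselves shows that the
  union is not empty.\<close>

lemma gr_mult:
  assumes f: "f \<in> carrier FA" and g: "g \<in> carrier FA"
  shows "gr_proj f \<otimes>\<^bsub>GY\<^esub> gr_proj g = gr_proj (f \<otimes>\<^bsub>FA\<^esub> g)"
  unfolding gr_yangian_simps
proof
  fix d
  let ?P = "\<lambda>x y. (\<forall>p. x p \<in> gr_proj f p) \<and> (\<forall>q. y q \<in> gr_proj g q)"
  have all: "YB d +>\<^bsub>YA\<^esub> (\<Oplus>\<^bsub>YA\<^esub>p\<in>{..d}. x p \<otimes>\<^bsub>YA\<^esub> y (d - p)) = gr_proj (f \<otimes>\<^bsub>FA\<^esub> g) d" if xy: "?P x y" for x y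
  proof -
    have "\<forall>p. \<exists>w. w \<in> carrier FA \<and> x p = proj w \<and> deg_lt p (w - deg_part p f)"
      using xy gr_proj_repr[OF f] by blast
    from choice[OF this] obtain u where
      u: "\<And>p. u p \<in> carrier FA" "\<And>p. x p = proj (u p)" "\<And>p. deg_lt p (u p - deg_part p f)"
      by blast
    have "\<forall>p. \<exists>w. w \<in> carrier FA \<and> y p = proj w \<and> deg_lt p (w - deg_part p g)"
      using xy gr_proj_repr[OF g] by blast
    from choice[OF this] obtain v where
      v: "\<And>p. v p \<in> carrier FA" "\<And>p. y p = proj (v p)" "\<And>p. deg_lt p (v p - deg_part p g)"
      by blast
    let ?s = "\<Sum>p\<le>d. u p \<otimes>\<^bsub>FA\<^esub> v (d - p)"
    have s: "(\<Oplus>\<^bsub>YA\<^esub>p\<in>{..d}. x p \<otimes>\<^bsub>YA\<^esub> y (d - p)) = proj ?s"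
      unfolding u(2) v(2) by (rule finsum_proj) (simp_all add: u v)
    have sc: "?s \<in> carrier FA"
      by (intro FA_sum_closed FA_mult_closed u v)
    have t: "deg_lt d (u p \<otimes>\<^bsub>FA\<^esub> v (d - p) - deg_part p f \<otimes>\<^bsub>FA\<^esub> deg_part (d - p) g)" if "p \<le> d" for p
    proof -
      let ?f = "deg_part p f" and ?g = "deg_part (d - p) g"
      have "u p \<otimes>\<^bsub>FA\<^esub> v (d - p) = (u p - ?f) \<otimes>\<^bsub>FA\<^esub> v (d - p) + ?f \<otimes>\<^bsub>FA\<^esub> v (d - p)"
        unfolding free_algebra_mult(2)[symmetric] by simp
      moreover have "?f \<otimes>\<^bsub>FA\<^esub> v (d - p) = ?f \<otimes>\<^bsub>FA\<^esub> (v (d - p) - ?g) + ?f \<otimes>\<^bsub>FA\<^esub> ?g"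
        unfolding free_algebra_mult(3)[symmetric] by simp
      \<comment> \<open>Changing the factors one at a time shows that each summand differs from the
        product of the homogeneous parts by terms of degree below \<open>d\<close>.\<close>
      ultimately have e: "u p \<otimes>\<^bsub>FA\<^esub> v (d - p) - ?f \<otimes>\<^bsub>FA\<^esub> ?g =
          (u p - ?f) \<otimes>\<^bsub>FA\<^esub> v (d - p) + ?f \<otimes>\<^bsub>FA\<^esub> (v (d - p) - ?g)"
        by simp
      have "deg_le (d - p) ((v (d - p) - ?g) + ?g)"
        by (rule deg_bounds(7)[OF deg_bounds(8)[OF v(3)] deg_bounds(9)])
      then have vd: "deg_le (d - p) (v (d - p))" by simp
      have "deg_lt (p + (d - p)) ((u p - ?f) \<otimes>\<^bsub>FA\<^esub> v (d - p))"
        by (rule deg_mult(2)[OF u(3) vd])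
      moreover have "deg_lt (p + (d - p)) (?f \<otimes>\<^bsub>FA\<^esub> (v (d - p) - ?g))"
        by (rule deg_mult(3)[OF deg_bounds(9) v(3)])
      ultimately show ?thesis unfolding e using that deg_bounds(2) by simp
    qed
    have "deg_lt d (?s - deg_part d (f \<otimes>\<^bsub>FA\<^esub> g))"
      unfolding deg_part_mult[OF f g] sum_subtractf[symmetric] using t by (intro deg_sum) auto
    then have "proj (?s - deg_part d (f \<otimes>\<^bsub>FA\<^esub> g)) \<in> YB d"
      unfolding below_eq using sc f g by (intro imageI) (auto intro: FA_diff_closed FA_filter_closed FA_mult_closed)
    then show ?thesis
      unfolding s gr_proj_def using sc f g
      by (simp add: below_coset_iff projD FA_filter_closed FA_mult_closed proj_diff)
  qed
  have one: "?P (\<lambda>p. proj (deg_part p f)) (\<lambda>p. proj (deg_part p g))"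
    using f g zero_below by (simp add: gr_proj_def below_coset_mem_iff projD FA_filter_closed a_minus_def YA.r_neg)
  have "{YB d +>\<^bsub>YA\<^esub> (\<Oplus>\<^bsub>YA\<^esub>p\<in>{..d}. x p \<otimes>\<^bsub>YA\<^esub> y (d - p)) | x y. ?P x y} = {gr_proj (f \<otimes>\<^bsub>FA\<^esub> g) d}"
  proof (intro equalityI subsetI)
    fix z assume "z \<in> {YB d +>\<^bsub>YA\<^esub> (\<Oplus>\<^bsub>YA\<^esub>p\<in>{..d}. x p \<otimes>\<^bsub>YA\<^esub> y (d - p)) | x y. ?P x y}"
    then obtain x y where "?P x y" "z = YB d +>\<^bsub>YA\<^esub> (\<Oplus>\<^bsub>YA\<^esub>p\<in>{..d}. x p \<otimes>\<^bsub>YA\<^esub> y (d - p))" by blast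
    then show "z \<in> {gr_proj (f \<otimes>\<^bsub>FA\<^esub> g) d}" using all[of x y] by simp
  next
    fix z assume "z \<in> {gr_proj (f \<otimes>\<^bsub>FA\<^esub> g) d}"
    then show "z \<in> {YB d +>\<^bsub>YA\<^esub> (\<Oplus>\<^bsub>YA\<^esub>p\<in>{..d}. x p \<otimes>\<^bsub>YA\<^esub> y (d - p)) | x y. ?P x y}"
      using one all[OF one]
      by (intro CollectI exI[of _ "\<lambda>p. proj (deg_part p f)"] exI[of _ "\<lambda>p. proj (deg_part p g)"]) simp
  qed
  then show "\<Union>{YB d +>\<^bsub>YA\<^esub> (\<Oplus>\<^bsub>YA\<^esub>p\<in>{..d}. x p \<otimes>\<^bsub>YA\<^esub> y (d - p)) | x y. ?P x y} = gr_proj (f \<otimes>\<^bsub>FA\<^esub> g) d"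
    by simp
qed

lemma gr_alg: "assoc_algebra GY" "gr_proj \<in> alg_hom FA GY"
  using assoc_algebra_image[OF free_algebra_alg gr_carrier] gr_mult gr_add gr_smult gr_one gr_zero
  by (simp_all add: free_algebra_simps)

lemma X_gen_eq:
  assumes "g \<in> ygens M N"
  shows "X_gen M N g = gr_proj (free_gen g)"
proof -
  obtain i j r where g: "g = (i, j, r)" by (cases g)
  show ?thesis
    unfolding g X_gen_def by (rule ext) 
      (auto simp: gr_symbol_def gr_proj_def free_gen_def pm_filter_simps gdeg_def proj_zero below_coset_zero)
qed

end

section \<open>Parity\<close>

definition wpar :: "nat \<Rightarrow> ygen list \<Rightarrow> nat" where
  "wpar M w = (\<Sum>g\<leftarrow>w. gen_parity M g)"

lemma wpar_simps [simp]: "wpar M [] = 0" "wpar M (g # w) = gen_parity M g + wpar M w" "wpar M (v @ w) = wpar M v + wpar M w"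
  by (simp_all add: wpar_def)

definition homog :: "nat \<Rightarrow> nat \<Rightarrow> (ygen list \<Rightarrow>\<^sub>0 complex) \<Rightarrow> bool" where
  "homog M e f \<longleftrightarrow> (\<forall>w\<in>Poly_Mapping.keys f. wpar M w mod 2 = e)"

abbreviation par_part :: "nat \<Rightarrow> nat \<Rightarrow> (ygen list \<Rightarrow>\<^sub>0 complex) \<Rightarrow> ygen list \<Rightarrow>\<^sub>0 complex" where
  "par_part M e \<equiv> pm_filter (\<lambda>w. wpar M w mod 2 = e)"

text \<open>The parity automorphism. Its eigenspaces for 1 and -1 are the even and the odd part, so
  its invariance of the Yangian ideal shows that the ideal is homogeneous for the parity.\<close>

definition par_aut :: "nat \<Rightarrow> (ygen list \<Rightarrow>\<^sub>0 complex) \<Rightarrow> ygen list \<Rightarrow>\<^sub>0 complex" where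
  "par_aut M f = Poly_Mapping.mapp (\<lambda>w c. (-1) ^ wpar M w * c) f"

lemma lookup_par_aut: "Poly_Mapping.lookup (par_aut M f) w = (-1) ^ wpar M w * Poly_Mapping.lookup f w"
  by (simp add: par_aut_def lookup_mapp when_def in_keys_iff)

lemma par_aut_simps:
  "par_aut M 0 = 0" "par_aut M (f + g) = par_aut M f + par_aut M g" "par_aut M (f - g) = par_aut M f - par_aut M g"
  "par_aut M (Poly_Mapping.single w c) = Poly_Mapping.single w ((-1) ^ wpar M w * c)"
  "par_aut M (Poly_Mapping.map ((*) c) f) = Poly_Mapping.map ((*) c) (par_aut M f)"
  by (rule poly_mapping_eqI; auto simp: lookup_par_aut lookup_add lookup_minus lookup_single lookup_scale when_def algebra_simps)+

lemma keys_par_aut: "Poly_Mapping.keys (par_aut M f) = Poly_Mapping.keys f"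
  by (auto simp: in_keys_iff lookup_par_aut)

lemma par_aut_mult: "par_aut M (f \<otimes>\<^bsub>free_algebra G\<^esub> g) = par_aut M f \<otimes>\<^bsub>free_algebra G\<^esub> par_aut M g"
proof -
  have f: "Poly_Mapping.keys f \<subseteq> UNIV" and g: "Poly_Mapping.keys g \<subseteq> UNIV" by auto
  show ?thesis using f
  proof (induction rule: poly_mapping_keys_induct)
    case (single v a)
    show ?case using g
      by (induction rule: poly_mapping_keys_induct)
        (simp_all add: free_algebra_mult par_aut_simps power_add ac_simps)
  qed (simp_all add: free_algebra_mult par_aut_simps)
qed

lemma par_aut_alg_hom: "par_aut M \<in> alg_hom (free_algebra G) (free_algebra G)"
  by (rule alg_homI) (auto simp: free_algebra_simps par_aut_simps par_aut_mult keys_par_aut)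

lemma sign_gen_parity: "(-1 :: complex) ^ gen_parity M (i, j, r) = (-1) ^ (ipar M i + ipar M j)"
  by (simp add: gen_parity_def minus_one_power_iff)

lemma par_aut_T_coeff:
  "par_aut M (T_coeff i j r) = Poly_Mapping.map ((*) ((-1) ^ (ipar M i + ipar M j))) (T_coeff i j r)"
proof -
  have "(-1 :: complex) ^ (ipar M j + ipar M j) = 1" by (simp add: minus_one_power_iff)
  moreover have "Poly_Mapping.map ((*) c) 0 = 0" for c :: complex
    by (rule poly_mapping_eqI) (simp add: lookup_scale)
  ultimately show ?thesis
    by (auto simp: T_coeff_def free_gen_def par_aut_simps scale_single sign_gen_parity)
qed

context
  fixes M N :: nat
begin

interpretation FA: complex_algebra "FA M N" by unfold_locales (rule free_algebra_alg)
interpretation YA: complex_algebra "YA M N" by unfold_locales (rule yangian_alg)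
interpretation GY: complex_algebra "GY M N" by unfold_locales (rule gr_alg)

lemma par_aut_T_mult:
  assumes "i \<in> {1..M + N}" "j \<in> {1..M + N}" "k \<in> {1..M + N}" "l \<in> {1..M + N}"
  shows "par_aut M (T_coeff i j r \<otimes>\<^bsub>FA M N\<^esub> T_coeff k l s) =
    Poly_Mapping.map ((*) ((-1) ^ (ipar M i + ipar M j + ipar M k + ipar M l))) (T_coeff i j r \<otimes>\<^bsub>FA M N\<^esub> T_coeff k l s)"
proof -
  note c = T_coeff_carrier[OF assms(1,2), of r] T_coeff_carrier[OF assms(3,4), of s]
  have "par_aut M (T_coeff i j r \<otimes>\<^bsub>FA M N\<^esub> T_coeff k l s) =
    ((-1) ^ (ipar M i + ipar M j) \<odot>\<^bsub>FA M N\<^esub> T_coeff i j r) \<otimes>\<^bsub>FA M N\<^esub> ((-1) ^ (ipar M k + ipar M l) \<odot>\<^bsub>FA M N\<^esub> T_coeff k l s)"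
    unfolding par_aut_mult par_aut_T_coeff by (simp add: free_algebra_simps)
  also have "\<dots> = ((-1) ^ (ipar M i + ipar M j) * (-1) ^ (ipar M k + ipar M l)) \<odot>\<^bsub>FA M N\<^esub> (T_coeff i j r \<otimes>\<^bsub>FA M N\<^esub> T_coeff k l s)"
    using c by (simp add: FA.smult_mult_left FA.smult_mult_right FA.smult_assocC[symmetric] mult.commute)
  finally show ?thesis by (simp add: free_algebra_simps power_add[symmetric] add.assoc)
qed

lemma scale_diff: "Poly_Mapping.map ((*) (c::complex)) (f - g) = Poly_Mapping.map ((*) c) f - Poly_Mapping.map ((*) c) g"
  and scale_scale: "Poly_Mapping.map ((*) (c::complex)) (Poly_Mapping.map ((*) d) f) = Poly_Mapping.map ((*) (c * d)) f"
  and scale_one: "Poly_Mapping.map ((*) (1::complex)) f = f"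
  and scale_zero: "Poly_Mapping.map ((*) (c::complex)) 0 = (0 :: 'a \<Rightarrow>\<^sub>0 complex)"
  for f g :: "'a \<Rightarrow>\<^sub>0 complex"
  by (rule poly_mapping_eqI; simp add: lookup_scale lookup_minus algebra_simps)+

text \<open>All terms of the relation have the same parity, namely that of the sum over the four
  indices.\<close>

lemma par_aut_yangian_rel:
  assumes "i \<in> {1..M + N}" "j \<in> {1..M + N}" "k \<in> {1..M + N}" "l \<in> {1..M + N}"
  shows "par_aut M (yangian_rel M N i j k l r s) =
    Poly_Mapping.map ((*) ((-1) ^ (ipar M i + ipar M j + ipar M k + ipar M l))) (yangian_rel M N i j k l r s)"
proof -
  define \<sigma> :: complex where "\<sigma> = (-1) ^ (ipar M i + ipar M j + ipar M k + ipar M l)"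
  have 1: "par_aut M (T_coeff i j r \<otimes>\<^bsub>FA M N\<^esub> T_coeff k l s) = Poly_Mapping.map ((*) \<sigma>) (T_coeff i j r \<otimes>\<^bsub>FA M N\<^esub> T_coeff k l s)"
    "par_aut M (T_coeff k l s \<otimes>\<^bsub>FA M N\<^esub> T_coeff i j r) = Poly_Mapping.map ((*) \<sigma>) (T_coeff k l s \<otimes>\<^bsub>FA M N\<^esub> T_coeff i j r)"
    "par_aut M (T_coeff k j s \<otimes>\<^bsub>FA M N\<^esub> T_coeff i l r) = Poly_Mapping.map ((*) \<sigma>) (T_coeff k j s \<otimes>\<^bsub>FA M N\<^esub> T_coeff i l r)" for r s
    unfolding \<sigma>_def using assms by (simp_all add: par_aut_T_mult ac_simps)
  show ?thesis
    unfolding yangian_rel_def T_supercomm_def Let_def free_algebra_simps par_aut_simps 1 scale_diff scale_scale \<sigma>_def[symmetric]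
    by (simp only: mult.commute mult.left_commute)
qed

lemma par_aut_ideal: "f \<in> YI M N \<Longrightarrow> par_aut M f \<in> YI M N"
proof -
  assume f: "f \<in> YI M N"
  have h: "(\<lambda>f. proj M N (par_aut M f)) \<in> alg_hom (FA M N) (YA M N)"
    by (rule alg_hom_comp[OF par_aut_alg_hom proj_alg_hom])
  have "proj M N (par_aut M f) = \<zero>\<^bsub>YA M N\<^esub>"
  proof (rule alg_hom_vanish_genideal[OF free_algebra_alg yangian_alg h yangian_gens_carrier])
    fix g assume "g \<in> {yangian_rel M N i j k l r s | i j k l r s.
        i \<in> {1..M + N} \<and> j \<in> {1..M + N} \<and> k \<in> {1..M + N} \<and> l \<in> {1..M + N}}"
    then obtain i j k l r s where g: "g = yangian_rel M N i j k l r s"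
      "i \<in> {1..M + N}" "j \<in> {1..M + N}" "k \<in> {1..M + N}" "l \<in> {1..M + N}" by blast
    have "(-1) ^ (ipar M i + ipar M j + ipar M k + ipar M l) \<odot>\<^bsub>FA M N\<^esub> yangian_rel M N i j k l r s \<in> YI M N"
      by (rule FA.ideal_smult_closed[OF yangian_ideal yangian_rel_in_ideal[OF g(2-5)]])
    then show "proj M N (par_aut M g) = \<zero>\<^bsub>YA M N\<^esub>"
      unfolding g(1) par_aut_yangian_rel[OF g(2-5)] by (simp add: free_algebra_simps proj_ideal)
  next
    show "f \<in> Idl\<^bsub>FA M N\<^esub> {yangian_rel M N i j k l r s | i j k l r s.
        i \<in> {1..M + N} \<and> j \<in> {1..M + N} \<and> k \<in> {1..M + N} \<and> l \<in> {1..M + N}}"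
      using f unfolding yangian_ideal_def .
  qed
  moreover have "par_aut M f \<in> carrier (FA M N)"
    using ideal.Icarr[OF yangian_ideal f] by (simp add: free_algebra_simps keys_par_aut)
  ultimately show ?thesis
    using proj_eq_iff[of "par_aut M f" M N 0] proj_zero by (simp add: free_algebra_simps)
qed

text \<open>The projections onto the eigenspaces of an involution.\<close>

lemma par_part_eq:
  assumes "e < 2"
  shows "par_part M e f = Poly_Mapping.map ((*) (1/2)) (f + Poly_Mapping.map ((*) ((-1) ^ e)) (par_aut M f))"
proof (rule poly_mapping_eqI)
  fix w
  have "e = 0 \<or> e = 1" using assms by auto
  then show "Poly_Mapping.lookup (par_part M e f) w =
    Poly_Mapping.lookup (Poly_Mapping.map ((*) (1/2)) (f + Poly_Mapping.map ((*) ((-1) ^ e)) (par_aut M f))) w"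
    by (cases "even (wpar M w)") (auto simp: lookup_pm_filter lookup_scale lookup_add lookup_par_aut even_iff_mod_2_eq_zero odd_iff_mod_2_eq_one)
qed

lemma par_part_ideal: "f \<in> YI M N \<Longrightarrow> e < 2 \<Longrightarrow> par_part M e f \<in> YI M N"
  using FA.ideal_smult_closed[OF yangian_ideal] par_aut_ideal
    additive_subgroup.a_closed[OF ideal.axioms(1)[OF yangian_ideal]]
  by (simp add: par_part_eq free_algebra_simps)

lemma par_part_below:
  assumes "f \<in> below_pre M N d" "e < 2"
  shows "par_part M e f \<in> below_pre M N d"
proof -
  obtain b where b: "f \<in> carrier (FA M N)" "b \<in> carrier (FA M N)" "deg_lt d b" "f - b \<in> YI M N"
    using assms(1) unfolding below_pre_iff by blast
  have "par_part M e f - par_part M e b \<in> YI M N"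
    using par_part_ideal[OF b(4) assms(2)] by (simp add: pm_filter_simps)
  then show ?thesis
    unfolding below_pre_iff using b by (intro conjI bexI[of _ "par_part M e b"]) (auto simp: FA_filter_closed deg_bounds)
qed

lemma yangian_parity_eq: "yangian_parity M N e = proj M N ` {f \<in> carrier (FA M N). homog M e f}"
  by (simp add: yangian_parity_def homog_def wpar_def)

lemma par_part_homog: "homog M e f \<Longrightarrow> par_part M e f = f"
  unfolding homog_def by (rule pm_filter_id) auto

lemma gr_parity_eq:
  assumes e: "e < 2"
  shows "gr_yangian_parity M N e = gr_proj M N ` {f \<in> carrier (FA M N). homog M e f}"
proof (intro equalityI subsetI)
  fix a assume "a \<in> gr_yangian_parity M N e"
  then have a: "a \<in> carrier (GY M N)"
    "\<And>d. \<exists>x\<in>yangian_filt M N d \<inter> yangian_parity M N e. a d = YB M N d +>\<^bsub>YA M N\<^esub> x"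
    by (auto simp: gr_yangian_parity_def gr_parity_def gr_yangian_def)
  have F: "\<exists>f\<in>carrier (FA M N). deg_le d f \<and> (\<forall>w\<in>Poly_Mapping.keys f. wpar M w mod 2 = e) \<and>
      a d = YB M N d +>\<^bsub>YA M N\<^esub> proj M N f" for d
  proof -
    obtain x where x: "x \<in> yangian_filt M N d" "x \<in> yangian_parity M N e" "a d = YB M N d +>\<^bsub>YA M N\<^esub> x"
      using a(2)[of d] by blast
    obtain f where f: "f \<in> carrier (FA M N)" "deg_le d f" "x = proj M N f"
      using x(1) unfolding filt_eq by blast
    obtain f' where f': "f' \<in> carrier (FA M N)" "homog M e f'" "x = proj M N f'"
      using x(2) unfolding yangian_parity_eq by blast
    have "f - f' \<in> YI M N" using f f' proj_eq_iff by metis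
    \<comment> \<open>The element has one lift \<open>f\<close> of bounded degree and another lift
      \<open>f'\<close> of pure parity. Since the ideal is homogeneous, the parity part of
      \<open>f\<close> is a lift with both properties.\<close>
    then have "par_part M e f - f' \<in> YI M N"
      using par_part_ideal[OF _ e, of "f - f'"] par_part_homog[OF f'(2)] by (simp add: pm_filter_simps)
    then have "x = proj M N (par_part M e f)"
      using f f' proj_eq_iff FA_filter_closed by metis
    then show ?thesis using f x(3)
      by (intro bexI[of _ "par_part M e f"]) (auto simp: deg_bounds keys_pm_filter FA_filter_closed)
  qed
  have fin: "finite {d. a d \<noteq> YB M N d}" using a(1) by (simp add: gr_yangian_simps)
  obtain f where "f \<in> carrier (FA M N)" "\<forall>w\<in>Poly_Mapping.keys f. wpar M w mod 2 = e" "gr_proj M N f = a"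
    using gr_assemble[OF F fin] by blast
  then show "a \<in> gr_proj M N ` {f \<in> carrier (FA M N). homog M e f}"
    by (auto simp: homog_def)
next
  fix a assume "a \<in> gr_proj M N ` {f \<in> carrier (FA M N). homog M e f}"
  then obtain f where f: "f \<in> carrier (FA M N)" "homog M e f" "a = gr_proj M N f" by blast
  have "proj M N (deg_part d f) \<in> yangian_filt M N d \<inter> yangian_parity M N e" for d
    using f by (auto simp: filt_eq yangian_parity_eq homog_def keys_pm_filter FA_filter_closed deg_bounds intro!: imageI)
  then have "\<forall>d. \<exists>x\<in>yangian_filt M N d \<inter> yangian_parity M N e. a d = YB M N d +>\<^bsub>YA M N\<^esub> x"
    unfolding f(3) gr_proj_def by blast
  moreover have "a \<in> carrier (GY M N)" using f gr_carrier by blast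
  ultimately show "a \<in> gr_yangian_parity M N e"
    unfolding gr_yangian_parity_def gr_parity_def gr_yangian_def[symmetric] by blast
qed

section \<open>Supercommutativity of the graded algebra\<close>

lemma deg_le_T_coeff: "deg_le r (T_coeff i j (int r))"
  by (auto simp: deg_le_def T_coeff_def free_gen_def gdeg_def)

text \<open>Up to sign, the relation trades the pair \<open>Suc r\<close>, \<open>s\<close> for
  \<open>r\<close>, \<open>Suc s\<close> at the price of products of total degree
  \<open>r + s\<close>, one less than allowed. The sum of the indices is preserved, and at
  \<open>r = 0\<close> the supercommutator with a scalar vanishes.\<close>

lemma T_supercomm_below:
  assumes ijkl: "i \<in> {1..M + N}" "j \<in> {1..M + N}" "k \<in> {1..M + N}" "l \<in> {1..M + N}"
  shows "T_supercomm M N i j k l (int r) (int s) \<in> below_pre M N (r + s)"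
proof (induction r arbitrary: s)
  case 0
  have c: "Poly_Mapping.keys (T_coeff k l (int s)) \<subseteq> lists (ygens M N)"
    using T_coeff_carrier[OF ijkl(3,4)] by (simp add: free_algebra_simps)
  have one: "Poly_Mapping.single [] 1 \<otimes>\<^bsub>FA M N\<^esub> T_coeff k l (int s) = T_coeff k l (int s)"
    "T_coeff k l (int s) \<otimes>\<^bsub>FA M N\<^esub> Poly_Mapping.single [] 1 = T_coeff k l (int s)"
    using FA.l_one[of "T_coeff k l (int s)"] FA.r_one[of "T_coeff k l (int s)"] c by (simp_all add: free_algebra_simps)
  have T0: "T_coeff j j 0 = Poly_Mapping.single [] 1" "i \<noteq> j \<Longrightarrow> T_coeff i j 0 = 0"
    by (simp_all add: T_coeff_def)
  have "T_supercomm M N i j k l (int 0) (int s) = 0"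
  proof (cases "i = j")
    case True
    have "(-1 :: complex) ^ ((ipar M i + ipar M j) * (ipar M k + ipar M l)) = 1"
      unfolding True by (simp add: minus_one_power_iff)
    then show ?thesis
      using True one T0 by (simp add: T_supercomm_def Let_def free_algebra_simps scale_one)
  next
    case False
    then show ?thesis
      by (simp add: T_supercomm_def Let_def T0 free_algebra_simps free_algebra_mult scale_zero)
  qed
  then show ?case by (simp add: below_pre_closed)
next
  case (Suc r)
  define \<epsilon> :: complex where "\<epsilon> = (-1) ^ (ipar M i * ipar M k + ipar M i * ipar M l + ipar M k * ipar M l)"
  have ee: "\<epsilon> * \<epsilon> = 1" by (simp add: \<epsilon>_def minus_one_power_iff)
  let ?A = "T_supercomm M N i j k l (int (Suc r)) (int s)" and ?B = "T_supercomm M N i j k l (int r) (int (Suc s))"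
  define R where "R = T_coeff k j (int r) \<otimes>\<^bsub>FA M N\<^esub> T_coeff i l (int s) - T_coeff k j (int s) \<otimes>\<^bsub>FA M N\<^esub> T_coeff i l (int r)"
  have rel: "yangian_rel M N i j k l (int r) (int s) = Poly_Mapping.map ((*) \<epsilon>) (?A - ?B) - R"
    unfolding yangian_rel_def Let_def R_def \<epsilon>_def by (simp add: free_algebra_simps add.commute)
  have "R \<in> carrier (FA M N)"
    unfolding R_def using ijkl by (intro FA_diff_closed FA_mult_closed T_coeff_carrier)
  moreover have "deg_le (r + s) (T_coeff k j (int r) \<otimes>\<^bsub>FA M N\<^esub> T_coeff i l (int s))"
    "deg_le (r + s) (T_coeff k j (int s) \<otimes>\<^bsub>FA M N\<^esub> T_coeff i l (int r))"
    using deg_mult(1)[OF deg_le_T_coeff deg_le_T_coeff, of r s] deg_mult(1)[OF deg_le_T_coeff deg_le_T_coeff, of s r]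
    by (simp_all add: add.commute)
  then have "deg_lt (Suc r + s) R"
    unfolding R_def by (intro deg_bounds(3)) (auto simp: deg_le_def deg_lt_def less_Suc_eq_le)
  ultimately have R: "R \<in> below_pre M N (Suc r + s)" by (rule below_pre_closed(5))
  have "yangian_rel M N i j k l (int r) (int s) + R \<in> below_pre M N (Suc r + s)"
    by (intro below_pre_closed(2) R below_pre_closed(6) yangian_rel_in_ideal ijkl)
  then have "Poly_Mapping.map ((*) \<epsilon>) (?A - ?B) \<in> below_pre M N (Suc r + s)"
    unfolding rel by simp
  from below_pre_closed(4)[OF this, of \<epsilon>] have "?A - ?B \<in> below_pre M N (Suc r + s)"
    by (simp add: scale_scale ee scale_one)
  moreover have "?B \<in> below_pre M N (Suc r + s)" using Suc[of "Suc s"] by simp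
  ultimately have "(?A - ?B) + ?B \<in> below_pre M N (Suc r + s)" by (rule below_pre_closed(2))
  then show ?case by simp
qed

lemma T_coeff_gen: "1 \<le> r \<Longrightarrow> T_coeff i j (int r) = free_gen (i, j, r)"
  by (simp add: T_coeff_def)

lemma free_gen_carrier: "g \<in> ygens M N \<Longrightarrow> free_gen g \<in> carrier (FA M N)"
  by (simp add: free_gen_def free_algebra_simps)

lemma gr_supercomm_gens:
  assumes g: "g \<in> ygens M N" and h: "h \<in> ygens M N"
  shows "gr_proj M N (free_gen g) \<otimes>\<^bsub>GY M N\<^esub> gr_proj M N (free_gen h) =
    (-1) ^ (gen_parity M g * gen_parity M h) \<odot>\<^bsub>GY M N\<^esub> (gr_proj M N (free_gen h) \<otimes>\<^bsub>GY M N\<^esub> gr_proj M N (free_gen g))"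
proof -
  obtain i j r where gi: "g = (i, j, r)" "i \<in> {1..M + N}" "j \<in> {1..M + N}" "1 \<le> r"
    using g by (cases g) (auto simp: ygens_def)
  obtain k l s where hi: "h = (k, l, s)" "k \<in> {1..M + N}" "l \<in> {1..M + N}" "1 \<le> s"
    using h by (cases h) (auto simp: ygens_def)
  define \<sigma> :: complex where "\<sigma> = (-1) ^ (gen_parity M g * gen_parity M h)"
  have \<sigma>: "(-1) ^ ((ipar M i + ipar M j) * (ipar M k + ipar M l)) = \<sigma>"
    by (simp add: \<sigma>_def gi hi gen_parity_def minus_one_power_iff)
  let ?c = "free_gen g \<otimes>\<^bsub>FA M N\<^esub> free_gen h - Poly_Mapping.map ((*) \<sigma>) (free_gen h \<otimes>\<^bsub>FA M N\<^esub> free_gen g)"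
  have c: "T_supercomm M N i j k l (int r) (int s) = ?c"
    unfolding T_supercomm_def Let_def T_coeff_gen[OF gi(4)] T_coeff_gen[OF hi(4)] \<sigma> free_algebra_simps gi(1) hi(1) ..
  have d: "deg_part d ?c = (if d = r + s then ?c else 0)" for d
    by (auto simp: free_gen_def free_algebra_mult pm_filter_simps scale_single gdeg_def gi hi)
  have "deg_part d ?c \<in> below_pre M N d" for d
    unfolding d using T_supercomm_below[OF gi(2,3) hi(2,3), of r s] c by (simp add: below_pre_closed)
  moreover have "free_gen g \<otimes>\<^bsub>FA M N\<^esub> free_gen h \<in> carrier (FA M N)" "free_gen h \<otimes>\<^bsub>FA M N\<^esub> free_gen g \<in> carrier (FA M N)"
    using g h by (auto intro: FA_mult_closed free_gen_carrier)
  ultimately have "gr_proj M N (free_gen g \<otimes>\<^bsub>FA M N\<^esub> free_gen h) =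
      gr_proj M N (Poly_Mapping.map ((*) \<sigma>) (free_gen h \<otimes>\<^bsub>FA M N\<^esub> free_gen g))"
    by (simp add: gr_proj_eq_iff FA_smult_closed)
  then show ?thesis
    using g h by (simp add: gr_mult gr_smult free_gen_carrier FA_mult_closed \<sigma>_def)
qed


lemma single_carrier: "w \<in> lists (ygens M N) \<Longrightarrow> Poly_Mapping.single w c \<in> carrier (FA M N)"
  by (simp add: free_algebra_simps)

lemma gr_word_closed: "w \<in> lists (ygens M N) \<Longrightarrow> gr_proj M N (Poly_Mapping.single w 1) \<in> carrier (GY M N)"
  using gr_carrier single_carrier by blast

lemma gr_word_append:
  "v \<in> lists (ygens M N) \<Longrightarrow> w \<in> lists (ygens M N) \<Longrightarrow>
    gr_proj M N (Poly_Mapping.single (v @ w) 1) =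
    gr_proj M N (Poly_Mapping.single v 1) \<otimes>\<^bsub>GY M N\<^esub> gr_proj M N (Poly_Mapping.single w 1)"
  by (simp add: gr_mult single_carrier free_algebra_mult)

lemma gr_supercomm_gen_word:
  assumes g: "g \<in> ygens M N" and w: "w \<in> lists (ygens M N)"
  shows "gr_proj M N (free_gen g) \<otimes>\<^bsub>GY M N\<^esub> gr_proj M N (Poly_Mapping.single w 1) =
    (-1) ^ (gen_parity M g * wpar M w) \<odot>\<^bsub>GY M N\<^esub> (gr_proj M N (Poly_Mapping.single w 1) \<otimes>\<^bsub>GY M N\<^esub> gr_proj M N (free_gen g))"
  using w
proof (induction w)
  case Nil
  have 1: "gr_proj M N (Poly_Mapping.single [] 1) = \<one>\<^bsub>GY M N\<^esub>"
    by (simp add: gr_one free_algebra_simps)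
  have "gr_proj M N (free_gen g) \<in> carrier (GY M N)" using gr_carrier free_gen_carrier[OF g] by blast
  then show ?case unfolding 1 by simp
next
  case (Cons h w)
  let ?G = "gr_proj M N (free_gen g)" and ?H = "gr_proj M N (free_gen h)" and ?W = "gr_proj M N (Poly_Mapping.single w 1)"
  have h: "h \<in> ygens M N" "w \<in> lists (ygens M N)" using Cons by auto
  have c: "?G \<in> carrier (GY M N)" "?H \<in> carrier (GY M N)" "?W \<in> carrier (GY M N)"
    using gr_carrier free_gen_carrier[OF g] free_gen_carrier[OF h(1)] gr_word_closed[OF h(2)] by blast+
  let ?s = "(-1 :: complex) ^ (gen_parity M g * gen_parity M h)" and ?t = "(-1 :: complex) ^ (gen_parity M g * wpar M w)"
  have hw: "gr_proj M N (Poly_Mapping.single (h # w) 1) = ?H \<otimes>\<^bsub>GY M N\<^esub> ?W"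
    using gr_word_append[of "[h]" w] h by (simp add: free_gen_def)
  have "?G \<otimes>\<^bsub>GY M N\<^esub> (?H \<otimes>\<^bsub>GY M N\<^esub> ?W) = (?s \<odot>\<^bsub>GY M N\<^esub> (?H \<otimes>\<^bsub>GY M N\<^esub> ?G)) \<otimes>\<^bsub>GY M N\<^esub> ?W"
    using c gr_supercomm_gens[OF g h(1)] by (simp add: GY.m_assoc[symmetric])
  also have "\<dots> = ?s \<odot>\<^bsub>GY M N\<^esub> (?H \<otimes>\<^bsub>GY M N\<^esub> (?t \<odot>\<^bsub>GY M N\<^esub> (?W \<otimes>\<^bsub>GY M N\<^esub> ?G)))"
    using c Cons h by (simp add: GY.smult_mult_left GY.m_assoc)
  also have "\<dots> = (?s * ?t) \<odot>\<^bsub>GY M N\<^esub> ((?H \<otimes>\<^bsub>GY M N\<^esub> ?W) \<otimes>\<^bsub>GY M N\<^esub> ?G)"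
    using c by (simp add: GY.smult_mult_right GY.m_assoc GY.smult_assocC)
  finally show ?case
    unfolding hw by (simp add: power_add[symmetric] distrib_left)
qed

lemma gr_supercomm_words:
  assumes v: "v \<in> lists (ygens M N)" and w: "w \<in> lists (ygens M N)"
  shows "gr_proj M N (Poly_Mapping.single v 1) \<otimes>\<^bsub>GY M N\<^esub> gr_proj M N (Poly_Mapping.single w 1) =
    (-1) ^ (wpar M v * wpar M w) \<odot>\<^bsub>GY M N\<^esub> (gr_proj M N (Poly_Mapping.single w 1) \<otimes>\<^bsub>GY M N\<^esub> gr_proj M N (Poly_Mapping.single v 1))"
  using v
proof (induction v)
  case Nil
  have 1: "gr_proj M N (Poly_Mapping.single [] 1) = \<one>\<^bsub>GY M N\<^esub>"
    by (simp add: gr_one free_algebra_simps)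
  show ?case unfolding 1 using gr_word_closed[OF w] by simp
next
  case (Cons h v)
  let ?H = "gr_proj M N (free_gen h)" and ?V = "gr_proj M N (Poly_Mapping.single v 1)" and ?W = "gr_proj M N (Poly_Mapping.single w 1)"
  have h: "h \<in> ygens M N" "v \<in> lists (ygens M N)" using Cons by auto
  have c: "?H \<in> carrier (GY M N)" "?V \<in> carrier (GY M N)" "?W \<in> carrier (GY M N)"
    using gr_carrier free_gen_carrier[OF h(1)] gr_word_closed[OF h(2)] gr_word_closed[OF w] by blast+
  let ?s = "(-1 :: complex) ^ (gen_parity M h * wpar M w)" and ?t = "(-1 :: complex) ^ (wpar M v * wpar M w)"
  have hv: "gr_proj M N (Poly_Mapping.single (h # v) 1) = ?H \<otimes>\<^bsub>GY M N\<^esub> ?V"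
    using gr_word_append[of "[h]" v] h by (simp add: free_gen_def)
  have "(?H \<otimes>\<^bsub>GY M N\<^esub> ?V) \<otimes>\<^bsub>GY M N\<^esub> ?W = ?H \<otimes>\<^bsub>GY M N\<^esub> (?t \<odot>\<^bsub>GY M N\<^esub> (?W \<otimes>\<^bsub>GY M N\<^esub> ?V))"
    using c Cons h by (simp add: GY.m_assoc)
  also have "\<dots> = ?t \<odot>\<^bsub>GY M N\<^esub> ((?s \<odot>\<^bsub>GY M N\<^esub> (?W \<otimes>\<^bsub>GY M N\<^esub> ?H)) \<otimes>\<^bsub>GY M N\<^esub> ?V)"
    using c gr_supercomm_gen_word[OF h(1) w] by (simp add: GY.smult_mult_right GY.m_assoc[symmetric])
  also have "\<dots> = (?t * ?s) \<odot>\<^bsub>GY M N\<^esub> (?W \<otimes>\<^bsub>GY M N\<^esub> (?H \<otimes>\<^bsub>GY M N\<^esub> ?V))"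
    using c by (simp add: GY.smult_mult_left GY.m_assoc GY.smult_assocC)
  finally show ?case
    unfolding hv by (simp add: power_add[symmetric] distrib_right add.commute)
qed

lemma homog_induct [consumes 2, case_names zero single add]:
  assumes "f \<in> carrier (FA M N)" "homog M e f"
    and "P 0" "\<And>w c. w \<in> lists (ygens M N) \<Longrightarrow> wpar M w mod 2 = e \<Longrightarrow> P (Poly_Mapping.single w c)"
    "\<And>f g. f \<in> carrier (FA M N) \<Longrightarrow> g \<in> carrier (FA M N) \<Longrightarrow> P f \<Longrightarrow> P g \<Longrightarrow> P (f + g)"
  shows "P f"
proof -
  have "Poly_Mapping.keys f \<subseteq> {w \<in> lists (ygens M N). wpar M w mod 2 = e}"
    using assms(1,2) by (auto simp: free_algebra_simps homog_def)
  then show ?thesis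
  proof (induction rule: poly_mapping_keys_induct)
    case (add f g)
    then have "f \<in> carrier (FA M N)" "g \<in> carrier (FA M N)"
      unfolding free_algebra_simps by blast+
    then show ?case using add assms(5) by blast
  qed (use assms(3,4) in auto)
qed

lemma gr_proj_single: "w \<in> lists (ygens M N) \<Longrightarrow>
    gr_proj M N (Poly_Mapping.single w c) = c \<odot>\<^bsub>GY M N\<^esub> gr_proj M N (Poly_Mapping.single w 1)"
  by (simp add: gr_smult single_carrier scale_single)

lemma gr_supercomm:
  assumes f: "f \<in> carrier (FA M N)" "homog M e f" and g: "g \<in> carrier (FA M N)" "homog M e' g"
  shows "gr_proj M N f \<otimes>\<^bsub>GY M N\<^esub> gr_proj M N g =
    (-1) ^ (e * e') \<odot>\<^bsub>GY M N\<^esub> (gr_proj M N g \<otimes>\<^bsub>GY M N\<^esub> gr_proj M N f)"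
proof -
  have cl: "gr_proj M N f \<in> carrier (GY M N)" if "f \<in> carrier (FA M N)" for f
    using that gr_carrier by blast
  have z: "gr_proj M N 0 = \<zero>\<^bsub>GY M N\<^esub>" by (simp add: gr_zero)
  have plus: "gr_proj M N (f + g) = gr_proj M N f \<oplus>\<^bsub>GY M N\<^esub> gr_proj M N g" 
    if "f \<in> carrier (FA M N)" "g \<in> carrier (FA M N)" for f g
    using that by (simp add: gr_add)
  show ?thesis using f
  proof (induction rule: homog_induct)
    case zero
    then show ?case using cl[OF g(1)] by (simp add: z)
  next
    case (single v a)
    show ?case using g
    proof (induction rule: homog_induct)
      case zero
      then show ?case using cl[OF single_carrier[OF single(1)]] by (simp add: z)
    next
      case (single w b)
      have "even (wpar M v * wpar M w) = even (e * e')"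
        using \<open>wpar M v mod 2 = e\<close> \<open>wpar M w mod 2 = e'\<close> by auto
      then have s: "(-1 :: complex) ^ (wpar M v * wpar M w) = (-1) ^ (e * e')"
        by (simp add: minus_one_power_iff)
      note c = gr_word_closed[OF \<open>v \<in> lists (ygens M N)\<close>] gr_word_closed[OF \<open>w \<in> lists (ygens M N)\<close>]
      show ?case
        unfolding gr_proj_single[OF \<open>v \<in> lists (ygens M N)\<close>, of a] gr_proj_single[OF \<open>w \<in> lists (ygens M N)\<close>, of b]
        using c gr_supercomm_words[OF \<open>v \<in> lists (ygens M N)\<close> \<open>w \<in> lists (ygens M N)\<close>]
        by (simp add: GY.smult_mult_left GY.smult_mult_right GY.smult_assocC[symmetric] s ac_simps)
    next
      case (add f g)
      then show ?case
        using cl single_carrier[OF single(1)] by (simp add: plus GY.r_distr GY.l_distr GY.smult_r_distrC)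
    qed
  next
    case (add f f')
    then show ?case
      using cl g by (simp add: plus GY.r_distr GY.l_distr GY.smult_r_distrC)
  qed
qed

lemma homog_closed:
  "homog M e 0" "homog M e f \<Longrightarrow> homog M e g \<Longrightarrow> homog M e (f + g)" "homog M e f \<Longrightarrow> homog M e g \<Longrightarrow> homog M e (f - g)"
  "homog M e f \<Longrightarrow> homog M e (Poly_Mapping.map ((*) c) f)" "homog M e (par_part M e f)"
  "homog M e f \<Longrightarrow> homog M e (pm_filter P f)"
  using Poly_Mapping.keys_add[of f g] Poly_Mapping.keys_diff[of f g]
  by (auto simp: homog_def keys_pm_filter in_keys_iff lookup_scale)

lemma homog_mult: "homog M e f \<Longrightarrow> homog M e' g \<Longrightarrow> homog M ((e + e') mod 2) (f \<otimes>\<^bsub>FA M N\<^esub> g)"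
  unfolding homog_def
proof
  fix k assume f: "\<forall>w\<in>Poly_Mapping.keys f. wpar M w mod 2 = e" and g: "\<forall>w\<in>Poly_Mapping.keys g. wpar M w mod 2 = e'"
    and k: "k \<in> Poly_Mapping.keys (f \<otimes>\<^bsub>FA M N\<^esub> g)"
  then obtain v w where "k = v @ w" "wpar M v mod 2 = e" "wpar M w mod 2 = e'"
    by (auto elim!: free_algebra_keys_mult)
  then show "wpar M k mod 2 = (e + e') mod 2"
    using mod_add_eq[of "wpar M v" 2 "wpar M w"] by simp
qed

lemma par_part_decomp: "f = par_part M 0 f + par_part M 1 f"
  by (rule poly_mapping_eqI) (auto simp: lookup_add lookup_pm_filter)

text \<open>The subspaces \<open>below_pre\<close> are stable under the parity projections, and
  these annihilate the summand of the other parity.\<close>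

lemma gr_parity_unique:
  assumes "f \<in> carrier (FA M N)" "homog M 0 f" "g \<in> carrier (FA M N)" "homog M 1 g" "gr_proj M N (f + g) = gr_proj M N 0"
  shows "gr_proj M N f = gr_proj M N 0"
proof -
  have "deg_part d (f + g) \<in> below_pre M N d" for d
    using assms by (simp add: gr_proj_eq_iff FA_add_closed FA_zero_closed)
  then have "par_part M 0 (deg_part d (f + g)) \<in> below_pre M N d" for d
    using par_part_below by simp
  moreover have "par_part M 0 (deg_part d (f + g)) = deg_part d f" for d
  proof -
    have "par_part M 0 f = f" "par_part M 0 g = 0"
      using assms(2,4) by (auto simp: homog_def intro: pm_filter_id intro!: pm_filter_none)
    then have "par_part M 0 (f + g) = f" by (simp add: pm_filter_simps)
    moreover have "par_part M 0 (deg_part d (f + g)) = deg_part d (par_part M 0 (f + g))"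
      unfolding pm_filter_filter by (simp only: conj_commute)
    ultimately show ?thesis by simp
  qed
  ultimately show ?thesis
    using assms by (simp add: gr_proj_eq_iff FA_zero_closed)
qed

lemma gr_supercommutative: "supercommutative_algebra (GY M N) (gr_yangian_parity M N)"
proof -
  let ?P = "gr_yangian_parity M N"
  have P: "?P 0 = gr_proj M N ` {f \<in> carrier (FA M N). homog M 0 f}"
    "?P 1 = gr_proj M N ` {f \<in> carrier (FA M N). homog M 1 f}"
    by (simp_all add: gr_parity_eq)
  have sub: "submodule (?P e) complex_ring (GY M N)" if e: "e < 2" for e
  proof (rule GY.mod.submoduleI)
    show "?P e \<subseteq> carrier (GY M N)"
      unfolding gr_parity_eq[OF e] gr_carrier by blast
    show "\<zero>\<^bsub>GY M N\<^esub> \<in> ?P e"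
      unfolding gr_parity_eq[OF e] gr_zero by (intro imageI) (simp add: FA_zero_closed homog_closed)
  next
    fix a assume "a \<in> ?P e"
    then obtain f where f: "f \<in> carrier (FA M N)" "homog M e f" "a = gr_proj M N f"
      unfolding gr_parity_eq[OF e] by blast
    have a: "a \<in> carrier (GY M N)" using f gr_carrier by blast
    show s: "c \<odot>\<^bsub>GY M N\<^esub> a \<in> ?P e" for c
      unfolding gr_parity_eq[OF e] f(3) gr_smult[OF f(1)] using f by (intro imageI) (simp add: FA_smult_closed homog_closed)
    show "\<ominus>\<^bsub>GY M N\<^esub> a \<in> ?P e"
      using s[of "-1"] GY.smult_minus_one[OF a] by simp
    fix b assume "b \<in> ?P e"
    then obtain g where g: "g \<in> carrier (FA M N)" "homog M e g" "b = gr_proj M N g"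
      unfolding gr_parity_eq[OF e] by blast
    show "a \<oplus>\<^bsub>GY M N\<^esub> b \<in> ?P e"
      unfolding gr_parity_eq[OF e] f(3) g(3) gr_add[OF f(1) g(1)] using f g
      by (intro imageI) (simp add: FA_add_closed homog_closed)
  qed
  have decomp: "\<exists>!(y, z). y \<in> ?P 0 \<and> z \<in> ?P 1 \<and> x = y \<oplus>\<^bsub>GY M N\<^esub> z" if x: "x \<in> carrier (GY M N)" for x
  proof -
    obtain f where f: "f \<in> carrier (FA M N)" "x = gr_proj M N f" using x gr_carrier by blast
    have ex: "gr_proj M N (par_part M 0 f) \<in> ?P 0 \<and> gr_proj M N (par_part M 1 f) \<in> ?P 1 \<and>
      x = gr_proj M N (par_part M 0 f) \<oplus>\<^bsub>GY M N\<^esub> gr_proj M N (par_part M 1 f)"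
      unfolding P using f par_part_decomp[of f]
      by (intro conjI imageI) (simp_all add: gr_add FA_filter_closed homog_closed del: One_nat_def)
    have uniq: "y = y' \<and> z = z'"
      if yz: "y \<in> ?P 0" "z \<in> ?P 1" "y' \<in> ?P 0" "z' \<in> ?P 1" and eq: "y \<oplus>\<^bsub>GY M N\<^esub> z = y' \<oplus>\<^bsub>GY M N\<^esub> z'" for y z y' z'
    proof -
      obtain h k where h: "h \<in> carrier (FA M N)" "homog M 0 h" "y = gr_proj M N h"
        and k: "k \<in> carrier (FA M N)" "homog M 1 k" "z = gr_proj M N k"
        using yz(1,2) unfolding P by blast
      obtain h' k' where h': "h' \<in> carrier (FA M N)" "homog M 0 h'" "y' = gr_proj M N h'"
        and k': "k' \<in> carrier (FA M N)" "homog M 1 k'" "z' = gr_proj M N k'"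
        using yz(3,4) unfolding P by blast
      have "gr_proj M N (h + k) = gr_proj M N (h' + k')"
        using eq h k h' k' by (simp add: gr_add)
      then have "gr_proj M N ((h - h') + (k - k')) = gr_proj M N 0"
        using h k h' k' by (simp add: gr_proj_eq_iff FA_add_closed FA_diff_closed FA_zero_closed algebra_simps)
      then have "gr_proj M N (h - h') = gr_proj M N 0"
        using gr_parity_unique[of "h - h'" "k - k'"] h h' k k' by (simp add: homog_closed FA_diff_closed)
      then have "y = y'"
        using h h' by (simp add: gr_proj_eq_iff FA_diff_closed FA_zero_closed)
      moreover have "y \<in> carrier (GY M N)" "z \<in> carrier (GY M N)" "z' \<in> carrier (GY M N)"
        using h k k' gr_carrier by blast+
      ultimately show ?thesis using eq by simp
    qed
    show ?thesis
    proof (rule ex1I[of _ "(gr_proj M N (par_part M 0 f), gr_proj M N (par_part M 1 f))"])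
      show "case (gr_proj M N (par_part M 0 f), gr_proj M N (par_part M 1 f)) of
        (y, z) \<Rightarrow> y \<in> ?P 0 \<and> z \<in> ?P 1 \<and> x = y \<oplus>\<^bsub>GY M N\<^esub> z"
        using ex by simp
    next
      fix q assume q: "case q of (y, z) \<Rightarrow> y \<in> ?P 0 \<and> z \<in> ?P 1 \<and> x = y \<oplus>\<^bsub>GY M N\<^esub> z"
      obtain y z where "q = (y, z)" by (cases q)
      then show "q = (gr_proj M N (par_part M 0 f), gr_proj M N (par_part M 1 f))"
        using q ex uniq[of y z "gr_proj M N (par_part M 0 f)" "gr_proj M N (par_part M 1 f)"] by simp
    qed
  qed
  have mult: "x \<otimes>\<^bsub>GY M N\<^esub> y \<in> ?P ((e + e') mod 2) \<and> x \<otimes>\<^bsub>GY M N\<^esub> y = ((-1) ^ (e * e')) \<odot>\<^bsub>GY M N\<^esub> (y \<otimes>\<^bsub>GY M N\<^esub> x)"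
    if e: "e < 2" "e' < 2" and x: "x \<in> ?P e" "y \<in> ?P e'" for e e' x y
  proof -
    obtain f where f: "f \<in> carrier (FA M N)" "homog M e f" "x = gr_proj M N f"
      using x(1) unfolding gr_parity_eq[OF e(1)] by blast
    obtain g where g: "g \<in> carrier (FA M N)" "homog M e' g" "y = gr_proj M N g"
      using x(2) unfolding gr_parity_eq[OF e(2)] by blast
    have lt: "(e + e') mod 2 < 2" by simp
    have "x \<otimes>\<^bsub>GY M N\<^esub> y \<in> ?P ((e + e') mod 2)"
      unfolding gr_parity_eq[OF lt] f(3) g(3) gr_mult[OF f(1) g(1)]
      by (intro imageI) (simp add: FA_mult_closed f g homog_mult)
    then show ?thesis using gr_supercomm[OF f(1,2) g(1,2)] f(3) g(3) by simp
  qed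
  show ?thesis
    unfolding supercommutative_algebra_def using gr_alg(1) sub decomp mult by blast
qed

end

section \<open>The representation of the Yangian\<close>

text \<open>The ring of operators as a record, so that the universal property of the free algebra
  yields a representation.\<close>

definition endo_algebra :: "(complex, 'x endo) module" where
  "endo_algebra = \<lparr>carrier = UNIV, mult = (*), one = 1, zero = 0, add = (+), smult = (\<lambda>c F. scalar_endo c * F)\<rparr>"

lemma endo_algebra_simps [simp]:
  "carrier endo_algebra = UNIV" "mult endo_algebra = (*)" "one endo_algebra = 1" "zero endo_algebra = 0"
  "add endo_algebra = (+)" "smult endo_algebra = (\<lambda>c F. scalar_endo c * F)"
  by (simp_all add: endo_algebra_def)

lemma endo_algebra_alg: "assoc_algebra (endo_algebra :: (complex, 'x endo) module)"
proof -
  have ab: "abelian_group (endo_algebra :: (complex, 'x endo) module)"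
  proof (rule abelian_groupI)
    fix F :: "'x endo"
    show "\<exists>G\<in>carrier endo_algebra. G \<oplus>\<^bsub>endo_algebra\<^esub> F = \<zero>\<^bsub>endo_algebra\<^esub>"
      by (rule bexI[of _ "- F"]) simp_all
  qed (simp_all add: ac_simps)
  have mon: "Group.monoid (endo_algebra :: (complex, 'x endo) module)"
    by (rule monoidI) (simp_all add: mult.assoc)
  have "ring (endo_algebra :: (complex, 'x endo) module)"
    by (rule ringI[OF ab mon]) (simp_all add: distrib_left distrib_right)
  moreover have "module complex_ring (endo_algebra :: (complex, 'x endo) module)"
    by (rule moduleI[OF cring_complex_ring ab])
      (simp_all add: scalar_endo_simps(1-4) distrib_left distrib_right mult.assoc)
  moreover have "F * (scalar_endo c * G) = scalar_endo c * (F * G)" for F G :: "'x endo" and c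
    using scalar_endo_simps(5)[of c F] by (metis mult.assoc)
  ultimately show ?thesis
    by (simp add: assoc_algebra_def mult.assoc)
qed

lemma endo_uminus: "\<ominus>\<^bsub>endo_algebra\<^esub> F = - F"
proof -
  interpret E: complex_algebra "endo_algebra :: (complex, 'a endo) module"
    by unfold_locales (rule endo_algebra_alg)
  show ?thesis by (rule E.minus_equality) simp_all
qed

lemma endo_finsum: "finite X \<Longrightarrow> (\<Oplus>\<^bsub>endo_algebra\<^esub>x\<in>X. F x) = sum F X"
proof (induction X rule: finite_induct)
  case empty
  interpret E: complex_algebra "endo_algebra :: (complex, 'b endo) module"
    by unfold_locales (rule endo_algebra_alg)
  show ?case by simp
next
  case (insert x X)
  interpret E: complex_algebra "endo_algebra :: (complex, 'b endo) module"
    by unfold_locales (rule endo_algebra_alg)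
  show ?case using insert by (subst E.finsum_insert) simp_all
qed

lemma ipar_cases: "ipar M i = 0 \<or> ipar M i = 1"
  by (simp add: ipar_def)

lemma gen_odd_ipar: "gen_odd (ipar M) g \<longleftrightarrow> gen_parity M g = 1"
  by (cases g) (simp only: gen_odd_def gen_parity_def odd_iff_mod_2_eq_one prod.case)

lemma gens_over_ygens: "gens_over {1..M + N} = ygens M N"
  by (auto simp: gens_over_def ygens_def)

context
  fixes M N m :: nat
begin

definition yangian_rep :: "(ygen list \<Rightarrow>\<^sub>0 complex) \<Rightarrow> state endo" where
  "yangian_rep = ma_lift endo_algebra (word_op (multi_site (ipar M) {1..M + N} m))"

lemma yangian_rep_hom:
  "yangian_rep \<in> alg_hom (FA M N) endo_algebra"
  "w \<in> lists (ygens M N) \<Longrightarrow> yangian_rep (Poly_Mapping.single w c) =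
    scalar_endo c * word_op (multi_site (ipar M) {1..M + N} m) w"
proof -
  let ?W = "word_op (multi_site (ipar M) {1..M + N} m)"
  note L = ma_lift_alg_hom[OF monoid_free[of "ygens M N"] endo_algebra_alg, of ?W]
  show "yangian_rep \<in> alg_hom (FA M N) endo_algebra"
    unfolding yangian_rep_def free_algebra_def by (rule L(1)) (simp_all add: word_op_simps)
  show "yangian_rep (Poly_Mapping.single w c) = scalar_endo c * ?W w" if "w \<in> lists (ygens M N)"
    unfolding yangian_rep_def using that by (subst L(2)) (simp_all add: word_op_simps)
qed

lemma yangian_rep_app:
  "app (yangian_rep f) v x = (\<Sum>w\<in>Poly_Mapping.keys f. Poly_Mapping.lookup f w *
    app (word_op (multi_site (ipar M) {1..M + N} m) w) v x)"
  by (simp add: yangian_rep_def ma_lift_def endo_finsum app_sum app_mult app_scalar)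

lemma yangian_rep_T_coeff:
  assumes "i \<in> {1..M + N}" "j \<in> {1..M + N}"
  shows "yangian_rep (T_coeff i j r) = (if r < 0 then 0 else multi_site (ipar M) {1..M + N} m i j (nat r))"
proof -
  have Y: "yangian_family (ipar M) {1..M + N} (multi_site (ipar M) {1..M + N} m)"
    by (rule yangian_family_multi_site[OF ipar_cases]) simp
  have z: "yangian_rep 0 = 0"
    using alg_hom_zero_minus(1)[OF free_algebra_alg endo_algebra_alg yangian_rep_hom(1)] by (simp add: free_algebra_simps)
  consider "r < 0" | "r = 0" | "r > 0" by linarith
  then show ?thesis
  proof cases
    case 2
    then show ?thesis
      using Y assms z yangian_rep_hom(2)[of "[]" 1]
      by (auto simp: T_coeff_def yangian_family_def word_op_simps scalar_endo_simps)
  next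
    case 3
    then have "(i, j, nat r) \<in> ygens M N" using assms by (auto simp: ygens_def)
    then show ?thesis
      using 3 yangian_rep_hom(2)[of "[(i, j, nat r)]" 1] by (simp add: T_coeff_def free_gen_def word_op_simps scalar_endo_simps)
  qed (simp add: T_coeff_def z)
qed

lemma yangian_rep_rel:
  assumes "i \<in> {1..M + N}" "j \<in> {1..M + N}" "k \<in> {1..M + N}" "l \<in> {1..M + N}"
  shows "yangian_rep (yangian_rel M N i j k l r s) = 0"
proof -
  let ?T = "multi_site (ipar M) {1..M + N} m"
  note D = alg_homD[OF yangian_rep_hom(1)]
  have Y: "yangian_family (ipar M) {1..M + N} ?T"
    by (rule yangian_family_multi_site[OF ipar_cases]) simp
  have T0: "?T i j 0 = (if i = j then 1 else 0)" if "i \<in> {1..M + N}" "j \<in> {1..M + N}" for i j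
    using Y that unfolding yangian_family_def by blast
  have diff: "yangian_rep (f - g) = yangian_rep f - yangian_rep g" if "f \<in> carrier (FA M N)" "g \<in> carrier (FA M N)" for f g
    using alg_hom_zero_minus(3)[OF free_algebra_alg endo_algebra_alg yangian_rep_hom(1) that] free_algebra_minus[OF that]
    by (simp add: a_minus_def endo_uminus)
  have prod: "yangian_rep (T_coeff i j r \<otimes>\<^bsub>FA M N\<^esub> T_coeff k l s) =
      (if r < 0 \<or> s < 0 then 0 else ?T i j (nat r) * ?T k l (nat s))"
    if "i \<in> {1..M + N}" "j \<in> {1..M + N}" "k \<in> {1..M + N}" "l \<in> {1..M + N}" for i j k l r s
    using that by (simp add: D(2) T_coeff_carrier yangian_rep_T_coeff)
  have sc: "scalar_endo ((-1) ^ n) = (-1) ^ n" for n :: nat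
    by (rule endo_eqI) (simp add: app_scalar app_sign)
  have smult: "yangian_rep (c \<odot>\<^bsub>FA M N\<^esub> f) = scalar_endo c * yangian_rep f" if "f \<in> carrier (FA M N)" for c f
    using D(5)[OF that] by simp
  interpret F: complex_algebra "FA M N" by unfold_locales (rule free_algebra_alg)
  have cl: "T_coeff i j r \<otimes>\<^bsub>FA M N\<^esub> T_coeff k l s \<in> carrier (FA M N)"
    if "i \<in> {1..M + N}" "j \<in> {1..M + N}" "k \<in> {1..M + N}" "l \<in> {1..M + N}" for i j k l r s
    using that by (intro FA_mult_closed T_coeff_carrier)
  have comm: "yangian_rep (T_supercomm M N i j k l r s) =
      (if r < 0 \<or> s < 0 then 0 else comm_coeff (ipar M) ?T i j k l (nat r) (nat s))" for r s
  proof -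
    have "yangian_rep (T_supercomm M N i j k l r s) =
      yangian_rep (T_coeff i j r \<otimes>\<^bsub>FA M N\<^esub> T_coeff k l s) -
      scalar_endo ((-1) ^ ((ipar M i + ipar M j) * (ipar M k + ipar M l))) * yangian_rep (T_coeff k l s \<otimes>\<^bsub>FA M N\<^esub> T_coeff i j r)"
      unfolding T_supercomm_def Let_def using assms by (simp add: diff smult cl)
    then show ?thesis
      using assms by (simp add: prod comm_coeff_def sc)
  qed
  have rel: "yangian_rep (yangian_rel M N i j k l r s) =
      (-1) ^ (ipar M i * ipar M k + ipar M i * ipar M l + ipar M k * ipar M l) *
        (yangian_rep (T_supercomm M N i j k l (r + 1) s) - yangian_rep (T_supercomm M N i j k l r (s + 1))) -
      ((if r < 0 \<or> s < 0 then 0 else ?T k j (nat r) * ?T i l (nat s)) -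
       (if r < 0 \<or> s < 0 then 0 else ?T k j (nat s) * ?T i l (nat r)))"
  proof -
    have "yangian_rep (yangian_rel M N i j k l r s) =
      scalar_endo ((-1) ^ (ipar M i * ipar M k + ipar M i * ipar M l + ipar M k * ipar M l)) *
        (yangian_rep (T_supercomm M N i j k l (r + 1) s) - yangian_rep (T_supercomm M N i j k l r (s + 1))) -
      (yangian_rep (T_coeff k j r \<otimes>\<^bsub>FA M N\<^esub> T_coeff i l s) - yangian_rep (T_coeff k j s \<otimes>\<^bsub>FA M N\<^esub> T_coeff i l r))"
      unfolding yangian_rel_def Let_def using assms
      by (simp add: diff smult cl T_supercomm_carrier FA_diff_closed)
    then show ?thesis using assms by (auto simp: prod sc)
  qed
  note c0 = comm_coeff_0[of "{1..M + N}" ?T, OF T0 assms, of "ipar M"]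
  show ?thesis
  proof (cases "r < 0 \<or> s < 0")
    \<comment> \<open>The right side of the relation has no such coefficients. On the left only
      \<open>r = -1\<close> or \<open>s = -1\<close> can contribute, through a supercommutator with
      a coefficient of index 0, and this is zero.\<close>
    case True
    then show ?thesis
      unfolding rel comm using c0 by (cases "r = -1"; cases "s = -1") auto
  next
    case False
    then have n: "nat (r + 1) = Suc (nat r)" "nat (s + 1) = Suc (nat s)" by auto
    have "(-1) ^ (ipar M i * ipar M k + ipar M i * ipar M l + ipar M k * ipar M l) *
          (comm_coeff (ipar M) ?T i j k l (Suc (nat r)) (nat s) - comm_coeff (ipar M) ?T i j k l (nat r) (Suc (nat s))) =
        ?T k j (nat r) * ?T i l (nat s) - ?T k j (nat s) * ?T i l (nat r)"
      using Y assms unfolding yangian_family_def by blast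
    then show ?thesis
      unfolding rel comm using False by (simp add: n)
  qed
qed

lemma yangian_rep_ideal:
  assumes "f \<in> YI M N"
  shows "yangian_rep f = 0"
proof -
  have "yangian_rep f = \<zero>\<^bsub>endo_algebra\<^esub>"
  proof (rule alg_hom_vanish_genideal[OF free_algebra_alg endo_algebra_alg yangian_rep_hom(1) yangian_gens_carrier])
    fix g assume "g \<in> {yangian_rel M N i j k l r s | i j k l r s.
        i \<in> {1..M + N} \<and> j \<in> {1..M + N} \<and> k \<in> {1..M + N} \<and> l \<in> {1..M + N}}"
    then obtain i j k l r s where g: "g = yangian_rel M N i j k l r s"
      "i \<in> {1..M + N}" "j \<in> {1..M + N}" "k \<in> {1..M + N}" "l \<in> {1..M + N}" by blast
    show "yangian_rep g = \<zero>\<^bsub>endo_algebra\<^esub>"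
      unfolding g(1) using yangian_rep_rel[OF g(2-5)] by simp
  next
    show "f \<in> Idl\<^bsub>FA M N\<^esub> {yangian_rel M N i j k l r s | i j k l r s.
        i \<in> {1..M + N} \<and> j \<in> {1..M + N} \<and> k \<in> {1..M + N} \<and> l \<in> {1..M + N}}"
      using assms unfolding yangian_ideal_def .
  qed
  then show ?thesis by simp
qed

end

text \<open>An element of the ideal acts as zero on any number of sites, whereas a nonzero normal
  combination acts nontrivially on the vacuum for some number of sites.\<close>

lemma normal_ideal_zero:
  assumes "f \<in> YI M N" "\<And>w. w \<in> Poly_Mapping.keys f \<Longrightarrow> normal_word (ipar M) w"
  shows "f = 0"
proof (rule ccontr)
  assume "f \<noteq> 0"
  have "Poly_Mapping.keys f \<subseteq> lists (ygens M N)"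
    using ideal.Icarr[OF yangian_ideal assms(1)] by (simp add: free_algebra_simps)
  then have "normal_word (ipar M) w \<and> set w \<subseteq> gens_over {1..M + N}" if "w \<in> Poly_Mapping.keys f" for w
    using assms(2) that unfolding gens_over_ygens by auto
  from normal_words_independent[OF finite_atLeastAtMost \<open>f \<noteq> 0\<close> this] obtain m x where
    "(\<Sum>w\<in>Poly_Mapping.keys f. Poly_Mapping.lookup f w *
      app (word_op (multi_site (ipar M) {1..M + N} m) w) vacuum x) \<noteq> 0" by blast
  then show False
    using yangian_rep_ideal[OF assms(1), of m] yangian_rep_app[of M N m f vacuum x] by (simp add: app_0)
qed

section \<open>Tensor products and exterior algebras\<close>

context
  fixes A :: "(complex, 'a) module" and B :: "(complex, 'b) module"
  assumes A: "assoc_algebra A" and B: "assoc_algebra B"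
begin

interpretation A: complex_algebra A by unfold_locales (rule A)
interpretation B: complex_algebra B by unfold_locales (rule B)

abbreviation "TM \<equiv> monoid_algebra (A \<times>\<times> B)"

lemma prod_monoid: "Group.monoid (A \<times>\<times> B)"
  by (rule DirProd_monoid[OF A.monoid_axioms B.monoid_axioms])

lemma prod_monoid_simps:
  "carrier (A \<times>\<times> B) = carrier A \<times> carrier B" "\<one>\<^bsub>A \<times>\<times> B\<^esub> = (\<one>\<^bsub>A\<^esub>, \<one>\<^bsub>B\<^esub>)"
  "(a, b) \<otimes>\<^bsub>A \<times>\<times> B\<^esub> (a', b') = (a \<otimes>\<^bsub>A\<^esub> a', b \<otimes>\<^bsub>B\<^esub> b')"
  by (simp_all add: DirProd_def)

lemma TM_alg: "assoc_algebra TM"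
  by (rule assoc_algebra_monoid_algebra[OF prod_monoid])

interpretation TM: complex_algebra TM by unfold_locales (rule TM_alg)

lemma TM_diff: "f \<in> carrier TM \<Longrightarrow> g \<in> carrier TM \<Longrightarrow> f - g \<in> carrier TM"
  using Poly_Mapping.keys_diff[of f g] by (auto simp: monoid_algebra_simps)

lemma TM_single: "a \<in> carrier A \<Longrightarrow> b \<in> carrier B \<Longrightarrow> Poly_Mapping.single (a, b) c \<in> carrier TM"
  by (simp add: monoid_algebra_simps prod_monoid_simps)

lemma bilinear_rels_carrier: "bilinear_rels A B \<subseteq> carrier TM"
  unfolding bilinear_rels_def by (auto intro!: TM_diff TM_single)

lemma tensor_ideal: "ideal (tensor_ideal A B) TM"
  unfolding tensor_ideal_def by (rule TM.genideal_ideal[OF bilinear_rels_carrier])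

lemma bilinear_rels_ideal: "r \<in> bilinear_rels A B \<Longrightarrow> r \<in> tensor_ideal A B"
  unfolding tensor_ideal_def using TM.genideal_self[OF bilinear_rels_carrier] by blast

lemma tensor_alg: "assoc_algebra (tensor_algebra A B)"
  unfolding tensor_algebra_def by (rule quot_algebra_proj(1)[OF TM_alg tensor_ideal])

definition tproj :: "('a \<times> 'b \<Rightarrow>\<^sub>0 complex) \<Rightarrow> ('a \<times> 'b \<Rightarrow>\<^sub>0 complex) set" where
  "tproj f = tensor_ideal A B +>\<^bsub>TM\<^esub> f"

lemma tproj_hom: "tproj \<in> alg_hom TM (tensor_algebra A B)"
  using quot_algebra_proj(2)[OF TM_alg tensor_ideal] unfolding tensor_algebra_def tproj_def[abs_def] .

lemma tproj_onto: "carrier (tensor_algebra A B) = tproj ` carrier TM"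
  using quot_algebra_proj(3)[OF TM_alg tensor_ideal] unfolding tensor_algebra_def tproj_def[abs_def] .

interpretation T: complex_algebra "tensor_algebra A B" by unfold_locales (rule tensor_alg)

lemma TM_minus: "f \<in> carrier TM \<Longrightarrow> g \<in> carrier TM \<Longrightarrow> f \<ominus>\<^bsub>TM\<^esub> g = f - g"
proof -
  assume fg: "f \<in> carrier TM" "g \<in> carrier TM"
  have m: "- g \<in> carrier TM" using fg by (simp add: monoid_algebra_simps)
  have "- g \<oplus>\<^bsub>TM\<^esub> g = \<zero>\<^bsub>TM\<^esub>" by (simp add: monoid_algebra_simps)
  then have "\<ominus>\<^bsub>TM\<^esub> g = - g" using TM.minus_equality fg m by blast
  then show ?thesis by (simp add: a_minus_def monoid_algebra_simps)
qed

lemma tproj_eqI: "f \<in> carrier TM \<Longrightarrow> g \<in> carrier TM \<Longrightarrow> f - g \<in> tensor_ideal A B \<Longrightarrow> tproj f = tproj g"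
  unfolding tproj_def using rcos_eq_iff[OF TM_alg tensor_ideal] TM_minus by simp

lemma pure_tensor_eq: "pure_tensor A B a b = tproj (Poly_Mapping.single (a, b) 1)"
  by (simp add: pure_tensor_def tproj_def)

lemma pure_closed: "a \<in> carrier A \<Longrightarrow> b \<in> carrier B \<Longrightarrow> pure_tensor A B a b \<in> carrier (tensor_algebra A B)"
  unfolding pure_tensor_eq tproj_onto using TM_single by blast

lemma pure_mult:
  assumes "a \<in> carrier A" "b \<in> carrier B" "a' \<in> carrier A" "b' \<in> carrier B"
  shows "pure_tensor A B a b \<otimes>\<^bsub>tensor_algebra A B\<^esub> pure_tensor A B a' b' = pure_tensor A B (a \<otimes>\<^bsub>A\<^esub> a') (b \<otimes>\<^bsub>B\<^esub> b')"
  unfolding pure_tensor_eq using assms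
  by (simp add: alg_homD(2)[OF tproj_hom, symmetric] TM_single monoid_algebra_mult_single prod_monoid_simps)

lemma pure_one: "pure_tensor A B \<one>\<^bsub>A\<^esub> \<one>\<^bsub>B\<^esub> = \<one>\<^bsub>tensor_algebra A B\<^esub>"
  unfolding pure_tensor_eq alg_homD(4)[OF tproj_hom, symmetric] by (simp add: monoid_algebra_simps prod_monoid_simps)

lemma TM_plus: "f \<in> carrier TM \<Longrightarrow> g \<in> carrier TM \<Longrightarrow> f + g \<in> carrier TM"
  using Poly_Mapping.keys_add[of f g] by (auto simp: monoid_algebra_simps)

lemma tproj_plus: "f \<in> carrier TM \<Longrightarrow> g \<in> carrier TM \<Longrightarrow> tproj (f + g) = tproj f \<oplus>\<^bsub>tensor_algebra A B\<^esub> tproj g"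
  using alg_homD(3)[OF tproj_hom, of f g] by (simp add: monoid_algebra_simps)

lemma tproj_single: "a \<in> carrier A \<Longrightarrow> b \<in> carrier B \<Longrightarrow>
    tproj (Poly_Mapping.single (a, b) c) = c \<odot>\<^bsub>tensor_algebra A B\<^esub> pure_tensor A B a b"
  using alg_homD(5)[OF tproj_hom TM_single, of a b c 1] by (simp add: monoid_algebra_simps scale_single pure_tensor_eq)

lemma pure_add_left:
  assumes "a \<in> carrier A" "a' \<in> carrier A" "b \<in> carrier B"
  shows "pure_tensor A B (a \<oplus>\<^bsub>A\<^esub> a') b = pure_tensor A B a b \<oplus>\<^bsub>tensor_algebra A B\<^esub> pure_tensor A B a' b"
proof -
  let ?s = "\<lambda>a. Poly_Mapping.single (a, b) (1 :: complex)"
  have "?s (a \<oplus>\<^bsub>A\<^esub> a') - ?s a - ?s a' \<in> bilinear_rels A B"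
    unfolding bilinear_rels_def using assms by blast
  then have "?s (a \<oplus>\<^bsub>A\<^esub> a') - (?s a + ?s a') \<in> tensor_ideal A B"
    using bilinear_rels_ideal by (simp add: diff_diff_eq)
  then have "tproj (?s (a \<oplus>\<^bsub>A\<^esub> a')) = tproj (?s a + ?s a')"
    using assms by (intro tproj_eqI TM_plus TM_single) auto
  then show ?thesis unfolding pure_tensor_eq using assms by (simp add: tproj_plus TM_single)
qed

lemma pure_add_right:
  assumes "a \<in> carrier A" "b \<in> carrier B" "b' \<in> carrier B"
  shows "pure_tensor A B a (b \<oplus>\<^bsub>B\<^esub> b') = pure_tensor A B a b \<oplus>\<^bsub>tensor_algebra A B\<^esub> pure_tensor A B a b'"
proof -
  let ?s = "\<lambda>b. Poly_Mapping.single (a, b) (1 :: complex)"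
  have "?s (b \<oplus>\<^bsub>B\<^esub> b') - ?s b - ?s b' \<in> bilinear_rels A B"
    unfolding bilinear_rels_def using assms by blast
  then have "?s (b \<oplus>\<^bsub>B\<^esub> b') - (?s b + ?s b') \<in> tensor_ideal A B"
    using bilinear_rels_ideal by (simp add: diff_diff_eq)
  then have "tproj (?s (b \<oplus>\<^bsub>B\<^esub> b')) = tproj (?s b + ?s b')"
    using assms by (intro tproj_eqI TM_plus TM_single) auto
  then show ?thesis unfolding pure_tensor_eq using assms by (simp add: tproj_plus TM_single)
qed

lemma pure_smult_left:
  assumes "a \<in> carrier A" "b \<in> carrier B"
  shows "pure_tensor A B (c \<odot>\<^bsub>A\<^esub> a) b = c \<odot>\<^bsub>tensor_algebra A B\<^esub> pure_tensor A B a b"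
proof -
  have "Poly_Mapping.single (c \<odot>\<^bsub>A\<^esub> a, b) 1 - Poly_Mapping.single (a, b) c \<in> bilinear_rels A B"
    unfolding bilinear_rels_def using assms by blast
  then have "tproj (Poly_Mapping.single (c \<odot>\<^bsub>A\<^esub> a, b) 1) = tproj (Poly_Mapping.single (a, b) c)"
    using assms bilinear_rels_ideal by (intro tproj_eqI TM_single) auto
  then show ?thesis unfolding tproj_single[OF assms] by (simp add: pure_tensor_eq)
qed

lemma pure_smult_right:
  assumes "a \<in> carrier A" "b \<in> carrier B"
  shows "pure_tensor A B a (c \<odot>\<^bsub>B\<^esub> b) = c \<odot>\<^bsub>tensor_algebra A B\<^esub> pure_tensor A B a b"
proof -
  have "Poly_Mapping.single (a, c \<odot>\<^bsub>B\<^esub> b) 1 - Poly_Mapping.single (a, b) c \<in> bilinear_rels A B"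
    unfolding bilinear_rels_def using assms by blast
  then have "tproj (Poly_Mapping.single (a, c \<odot>\<^bsub>B\<^esub> b) 1) = tproj (Poly_Mapping.single (a, b) c)"
    using assms bilinear_rels_ideal by (intro tproj_eqI TM_single) auto
  then show ?thesis unfolding tproj_single[OF assms] by (simp add: pure_tensor_eq)
qed

lemma tensor_span:
  assumes "\<zero>\<^bsub>tensor_algebra A B\<^esub> \<in> S"
    and "\<And>x y. x \<in> S \<Longrightarrow> y \<in> S \<Longrightarrow> x \<oplus>\<^bsub>tensor_algebra A B\<^esub> y \<in> S"
    and "\<And>x c. x \<in> S \<Longrightarrow> c \<odot>\<^bsub>tensor_algebra A B\<^esub> x \<in> S"
    and "\<And>a b. a \<in> carrier A \<Longrightarrow> b \<in> carrier B \<Longrightarrow> pure_tensor A B a b \<in> S"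
  shows "carrier (tensor_algebra A B) \<subseteq> S"
proof
  fix x assume "x \<in> carrier (tensor_algebra A B)"
  then obtain f where f: "f \<in> carrier TM" "x = tproj f" unfolding tproj_onto by blast
  have "Poly_Mapping.keys f \<subseteq> carrier A \<times> carrier B"
    using f(1) by (simp add: monoid_algebra_simps prod_monoid_simps)
  then have "tproj f \<in> S"
  proof (induction rule: poly_mapping_keys_induct)
    case zero
    show ?case using assms(1) alg_hom_zero_minus(1)[OF TM_alg tensor_alg tproj_hom] by (simp add: monoid_algebra_simps)
  next
    case (single x c)
    then show ?case using assms(3,4) by (cases x) (simp add: tproj_single)
  next
    case (add f g)
    then have "f \<in> carrier TM" "g \<in> carrier TM" by (simp_all add: monoid_algebra_simps prod_monoid_simps)
    then show ?case using add assms(2) by (simp add: tproj_plus)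
  qed
  then show "x \<in> S" using f by simp
qed

text \<open>The images have to commute without sign, as the two factors of
  \<open>tensor_algebra\<close> do. In the application the first factor is purely even.\<close>

lemma tensor_lift:
  assumes C: "assoc_algebra C" and h: "h \<in> alg_hom A C" and k: "k \<in> alg_hom B C"
    and comm: "\<And>a b. a \<in> carrier A \<Longrightarrow> b \<in> carrier B \<Longrightarrow> h a \<otimes>\<^bsub>C\<^esub> k b = k b \<otimes>\<^bsub>C\<^esub> h a"
  obtains t where "t \<in> alg_hom (tensor_algebra A B) C"
    "\<And>a b. a \<in> carrier A \<Longrightarrow> b \<in> carrier B \<Longrightarrow> t (pure_tensor A B a b) = h a \<otimes>\<^bsub>C\<^esub> k b"
proof -
  interpret C: complex_algebra C by unfold_locales (rule C)
  define \<phi> where "\<phi> = (\<lambda>(a, b). h a \<otimes>\<^bsub>C\<^esub> k b)"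
  note hD = alg_homD[OF h] and kD = alg_homD[OF k]
  have mult: "\<phi> (x \<otimes>\<^bsub>A \<times>\<times> B\<^esub> y) = \<phi> x \<otimes>\<^bsub>C\<^esub> \<phi> y" if "x \<in> carrier (A \<times>\<times> B)" "y \<in> carrier (A \<times>\<times> B)" for x y
  proof -
    obtain a b a' b' where xy: "x = (a, b)" "y = (a', b')" by (cases x, cases y)
    have c: "a \<in> carrier A" "b \<in> carrier B" "a' \<in> carrier A" "b' \<in> carrier B"
      using that by (auto simp: xy prod_monoid_simps)
    have "h a \<otimes>\<^bsub>C\<^esub> h a' \<otimes>\<^bsub>C\<^esub> (k b \<otimes>\<^bsub>C\<^esub> k b') = h a \<otimes>\<^bsub>C\<^esub> (h a' \<otimes>\<^bsub>C\<^esub> k b) \<otimes>\<^bsub>C\<^esub> k b'"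
      using c by (simp add: hD kD C.m_assoc)
    also have "\<dots> = h a \<otimes>\<^bsub>C\<^esub> (k b \<otimes>\<^bsub>C\<^esub> h a') \<otimes>\<^bsub>C\<^esub> k b'" using c comm by simp
    also have "\<dots> = h a \<otimes>\<^bsub>C\<^esub> k b \<otimes>\<^bsub>C\<^esub> (h a' \<otimes>\<^bsub>C\<^esub> k b')" using c by (simp add: hD kD C.m_assoc)
    finally show ?thesis using c by (simp add: xy \<phi>_def prod_monoid_simps hD kD)
  qed
  have \<phi>c: "\<phi> x \<in> carrier C" if "x \<in> carrier (A \<times>\<times> B)" for x
    using that by (auto simp: \<phi>_def prod_monoid_simps hD kD)
  have \<phi>1: "\<phi> \<one>\<^bsub>A \<times>\<times> B\<^esub> = \<one>\<^bsub>C\<^esub>" by (simp add: \<phi>_def prod_monoid_simps hD kD)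
  define L where "L = ma_lift C \<phi>"
  have L: "L \<in> alg_hom TM C" unfolding L_def by (rule ma_lift_alg_hom(1)[OF prod_monoid C \<phi>c mult \<phi>1])
  have Ls: "L (Poly_Mapping.single (a, b) c) = c \<odot>\<^bsub>C\<^esub> (h a \<otimes>\<^bsub>C\<^esub> k b)" if "a \<in> carrier A" "b \<in> carrier B" for a b c
    unfolding L_def using ma_lift_alg_hom(2)[OF prod_monoid C \<phi>c mult \<phi>1, of "(a, b)" c] that
    by (simp add: prod_monoid_simps \<phi>_def)
  have Ld: "L (f - g) = L f \<ominus>\<^bsub>C\<^esub> L g" if "f \<in> carrier TM" "g \<in> carrier TM" for f g
    using alg_hom_zero_minus(3)[OF TM_alg C L that] TM_minus[OF that] by simp
  have rel: "L r = \<zero>\<^bsub>C\<^esub>" if "r \<in> bilinear_rels A B" for r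
  proof -
    have z: "(x \<oplus>\<^bsub>C\<^esub> y) \<ominus>\<^bsub>C\<^esub> x \<ominus>\<^bsub>C\<^esub> y = \<zero>\<^bsub>C\<^esub>" if "x \<in> carrier C" "y \<in> carrier C" for x y
      using that C.r_neg[of "x \<oplus>\<^bsub>C\<^esub> y"] by (simp add: a_minus_def C.minus_add C.a_assoc)
    have z': "x \<ominus>\<^bsub>C\<^esub> x = \<zero>\<^bsub>C\<^esub>" if "x \<in> carrier C" for x
      using that by (simp add: a_minus_def C.r_neg)
    from that show ?thesis
      unfolding bilinear_rels_def
    proof (elim UnE CollectE exE conjE)
      fix a a' b
      assume "r = Poly_Mapping.single (a \<oplus>\<^bsub>A\<^esub> a', b) 1 - Poly_Mapping.single (a, b) 1 - Poly_Mapping.single (a', b) 1"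
        "a \<in> carrier A" "a' \<in> carrier A" "b \<in> carrier B"
      then show "L r = \<zero>\<^bsub>C\<^esub>"
        by (simp add: Ld TM_single TM_diff Ls hD kD C.l_distr z)
    next
      fix a b b'
      assume "r = Poly_Mapping.single (a, b \<oplus>\<^bsub>B\<^esub> b') 1 - Poly_Mapping.single (a, b) 1 - Poly_Mapping.single (a, b') 1"
        "a \<in> carrier A" "b \<in> carrier B" "b' \<in> carrier B"
      then show "L r = \<zero>\<^bsub>C\<^esub>"
        by (simp add: Ld TM_single TM_diff Ls hD kD C.r_distr z)
    next
      fix a b c
      assume "r = Poly_Mapping.single (c \<odot>\<^bsub>A\<^esub> a, b) 1 - Poly_Mapping.single (a, b) c"
        "a \<in> carrier A" "b \<in> carrier B"
      then show "L r = \<zero>\<^bsub>C\<^esub>"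
        by (simp add: Ld TM_single Ls hD kD C.smult_mult_left z')
    next
      fix a b c
      assume "r = Poly_Mapping.single (a, c \<odot>\<^bsub>B\<^esub> b) 1 - Poly_Mapping.single (a, b) c"
        "a \<in> carrier A" "b \<in> carrier B"
      then show "L r = \<zero>\<^bsub>C\<^esub>"
        by (simp add: Ld TM_single Ls hD kD C.smult_mult_right z')
    qed
  qed
  have ker: "L x = \<zero>\<^bsub>C\<^esub>" if "x \<in> tensor_ideal A B" for x
    by (rule alg_hom_vanish_genideal[OF TM_alg C L bilinear_rels_carrier _ that[unfolded tensor_ideal_def]]) (rule rel)
  obtain t where t: "t \<in> alg_hom (quot_algebra TM (tensor_ideal A B)) C"
      "\<And>x. x \<in> carrier TM \<Longrightarrow> t (tensor_ideal A B +>\<^bsub>TM\<^esub> x) = L x"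
    using quot_algebra_lift[OF TM_alg tensor_ideal C L ker] by blast
  show thesis
  proof (rule that)
    show "t \<in> alg_hom (tensor_algebra A B) C" using t(1) by (simp add: tensor_algebra_def)
    show "t (pure_tensor A B a b) = h a \<otimes>\<^bsub>C\<^esub> k b" if "a \<in> carrier A" "b \<in> carrier B" for a b
      using t(2)[OF TM_single[OF that]] Ls[OF that] that by (simp add: pure_tensor_def hD kD)
  qed
qed

end

section \<open>Polynomial algebras and exterior algebras\<close>

lemma poly_monoid: "Group.monoid \<lparr>carrier = {m. set_mset m \<subseteq> G}, mult = (+), one = {#}\<rparr>"
  by (rule monoidI) (auto simp: ac_simps)

lemma poly_algebra_alg: "assoc_algebra (poly_algebra G)"
  unfolding poly_algebra_def by (rule assoc_algebra_monoid_algebra[OF poly_monoid])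

lemma poly_algebra_simps:
  "carrier (poly_algebra G) = {f. \<forall>m\<in>Poly_Mapping.keys f. set_mset m \<subseteq> G}"
  "zero (poly_algebra G) = 0" "add (poly_algebra G) = (+)"
  "one (poly_algebra G) = Poly_Mapping.single {#} 1"
  "smult (poly_algebra G) = (\<lambda>c. Poly_Mapping.map ((*) c))"
  "Poly_Mapping.single x a \<otimes>\<^bsub>poly_algebra G\<^esub> Poly_Mapping.single y b = Poly_Mapping.single (x + y) (a * b)"
  by (auto simp: poly_algebra_def monoid_algebra_simps monoid_algebra_mult_single)

lemma ext_gens_carrier:
  "{v \<otimes>\<^bsub>free_algebra G\<^esub> v | v. v \<in> carrier (free_algebra G) \<and> (\<forall>w\<in>Poly_Mapping.keys v. length w = 1)}
    \<subseteq> carrier (free_algebra G)"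
proof -
  interpret F: complex_algebra "free_algebra G" by unfold_locales (rule free_algebra_alg)
  show ?thesis by auto
qed

lemma ext_ideal: "ideal (ext_ideal G) (free_algebra G)"
proof -
  interpret F: complex_algebra "free_algebra G" by unfold_locales (rule free_algebra_alg)
  show ?thesis unfolding ext_ideal_def by (rule F.genideal_ideal[OF ext_gens_carrier])
qed

lemma ext_square_ideal:
  "v \<in> carrier (free_algebra G) \<Longrightarrow> (\<And>w. w \<in> Poly_Mapping.keys v \<Longrightarrow> length w = 1) \<Longrightarrow>
    v \<otimes>\<^bsub>free_algebra G\<^esub> v \<in> ext_ideal G"
proof -
  interpret F: complex_algebra "free_algebra G" by unfold_locales (rule free_algebra_alg)
  assume "v \<in> carrier (free_algebra G)" "\<And>w. w \<in> Poly_Mapping.keys v \<Longrightarrow> length w = 1"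
  then show ?thesis unfolding ext_ideal_def using F.genideal_self[OF ext_gens_carrier] by blast
qed

lemma ext_alg: "assoc_algebra (ext_algebra G)"
  unfolding ext_algebra_def by (rule quot_algebra_proj(1)[OF free_algebra_alg ext_ideal])

definition eproj :: "'g set \<Rightarrow> ('g list \<Rightarrow>\<^sub>0 complex) \<Rightarrow> ('g list \<Rightarrow>\<^sub>0 complex) set" where
  "eproj G f = ext_ideal G +>\<^bsub>free_algebra G\<^esub> f"

lemma eproj_hom: "eproj G \<in> alg_hom (free_algebra G) (ext_algebra G)"
  using quot_algebra_proj(2)[OF free_algebra_alg ext_ideal] unfolding ext_algebra_def eproj_def[abs_def] .

lemma eproj_onto: "carrier (ext_algebra G) = eproj G ` carrier (free_algebra G)"
  using quot_algebra_proj(3)[OF free_algebra_alg ext_ideal] unfolding ext_algebra_def eproj_def[abs_def] .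

definition eword :: "'g set \<Rightarrow> 'g list \<Rightarrow> ('g list \<Rightarrow>\<^sub>0 complex) set" where
  "eword G w = eproj G (Poly_Mapping.single w 1)"

lemma ext_gen_eq: "ext_gen G g = eword G [g]"
  by (simp add: ext_gen_def eword_def eproj_def free_gen_def)

lemma single_free: "w \<in> lists G \<Longrightarrow> Poly_Mapping.single w c \<in> carrier (free_algebra G)"
  by (simp add: free_algebra_simps)

lemma eword_closed: "w \<in> lists G \<Longrightarrow> eword G w \<in> carrier (ext_algebra G)"
  unfolding eword_def eproj_onto by (intro imageI single_free)

lemma eword_append: "v \<in> lists G \<Longrightarrow> w \<in> lists G \<Longrightarrow> eword G (v @ w) = eword G v \<otimes>\<^bsub>ext_algebra G\<^esub> eword G w"
  unfolding eword_def by (simp add: alg_homD(2)[OF eproj_hom, symmetric] single_free free_algebra_mult)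

lemma eword_Nil: "eword G [] = \<one>\<^bsub>ext_algebra G\<^esub>"
  unfolding eword_def using alg_homD(4)[OF eproj_hom, of G] by (simp add: free_algebra_simps)

lemma eproj_ideal_zero:
  assumes "f \<in> ext_ideal G"
  shows "eproj G f = \<zero>\<^bsub>ext_algebra G\<^esub>"
proof -
  interpret F: complex_algebra "free_algebra G" by unfold_locales (rule free_algebra_alg)
  show ?thesis
    unfolding eproj_def ext_algebra_def quot_algebra_simps by (rule F.a_rcos_zero[OF ext_ideal assms])
qed

lemma eword_square: "g \<in> G \<Longrightarrow> eword G [g] \<otimes>\<^bsub>ext_algebra G\<^esub> eword G [g] = \<zero>\<^bsub>ext_algebra G\<^esub>"
  unfolding eword_def using ext_square_ideal[of "Poly_Mapping.single [g] 1" G]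
  by (simp add: alg_homD(2)[OF eproj_hom, symmetric] single_free eproj_ideal_zero)

text \<open>Polarisation: the square of the sum of two generators vanishes. This uses that the
  relations of \<open>ext_ideal\<close> are imposed on all vectors and not only on the
  generators.\<close>

lemma eword_anticomm:
  assumes "g \<in> G" "h \<in> G"
  shows "eword G [g] \<otimes>\<^bsub>ext_algebra G\<^esub> eword G [h] = \<ominus>\<^bsub>ext_algebra G\<^esub> (eword G [h] \<otimes>\<^bsub>ext_algebra G\<^esub> eword G [g])"
proof -
  interpret E: complex_algebra "ext_algebra G" by unfold_locales (rule ext_alg)
  let ?g = "Poly_Mapping.single [g] (1 :: complex)" and ?h = "Poly_Mapping.single [h] (1 :: complex)"
  have c: "?g \<in> carrier (free_algebra G)" "?h \<in> carrier (free_algebra G)" "?g + ?h \<in> carrier (free_algebra G)"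
    using assms Poly_Mapping.keys_add[of ?g ?h] by (auto simp: free_algebra_simps)
  have e: "eword G [g] \<in> carrier (ext_algebra G)" "eword G [h] \<in> carrier (ext_algebra G)"
    using assms by (auto intro: eword_closed)
  have "(?g + ?h) \<otimes>\<^bsub>free_algebra G\<^esub> (?g + ?h) \<in> ext_ideal G"
    using c Poly_Mapping.keys_add[of ?g ?h] by (intro ext_square_ideal) auto
  then have "eproj G ((?g + ?h) \<otimes>\<^bsub>free_algebra G\<^esub> (?g + ?h)) = \<zero>\<^bsub>ext_algebra G\<^esub>"
    by (rule eproj_ideal_zero)
  moreover have "eproj G (?g + ?h) = eword G [g] \<oplus>\<^bsub>ext_algebra G\<^esub> eword G [h]"
    using alg_homD(3)[OF eproj_hom c(1,2)] by (simp add: free_algebra_simps eword_def)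
  ultimately have "(eword G [g] \<oplus>\<^bsub>ext_algebra G\<^esub> eword G [h]) \<otimes>\<^bsub>ext_algebra G\<^esub> (eword G [g] \<oplus>\<^bsub>ext_algebra G\<^esub> eword G [h]) = \<zero>\<^bsub>ext_algebra G\<^esub>"
    using c by (simp add: alg_homD(2)[OF eproj_hom])
  then have "eword G [g] \<otimes>\<^bsub>ext_algebra G\<^esub> eword G [h] \<oplus>\<^bsub>ext_algebra G\<^esub> eword G [h] \<otimes>\<^bsub>ext_algebra G\<^esub> eword G [g] = \<zero>\<^bsub>ext_algebra G\<^esub>"
    using e assms by (simp add: E.l_distr E.r_distr eword_square E.a_comm)
  then show ?thesis
    using e by (metis E.minus_equality E.m_closed)
qed

text \<open>The step of an insertion sort: \<open>g\<close> moves to the right with a sign until it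
  finds its place or meets its equal. The clause on \<open>set v'\<close> guarantees that the head
  \<open>h\<close> is still smaller than all letters of the sorted remainder.\<close>

lemma eword_insert:
  fixes v :: "'g :: linorder list"
  assumes "g \<in> G" "v \<in> lists G" "sorted v" "distinct v"
  shows "eword G (g # v) = \<zero>\<^bsub>ext_algebra G\<^esub> \<or>
    (\<exists>v' s. eword G (g # v) = s \<odot>\<^bsub>ext_algebra G\<^esub> eword G v' \<and> v' \<in> lists G \<and> sorted v' \<and> distinct v' \<and> set v' = insert g (set v))"
  using assms
proof (induction v)
  case Nil
  interpret E: complex_algebra "ext_algebra G" by unfold_locales (rule ext_alg)
  show ?case using Nil eword_closed[of "[g]" G] by (intro disjI2 exI[of _ "[g]"] exI[of _ 1]) simp
next
  case (Cons h v)
  interpret E: complex_algebra "ext_algebra G" by unfold_locales (rule ext_alg)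
  have h: "h \<in> G" "v \<in> lists G" "sorted v" "distinct v" "\<forall>x\<in>set v. h < x"
    using Cons.prems by (auto simp: order.strict_iff_order)
  have c: "eword G [g] \<in> carrier (ext_algebra G)" "eword G [h] \<in> carrier (ext_algebra G)" "eword G v \<in> carrier (ext_algebra G)"
    using Cons.prems h by (auto intro: eword_closed)
  have cons: "eword G (a # w) = eword G [a] \<otimes>\<^bsub>ext_algebra G\<^esub> eword G w" if "a \<in> G" "w \<in> lists G" for a w
    using eword_append[of "[a]" G w] that by simp
  have split: "eword G (g # h # v) = (eword G [g] \<otimes>\<^bsub>ext_algebra G\<^esub> eword G [h]) \<otimes>\<^bsub>ext_algebra G\<^esub> eword G v"
    using Cons.prems h c by (simp add: cons[of g "h # v"] cons[of h v] E.m_assoc)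
  consider "g < h" | "g = h" | "h < g" using less_linear[of g h] by blast
  then show ?case
  proof cases
    case 1
    then have "sorted (g # h # v)" "distinct (g # h # v)" using Cons.prems h by auto
    then show ?thesis
      using Cons.prems eword_closed[of "g # h # v" G]
      by (intro disjI2 exI[of _ "g # h # v"] exI[of _ 1]) simp
  next
    case 2
    then show ?thesis using split c h by (simp add: eword_square)
  next
    case 3
    have e: "eword G (g # h # v) = (-1) \<odot>\<^bsub>ext_algebra G\<^esub> (eword G [h] \<otimes>\<^bsub>ext_algebra G\<^esub> eword G (g # v))"
    proof -
      have "eword G (g # h # v) = (\<ominus>\<^bsub>ext_algebra G\<^esub> (eword G [h] \<otimes>\<^bsub>ext_algebra G\<^esub> eword G [g])) \<otimes>\<^bsub>ext_algebra G\<^esub> eword G v"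
        unfolding split using eword_anticomm[of g G h] Cons.prems h by simp
      also have "\<dots> = (-1) \<odot>\<^bsub>ext_algebra G\<^esub> (eword G [h] \<otimes>\<^bsub>ext_algebra G\<^esub> eword G [g] \<otimes>\<^bsub>ext_algebra G\<^esub> eword G v)"
        using c by (simp add: E.smult_minus_one[symmetric] E.smult_mult_left)
      finally show ?thesis using c Cons.prems h by (simp add: cons[of g v] E.m_assoc)
    qed
    from Cons.IH[OF Cons.prems(1) h(2-4)] show ?thesis
    proof
      assume "eword G (g # v) = \<zero>\<^bsub>ext_algebra G\<^esub>"
      then show ?thesis using e c by simp
    next
      assume "\<exists>v' s. eword G (g # v) = s \<odot>\<^bsub>ext_algebra G\<^esub> eword G v' \<and> v' \<in> lists G \<and> sorted v' \<and> distinct v' \<and> set v' = insert g (set v)"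
      then obtain v' s where v': "eword G (g # v) = s \<odot>\<^bsub>ext_algebra G\<^esub> eword G v'" "v' \<in> lists G" "sorted v'" "distinct v'"
        "set v' = insert g (set v)" by blast
      have "eword G (g # h # v) = (- s) \<odot>\<^bsub>ext_algebra G\<^esub> eword G (h # v')"
        unfolding e v'(1) using c eword_closed[OF v'(2)] h v'
        by (simp add: cons[of h v'] E.smult_mult_right E.smult_assocC[symmetric])
      moreover have "sorted (h # v')" "distinct (h # v')" "set (h # v') = insert g (set (h # v))"
        using v' h 3 by auto
      ultimately show ?thesis using h v' by (intro disjI2 exI[of _ "h # v'"] exI[of _ "- s"]) simp
    qed
  qed
qed

lemma eword_sort:
  fixes v :: "'g :: linorder list"
  assumes "v \<in> lists G"
  shows "eword G v = \<zero>\<^bsub>ext_algebra G\<^esub> \<or>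
    (\<exists>v' s. eword G v = s \<odot>\<^bsub>ext_algebra G\<^esub> eword G v' \<and> v' \<in> lists G \<and> sorted v' \<and> distinct v')"
  using assms
proof (induction v rule: list.induct)
  case Nil
  interpret E: complex_algebra "ext_algebra G" by unfold_locales (rule ext_alg)
  show ?case using eword_closed[of "[]" G] by (intro disjI2 exI[of _ "[]"] exI[of _ 1]) simp
next
  case (Cons g v)
  interpret E: complex_algebra "ext_algebra G" by unfold_locales (rule ext_alg)
  have g: "g \<in> G" "v \<in> lists G" using Cons.prems by auto
  have cons: "eword G (g # w) = eword G [g] \<otimes>\<^bsub>ext_algebra G\<^esub> eword G w" if "w \<in> lists G" for w
    using eword_append[of "[g]" G w] g that by simp
  have c: "eword G [g] \<in> carrier (ext_algebra G)" using g by (auto intro: eword_closed)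
  from Cons.IH[OF g(2)] show ?case
  proof
    assume "eword G v = \<zero>\<^bsub>ext_algebra G\<^esub>"
    then show ?thesis using c g by (simp add: cons[of v])
  next
    assume "\<exists>v' s. eword G v = s \<odot>\<^bsub>ext_algebra G\<^esub> eword G v' \<and> v' \<in> lists G \<and> sorted v' \<and> distinct v'"
    then obtain v' s where v': "eword G v = s \<odot>\<^bsub>ext_algebra G\<^esub> eword G v'" "v' \<in> lists G" "sorted v'" "distinct v'" by blast
    have e: "eword G (g # v) = s \<odot>\<^bsub>ext_algebra G\<^esub> eword G (g # v')"
      using g v' c eword_closed[OF v'(2)] by (simp add: cons[of v] cons[of v'] E.smult_mult_right)
    from eword_insert[OF g(1) v'(2-4)] show ?thesis
    proof
      assume "eword G (g # v') = \<zero>\<^bsub>ext_algebra G\<^esub>"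
      then show ?thesis using e by simp
    next
      assume "\<exists>v'' t. eword G (g # v') = t \<odot>\<^bsub>ext_algebra G\<^esub> eword G v'' \<and> v'' \<in> lists G \<and> sorted v'' \<and> distinct v'' \<and> set v'' = insert g (set v')"
      then obtain v'' t where v'': "eword G (g # v') = t \<odot>\<^bsub>ext_algebra G\<^esub> eword G v''" "v'' \<in> lists G" "sorted v''" "distinct v''" by blast
      have "eword G (g # v) = (s * t) \<odot>\<^bsub>ext_algebra G\<^esub> eword G v''"
        unfolding e v''(1) using eword_closed[OF v''(2)] by (simp add: E.smult_assocC)
      then show ?thesis using v'' by blast
    qed
  qed
qed

section \<open>The isomorphism\<close>

context
  fixes M N :: nat
begin

declare One_nat_def [simp del]

abbreviation "evens \<equiv> {g \<in> ygens M N. gen_parity M g = 0}"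
abbreviation "odds \<equiv> {g \<in> ygens M N. gen_parity M g = 1}"
abbreviation "PA \<equiv> poly_algebra evens"
abbreviation "EA \<equiv> ext_algebra odds"
abbreviation "FS \<equiv> free_supercomm (ygens M N) (gen_parity M)"
abbreviation "fs_gen \<equiv> free_supercomm_gen (ygens M N) (gen_parity M)"
abbreviation "X \<equiv> \<lambda>w. gr_proj M N (Poly_Mapping.single w 1)"
abbreviation "pure \<equiv> pure_tensor PA EA"

interpretation GY: complex_algebra "GY M N" by unfold_locales (rule gr_alg)
interpretation PA: complex_algebra PA by unfold_locales (rule poly_algebra_alg)
interpretation EA: complex_algebra EA by unfold_locales (rule ext_alg)

lemma FS_eq: "FS = tensor_algebra PA EA"
  by (simp add: free_supercomm_def)

lemma FS_alg: "assoc_algebra FS"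
  unfolding FS_eq by (rule tensor_alg[OF poly_algebra_alg ext_alg])

interpretation FS: complex_algebra FS by unfold_locales (rule FS_alg)

lemma gen_parity_less: "gen_parity M g < 2"
  by (cases g) (simp add: gen_parity_def)

lemma gen_cases: "g \<in> ygens M N \<Longrightarrow> g \<in> evens \<or> g \<in> odds"
  using gen_parity_less[of g] by auto

lemma wpar_evens: "w \<in> lists evens \<Longrightarrow> wpar M w = 0"
  by (induction w) auto

lemma lists_sub: "w \<in> lists evens \<Longrightarrow> w \<in> lists (ygens M N)" "w \<in> lists odds \<Longrightarrow> w \<in> lists (ygens M N)"
  by auto

text \<open>\<open>gr_supercomm\<close> needs two homogeneous factors, so \<open>f\<close> is split
  into its parity parts. An even factor commutes with each of them without sign.\<close>

lemma gr_even_word_comm: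
  assumes u: "u \<in> lists evens" and f: "f \<in> carrier (FA M N)"
  shows "X u \<otimes>\<^bsub>GY M N\<^esub> gr_proj M N f = gr_proj M N f \<otimes>\<^bsub>GY M N\<^esub> X u"
proof -
  let ?s = "Poly_Mapping.single u (1 :: complex)"
  have s: "?s \<in> carrier (FA M N)" "homog M 0 ?s"
    using single_carrier[OF lists_sub(1)[OF u]] wpar_evens[OF u] by (auto simp: homog_def)
  have cl: "gr_proj M N f \<in> carrier (GY M N)" if "f \<in> carrier (FA M N)" for f
    using that gr_carrier by blast
  have c: "X u \<otimes>\<^bsub>GY M N\<^esub> gr_proj M N (par_part M e f) = gr_proj M N (par_part M e f) \<otimes>\<^bsub>GY M N\<^esub> X u" for e
  proof -
    have p: "par_part M e f \<in> carrier (FA M N)" "homog M e (par_part M e f)"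
      using f by (simp_all add: FA_filter_closed homog_closed)
    show ?thesis
      using gr_supercomm[OF s p] cl[OF s(1)] cl[OF p(1)] by simp
  qed
  have "gr_proj M N f = gr_proj M N (par_part M 0 f) \<oplus>\<^bsub>GY M N\<^esub> gr_proj M N (par_part M 1 f)"
    using par_part_decomp[of f M] f by (simp add: gr_add FA_filter_closed)
  then show ?thesis
    using c cl[OF s(1)] cl[OF FA_filter_closed[OF f]] by (simp add: GY.l_distr GY.r_distr)
qed

text \<open>A multiset of even letters is sent to the word in sorted order. Independence of the
  order makes this assignment multiplicative in \<open>poly_hom\<close>.\<close>

lemma gr_even_word_perm:
  assumes "v \<in> lists evens" "mset v = mset w"
  shows "X v = X w"
  using assms
proof (induction v arbitrary: w rule: list.induct)
  case (Cons g v)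
  have gv: "g \<in> evens" "v \<in> lists evens" using Cons.prems(1) by auto
  have sw: "set (g # v) = set w" using Cons.prems(2) by (rule mset_eq_setD)
  have w: "w \<in> lists evens" using Cons.prems(1) unfolding in_lists_conv_set sw .
  have "g \<in> set w" using sw by auto
  then obtain a b where ab: "w = a @ g # b" using split_list[of g w] by blast
  have abl: "a \<in> lists evens" "b \<in> lists evens" using w ab by auto
  have vab: "mset v = mset (a @ b)" using Cons.prems(2) ab by simp
  note cl = gr_word_closed[OF lists_sub(1)]
  have c: "X [g] \<in> carrier (GY M N)" "X a \<in> carrier (GY M N)" "X b \<in> carrier (GY M N)"
    using gv abl by (auto intro!: cl)
  have app: "X (u @ v) = X u \<otimes>\<^bsub>GY M N\<^esub> X v" if "u \<in> lists evens" "v \<in> lists evens" for u v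
    using that by (intro gr_word_append lists_sub(1))
  have "X w = X a \<otimes>\<^bsub>GY M N\<^esub> (X [g] \<otimes>\<^bsub>GY M N\<^esub> X b)"
    using app[of a "g # b"] app[of "[g]" b] gv abl ab by simp
  also have "\<dots> = (X [g] \<otimes>\<^bsub>GY M N\<^esub> X a) \<otimes>\<^bsub>GY M N\<^esub> X b"
    using c gr_even_word_comm[OF abl(1) single_carrier[OF lists_sub(1)], of "[g]" 1] gv by (simp add: GY.m_assoc[symmetric])
  also have "\<dots> = X [g] \<otimes>\<^bsub>GY M N\<^esub> X v"
    using Cons.IH[OF gv(2) vab] app[OF abl] c by (simp add: GY.m_assoc)
  also have "\<dots> = X (g # v)" using app[of "[g]" v] gv by simp
  finally show ?case ..
qed simp

lemma sorted_list_lists: "set_mset m \<subseteq> G \<Longrightarrow> sorted_list_of_multiset m \<in> lists G"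
  by (auto simp: in_lists_conv_set)

lemma poly_hom:
  obtains h where "h \<in> alg_hom PA (GY M N)"
    "\<And>m c. set_mset m \<subseteq> evens \<Longrightarrow> h (Poly_Mapping.single m c) = c \<odot>\<^bsub>GY M N\<^esub> X (sorted_list_of_multiset m)"
proof -
  let ?S = "\<lparr>carrier = {m. set_mset m \<subseteq> evens}, mult = (+), one = {#}\<rparr>"
  let ?\<phi> = "\<lambda>m. X (sorted_list_of_multiset m)"
  have c: "?\<phi> m \<in> carrier (GY M N)" if "m \<in> carrier ?S" for m
    using that by (intro gr_word_closed lists_sub(1) sorted_list_lists) simp
  have m: "?\<phi> (m \<otimes>\<^bsub>?S\<^esub> n) = ?\<phi> m \<otimes>\<^bsub>GY M N\<^esub> ?\<phi> n" if "m \<in> carrier ?S" "n \<in> carrier ?S" for m n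
  proof -
    have l: "sorted_list_of_multiset m \<in> lists evens" "sorted_list_of_multiset n \<in> lists evens"
      "sorted_list_of_multiset (m + n) \<in> lists evens"
      using that by (auto intro!: sorted_list_lists)
    have "?\<phi> (m + n) = X (sorted_list_of_multiset m @ sorted_list_of_multiset n)"
      by (rule gr_even_word_perm[OF l(3)]) simp
    then show ?thesis
      using gr_word_append[OF lists_sub(1)[OF l(1)] lists_sub(1)[OF l(2)]] by simp
  qed
  have o: "?\<phi> \<one>\<^bsub>?S\<^esub> = \<one>\<^bsub>GY M N\<^esub>"
    by (simp add: gr_one free_algebra_simps)
  note L = ma_lift_alg_hom[OF poly_monoid gr_alg(1), of evens ?\<phi>]
  show thesis
  proof (rule that)
    show "ma_lift (GY M N) ?\<phi> \<in> alg_hom PA (GY M N)"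
      unfolding poly_algebra_def by (rule L(1), erule c, erule (1) m, rule o)
    show "ma_lift (GY M N) ?\<phi> (Poly_Mapping.single m c) = c \<odot>\<^bsub>GY M N\<^esub> X (sorted_list_of_multiset m)"
      if "set_mset m \<subseteq> evens" for m c
    proof -
      have mem: "m \<in> carrier ?S" using that by simp
      show ?thesis by (rule L(2), erule c, erule (1) m, rule o, rule mem)
    qed
  qed
qed

lemma FO_sub: "f \<in> carrier (free_algebra odds) \<Longrightarrow> f \<in> carrier (FA M N)"
  by (auto simp: free_algebra_simps)

text \<open>The product formula does not mention the carrier, so the free algebra on the odd
  generators lies in \<open>FA M N\<close> with the same multiplication.\<close>

lemma free_algebra_mult_indep: "f \<otimes>\<^bsub>free_algebra G\<^esub> g = f \<otimes>\<^bsub>free_algebra G'\<^esub> g"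
  by (simp add: free_algebra_def monoid_algebra_def)

lemma ext_hom:
  obtains k where "k \<in> alg_hom EA (GY M N)"
    "\<And>f. f \<in> carrier (free_algebra odds) \<Longrightarrow> k (eproj odds f) = gr_proj M N f"
proof -
  have h: "gr_proj M N \<in> alg_hom (free_algebra odds) (GY M N)"
  proof (rule alg_homI)
    fix f assume f: "f \<in> carrier (free_algebra odds)"
    show "gr_proj M N f \<in> carrier (GY M N)" using FO_sub[OF f] gr_carrier by blast
    show "gr_proj M N (c \<odot>\<^bsub>free_algebra odds\<^esub> f) = c \<odot>\<^bsub>GY M N\<^esub> gr_proj M N f" for c
      using FO_sub[OF f] by (simp add: free_algebra_simps gr_smult)
    fix g assume g: "g \<in> carrier (free_algebra odds)"
    show "gr_proj M N (f \<otimes>\<^bsub>free_algebra odds\<^esub> g) = gr_proj M N f \<otimes>\<^bsub>GY M N\<^esub> gr_proj M N g"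
      unfolding gr_mult[OF FO_sub[OF f] FO_sub[OF g]] free_algebra_mult_indep[of odds f g "ygens M N"] ..
    show "gr_proj M N (f \<oplus>\<^bsub>free_algebra odds\<^esub> g) = gr_proj M N f \<oplus>\<^bsub>GY M N\<^esub> gr_proj M N g"
      using FO_sub[OF f] FO_sub[OF g] by (simp add: free_algebra_simps gr_add)
  qed (simp add: gr_one free_algebra_simps)
  have sq: "gr_proj M N (v \<otimes>\<^bsub>free_algebra odds\<^esub> v) = \<zero>\<^bsub>GY M N\<^esub>"
    if v: "v \<in> carrier (free_algebra odds)" "\<forall>w\<in>Poly_Mapping.keys v. length w = 1" for v
  proof -
    have "wpar M w mod 2 = 1" if "w \<in> Poly_Mapping.keys v" for w
    proof -
      have "w \<in> lists odds" "length w = 1" using v that by (auto simp: free_algebra_simps)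
      then show ?thesis by (cases w) auto
    qed
    then have "homog M 1 v" by (simp add: homog_def)
    let ?x = "gr_proj M N v"
    have x: "?x \<in> carrier (GY M N)" using FO_sub[OF v(1)] gr_carrier by blast
    \<comment> \<open>A combination of single odd letters is homogeneous and odd. Supercommutativity
      makes its square equal to its own negative, and 2 is invertible.\<close>
    have "?x \<otimes>\<^bsub>GY M N\<^esub> ?x = (-1) \<odot>\<^bsub>GY M N\<^esub> (?x \<otimes>\<^bsub>GY M N\<^esub> ?x)"
      using gr_supercomm[OF FO_sub[OF v(1)] \<open>homog M 1 v\<close> FO_sub[OF v(1)] \<open>homog M 1 v\<close>] by simp
    then have "?x \<otimes>\<^bsub>GY M N\<^esub> ?x \<oplus>\<^bsub>GY M N\<^esub> ?x \<otimes>\<^bsub>GY M N\<^esub> ?x = \<zero>\<^bsub>GY M N\<^esub>"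
      using x GY.smult_minus_one[of "?x \<otimes>\<^bsub>GY M N\<^esub> ?x"] GY.r_neg[of "?x \<otimes>\<^bsub>GY M N\<^esub> ?x"] by simp
    then have "2 \<odot>\<^bsub>GY M N\<^esub> (?x \<otimes>\<^bsub>GY M N\<^esub> ?x) = \<zero>\<^bsub>GY M N\<^esub>"
      using x GY.smult_l_distrC[of "?x \<otimes>\<^bsub>GY M N\<^esub> ?x" 1 1] by simp
    then have "(1/2) \<odot>\<^bsub>GY M N\<^esub> (2 \<odot>\<^bsub>GY M N\<^esub> (?x \<otimes>\<^bsub>GY M N\<^esub> ?x)) = \<zero>\<^bsub>GY M N\<^esub>" by simp
    then have "?x \<otimes>\<^bsub>GY M N\<^esub> ?x = \<zero>\<^bsub>GY M N\<^esub>"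
      using x GY.smult_assocC[of "?x \<otimes>\<^bsub>GY M N\<^esub> ?x" "1/2" 2] by simp
    then show ?thesis using alg_homD(2)[OF h v(1) v(1)] by simp
  qed
  have ker: "gr_proj M N f = \<zero>\<^bsub>GY M N\<^esub>" if "f \<in> ext_ideal odds" for f
  proof (rule alg_hom_vanish_genideal[OF free_algebra_alg gr_alg(1) h ext_gens_carrier _ that[unfolded ext_ideal_def]])
    fix g assume "g \<in> {v \<otimes>\<^bsub>free_algebra odds\<^esub> v |v. v \<in> carrier (free_algebra odds) \<and> (\<forall>w\<in>Poly_Mapping.keys v. length w = 1)}"
    then obtain v where "g = v \<otimes>\<^bsub>free_algebra odds\<^esub> v" "v \<in> carrier (free_algebra odds)" "\<forall>w\<in>Poly_Mapping.keys v. length w = 1"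
      by blast
    then show "gr_proj M N g = \<zero>\<^bsub>GY M N\<^esub>" using sq by simp
  qed
  obtain k where "k \<in> alg_hom (quot_algebra (free_algebra odds) (ext_ideal odds)) (GY M N)"
    "\<And>f. f \<in> carrier (free_algebra odds) \<Longrightarrow> k (ext_ideal odds +>\<^bsub>free_algebra odds\<^esub> f) = gr_proj M N f"
    using quot_algebra_lift[OF free_algebra_alg ext_ideal gr_alg(1) h ker] by blast
  then show thesis
    using that unfolding ext_algebra_def eproj_def by blast
qed

lemma supercomm_hom:
  obtains t where "t \<in> alg_hom FS (GY M N)" "\<And>g. g \<in> ygens M N \<Longrightarrow> t (fs_gen g) = X [g]"
proof -
  obtain h where h: "h \<in> alg_hom PA (GY M N)"
    "\<And>m c. set_mset m \<subseteq> evens \<Longrightarrow> h (Poly_Mapping.single m c) = c \<odot>\<^bsub>GY M N\<^esub> X (sorted_list_of_multiset m)"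
    using poly_hom by blast
  obtain k where k: "k \<in> alg_hom EA (GY M N)"
    "\<And>f. f \<in> carrier (free_algebra odds) \<Longrightarrow> k (eproj odds f) = gr_proj M N f"
    using ext_hom by blast
  have cl: "gr_proj M N f \<in> carrier (GY M N)" if "f \<in> carrier (FA M N)" for f
    using that gr_carrier by blast
  have comm: "h a \<otimes>\<^bsub>GY M N\<^esub> k b = k b \<otimes>\<^bsub>GY M N\<^esub> h a" if a: "a \<in> carrier PA" and b: "b \<in> carrier EA" for a b
  proof -
    obtain f where f: "f \<in> carrier (free_algebra odds)" "b = eproj odds f" using b eproj_onto by blast
    have kb: "k b = gr_proj M N f" using f k by simp
    have kc: "gr_proj M N f \<in> carrier (GY M N)" using FO_sub[OF f(1)] cl by blast
    have "Poly_Mapping.keys a \<subseteq> {m. set_mset m \<subseteq> evens}" using a by (auto simp: poly_algebra_simps)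
    then show ?thesis
      unfolding kb
    proof (induction rule: poly_mapping_keys_induct)
      case zero
      have "h 0 = \<zero>\<^bsub>GY M N\<^esub>"
        using alg_hom_zero_minus(1)[OF poly_algebra_alg gr_alg(1) h(1)] by (simp add: poly_algebra_simps)
      then show ?case using kc by simp
    next
      case (single m c)
      then have l: "sorted_list_of_multiset m \<in> lists evens" by (intro sorted_list_lists) simp
      show ?case
        using single h(2)[of m c] gr_even_word_comm[OF l FO_sub[OF f(1)]] kc gr_word_closed[OF lists_sub(1)[OF l]]
        by (simp add: GY.smult_mult_left GY.smult_mult_right)
    next
      case (add f g)
      then have "f \<in> carrier PA" "g \<in> carrier PA" by (auto simp: poly_algebra_simps)
      then have "h (f + g) = h f \<oplus>\<^bsub>GY M N\<^esub> h g" "h f \<in> carrier (GY M N)" "h g \<in> carrier (GY M N)"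
        using alg_homD(3)[OF h(1), of f g] alg_homD(1)[OF h(1)] by (simp_all add: poly_algebra_simps)
      then show ?case using add kc by (simp add: GY.l_distr GY.r_distr)
    qed
  qed
  obtain t where t: "t \<in> alg_hom (tensor_algebra PA EA) (GY M N)"
    "\<And>a b. a \<in> carrier PA \<Longrightarrow> b \<in> carrier EA \<Longrightarrow> t (pure a b) = h a \<otimes>\<^bsub>GY M N\<^esub> k b"
    using tensor_lift[OF poly_algebra_alg ext_alg gr_alg(1) h(1) k(1) comm] by blast
  have "t (fs_gen g) = X [g]" if g: "g \<in> ygens M N" for g
  proof (cases "gen_parity M g = 0")
    case True
    have gc: "poly_gen g \<in> carrier PA" using True g by (simp add: poly_algebra_simps poly_gen_def)
    have "sorted_list_of_multiset {#g#} = [g]" by simp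
    then have "h (poly_gen g) = X [g]"
      unfolding poly_gen_def using True g h(2)[of "{#g#}" 1] gr_word_closed[of "[g]" M N] by simp
    then show ?thesis
      using True g t(2)[OF gc EA.one_closed] alg_homD(4)[OF k(1)] gr_word_closed[of "[g]" M N]
      by (simp add: free_supercomm_gen_def Let_def)
  next
    case False
    then have o: "g \<in> odds" using gen_cases[OF g] by auto
    then have gc: "ext_gen odds g \<in> carrier EA" unfolding ext_gen_eq by (intro eword_closed) simp
    have "k (ext_gen odds g) = X [g]"
      unfolding ext_gen_eq eword_def using o by (intro k(2) single_free) simp
    then show ?thesis
      using False g t(2)[OF PA.one_closed gc] alg_homD(4)[OF h(1)] gr_word_closed[of "[g]" M N]
      by (simp add: free_supercomm_gen_def Let_def)
  qed
  then show thesis using that t(1) unfolding FS_eq by blast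
qed

lemma fs_gen_closed: "g \<in> ygens M N \<Longrightarrow> fs_gen g \<in> carrier FS"
proof -
  assume g: "g \<in> ygens M N"
  show ?thesis
  proof (cases "gen_parity M g = 0")
    case True
    then have "poly_gen g \<in> carrier PA" using g by (simp add: poly_algebra_simps poly_gen_def)
    then show ?thesis
      using True pure_closed[OF poly_algebra_alg ext_alg _ EA.one_closed] by (simp add: free_supercomm_gen_def FS_eq Let_def)
  next
    case False
    then have "ext_gen odds g \<in> carrier EA"
      unfolding ext_gen_eq using gen_cases[OF g] by (intro eword_closed) auto
    then show ?thesis
      using False pure_closed[OF poly_algebra_alg ext_alg PA.one_closed] by (simp add: free_supercomm_gen_def FS_eq Let_def)
  qed
qed

section \<open>Words in the free supercommutative algebra\<close>

definition fs_word :: "ygen list \<Rightarrow> ((ygen multiset \<Rightarrow>\<^sub>0 complex) \<times> (ygen list \<Rightarrow>\<^sub>0 complex) set \<Rightarrow>\<^sub>0 complex) set" where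
  "fs_word w = foldr (\<lambda>g a. fs_gen g \<otimes>\<^bsub>FS\<^esub> a) w \<one>\<^bsub>FS\<^esub>"

lemma fs_word_simps: "fs_word [] = \<one>\<^bsub>FS\<^esub>" "fs_word (g # w) = fs_gen g \<otimes>\<^bsub>FS\<^esub> fs_word w"
  by (simp_all add: fs_word_def)

lemma fs_word_closed: "w \<in> lists (ygens M N) \<Longrightarrow> fs_word w \<in> carrier FS"
  by (induction w rule: list.induct) (auto simp: fs_word_simps fs_gen_closed)

lemma fs_word_append:
  "v \<in> lists (ygens M N) \<Longrightarrow> w \<in> lists (ygens M N) \<Longrightarrow> fs_word (v @ w) = fs_word v \<otimes>\<^bsub>FS\<^esub> fs_word w"
  by (induction v rule: list.induct) (auto simp: fs_word_simps fs_gen_closed fs_word_closed FS.m_assoc)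

text \<open>The counterpart of \<open>gr_proj\<close> for the free supercommutative algebra. Both
  start from the free algebra, so the comparison map \<open>t\<close> is controlled by the identity
  that \<open>t\<close> after \<open>fs_proj\<close> is \<open>gr_proj\<close>.\<close>

definition fs_proj :: "(ygen list \<Rightarrow>\<^sub>0 complex) \<Rightarrow> ((ygen multiset \<Rightarrow>\<^sub>0 complex) \<times> (ygen list \<Rightarrow>\<^sub>0 complex) set \<Rightarrow>\<^sub>0 complex) set" where
  "fs_proj = ma_lift FS fs_word"

lemma fs_proj_hom:
  "fs_proj \<in> alg_hom (FA M N) FS"
  "w \<in> lists (ygens M N) \<Longrightarrow> fs_proj (Poly_Mapping.single w c) = c \<odot>\<^bsub>FS\<^esub> fs_word w"
proof -
  note L = ma_lift_alg_hom[OF monoid_free[of "ygens M N"] FS_alg, of fs_word]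
  show "fs_proj \<in> alg_hom (FA M N) FS"
    unfolding fs_proj_def free_algebra_def by (rule L(1)) (simp_all add: fs_word_closed fs_word_append fs_word_simps)
  show "fs_proj (Poly_Mapping.single w c) = c \<odot>\<^bsub>FS\<^esub> fs_word w" if "w \<in> lists (ygens M N)"
    unfolding fs_proj_def using that by (intro L(2)) (simp_all add: fs_word_closed fs_word_append fs_word_simps)
qed

lemma fs_word_even: "w \<in> lists evens \<Longrightarrow> fs_word w = pure (Poly_Mapping.single (mset w) 1) \<one>\<^bsub>EA\<^esub>"
proof (induction w rule: list.induct)
  case Nil
  then show ?case
    using pure_one[OF poly_algebra_alg[of evens] ext_alg[of odds]] by (simp add: fs_word_simps FS_eq poly_algebra_simps)
next
  case (Cons g w)
  then have g: "g \<in> evens" "w \<in> lists evens" by auto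
  have c: "Poly_Mapping.single {#g#} 1 \<in> carrier PA" "Poly_Mapping.single (mset w) 1 \<in> carrier PA"
    using g by (auto simp: poly_algebra_simps)
  have "fs_gen g = pure (Poly_Mapping.single {#g#} 1) \<one>\<^bsub>EA\<^esub>"
    using g by (simp add: free_supercomm_gen_def poly_gen_def Let_def)
  then have "fs_word (g # w) = pure (Poly_Mapping.single {#g#} 1) \<one>\<^bsub>EA\<^esub> \<otimes>\<^bsub>FS\<^esub> pure (Poly_Mapping.single (mset w) 1) \<one>\<^bsub>EA\<^esub>"
    using Cons.IH g by (simp add: fs_word_simps)
  also have "\<dots> = pure (Poly_Mapping.single {#g#} 1 \<otimes>\<^bsub>PA\<^esub> Poly_Mapping.single (mset w) 1) (\<one>\<^bsub>EA\<^esub> \<otimes>\<^bsub>EA\<^esub> \<one>\<^bsub>EA\<^esub>)"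
    unfolding FS_eq by (rule pure_mult[OF poly_algebra_alg ext_alg c(1) EA.one_closed c(2) EA.one_closed])
  finally show ?case by (simp add: poly_algebra_simps)
qed

lemma fs_word_odd: "w \<in> lists odds \<Longrightarrow> fs_word w = pure \<one>\<^bsub>PA\<^esub> (eword odds w)"
proof (induction w rule: list.induct)
  case Nil
  then show ?case
    using pure_one[OF poly_algebra_alg[of evens] ext_alg[of odds]] by (simp add: fs_word_simps FS_eq eword_Nil)
next
  case (Cons g w)
  then have g: "g \<in> odds" "w \<in> lists odds" by auto
  have c: "eword odds [g] \<in> carrier EA" "eword odds w \<in> carrier EA"
    using g by (auto intro!: eword_closed)
  have "fs_gen g = pure \<one>\<^bsub>PA\<^esub> (eword odds [g])"
    using g by (simp add: free_supercomm_gen_def Let_def ext_gen_eq)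
  then have "fs_word (g # w) = pure \<one>\<^bsub>PA\<^esub> (eword odds [g]) \<otimes>\<^bsub>FS\<^esub> pure \<one>\<^bsub>PA\<^esub> (eword odds w)"
    using Cons.IH g by (simp add: fs_word_simps)
  also have "\<dots> = pure (\<one>\<^bsub>PA\<^esub> \<otimes>\<^bsub>PA\<^esub> \<one>\<^bsub>PA\<^esub>) (eword odds [g] \<otimes>\<^bsub>EA\<^esub> eword odds w)"
    unfolding FS_eq by (rule pure_mult[OF poly_algebra_alg ext_alg PA.one_closed c(1) PA.one_closed c(2)])
  also have "\<dots> = pure \<one>\<^bsub>PA\<^esub> (eword odds (g # w))"
    using eword_append[of "[g]" odds w] g by simp
  finally show ?case .
qed

lemma fs_word_normal:
  assumes "u \<in> lists evens" "v \<in> lists odds"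
  shows "fs_word (u @ v) = pure (Poly_Mapping.single (mset u) 1) (eword odds v)"
proof -
  have c: "Poly_Mapping.single (mset u) 1 \<in> carrier PA" "eword odds v \<in> carrier EA"
    using assms by (auto simp: poly_algebra_simps intro!: eword_closed)
  have "fs_word (u @ v) = pure (Poly_Mapping.single (mset u) 1) \<one>\<^bsub>EA\<^esub> \<otimes>\<^bsub>FS\<^esub> pure \<one>\<^bsub>PA\<^esub> (eword odds v)"
    using assms by (simp add: fs_word_append lists_sub fs_word_even fs_word_odd)
  also have "\<dots> = pure (Poly_Mapping.single (mset u) 1 \<otimes>\<^bsub>PA\<^esub> \<one>\<^bsub>PA\<^esub>) (\<one>\<^bsub>EA\<^esub> \<otimes>\<^bsub>EA\<^esub> eword odds v)"
    unfolding FS_eq by (rule pure_mult[OF poly_algebra_alg ext_alg c(1) EA.one_closed PA.one_closed c(2)])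
  finally show ?thesis unfolding PA.r_one[OF c(1)] EA.l_one[OF c(2)] .
qed

section \<open>Combinations of normal words\<close>

definition normal_span :: "(ygen list \<Rightarrow>\<^sub>0 complex) set" where
  "normal_span = {f \<in> carrier (FA M N). \<forall>w\<in>Poly_Mapping.keys f. normal_word (ipar M) w}"

lemma normal_span_closed:
  "0 \<in> normal_span" "f \<in> normal_span \<Longrightarrow> g \<in> normal_span \<Longrightarrow> f + g \<in> normal_span"
  "f \<in> normal_span \<Longrightarrow> g \<in> normal_span \<Longrightarrow> f - g \<in> normal_span"
  "f \<in> normal_span \<Longrightarrow> Poly_Mapping.map ((*) c) f \<in> normal_span"
  "f \<in> normal_span \<Longrightarrow> pm_filter P f \<in> normal_span"
  "f \<in> normal_span \<Longrightarrow> f \<in> carrier (FA M N)"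
  using Poly_Mapping.keys_add[of f g] Poly_Mapping.keys_diff[of f g]
  by (auto simp: normal_span_def FA_zero_closed FA_add_closed FA_diff_closed FA_smult_closed FA_filter_closed
      keys_pm_filter in_keys_iff lookup_scale)

text \<open>Pure tensors span, and by bilinearity a multiset of even letters tensored with a word in
  the odd letters suffices. The multiset is listed in sorted order, and \<open>eword_sort\<close>
  turns the odd word into zero or a multiple of a strictly sorted one.\<close>

lemma fs_normal_onto: "carrier FS \<subseteq> fs_proj ` normal_span"
proof -
  let ?S = "fs_proj ` normal_span"
  note D = alg_homD[OF fs_proj_hom(1)]
  have S_zero: "\<zero>\<^bsub>FS\<^esub> \<in> ?S"
    using alg_hom_zero_minus(1)[OF free_algebra_alg FS_alg fs_proj_hom(1)] normal_span_closed(1)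
    by (metis free_algebra_simps(2) imageI)
  have S_add: "x \<oplus>\<^bsub>FS\<^esub> y \<in> ?S" if xy: "x \<in> ?S" "y \<in> ?S" for x y
  proof -
    obtain f g where "f \<in> normal_span" "x = fs_proj f" "g \<in> normal_span" "y = fs_proj g" using xy by blast
    then show ?thesis
      using D(3)[of f g] normal_span_closed(6) normal_span_closed(2)[of f g]
      by (intro image_eqI[of _ _ "f + g"]) (simp_all add: free_algebra_simps)
  qed
  have smult: "c \<odot>\<^bsub>FS\<^esub> x \<in> ?S" if x: "x \<in> ?S" for c x
  proof -
    obtain f where "f \<in> normal_span" "x = fs_proj f" using x by blast
    then show ?thesis
      using D(5)[of f c] normal_span_closed(6) normal_span_closed(4)[of f c]
      by (intro image_eqI[of _ _ "Poly_Mapping.map ((*) c) f"]) (simp_all add: free_algebra_simps)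
  qed
  have words: "pure (Poly_Mapping.single m 1) (eword odds v) \<in> ?S"
    if m: "set_mset m \<subseteq> evens" and v: "v \<in> lists odds" for m v
  proof -
    let ?u = "sorted_list_of_multiset m"
    have u: "?u \<in> lists evens" using m by (rule sorted_list_lists)
    have mc: "Poly_Mapping.single m 1 \<in> carrier PA" using m by (simp add: poly_algebra_simps)
    have sorted_case: "pure (Poly_Mapping.single m 1) (eword odds v') \<in> ?S"
      if v': "v' \<in> lists odds" "sorted v'" "distinct v'" for v'
    proof -
      have l: "?u @ v' \<in> lists (ygens M N)" using u v' by auto
      have "normal_word (ipar M) (?u @ v')"
        unfolding normal_word_def gen_odd_ipar using u v' m
        by (intro exI[of _ ?u] exI[of _ v']) auto
      then have "Poly_Mapping.single (?u @ v') 1 \<in> normal_span"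
        using l by (auto simp: normal_span_def free_algebra_simps)
      moreover have "fs_proj (Poly_Mapping.single (?u @ v') 1) = pure (Poly_Mapping.single m 1) (eword odds v')"
        using fs_proj_hom(2)[OF l, of 1] fs_word_closed[OF l] fs_word_normal[OF u v'(1)] by simp
      ultimately show ?thesis by (metis imageI)
    qed
    from eword_sort[OF v] show ?thesis
    proof
      assume z: "eword odds v = \<zero>\<^bsub>EA\<^esub>"
      \<comment> \<open>Zero is written as a scalar multiple of the unit, so that compatibility of
        pure tensors with scalars gives the vanishing.\<close>
      have "pure (Poly_Mapping.single m 1) (0 \<odot>\<^bsub>EA\<^esub> \<one>\<^bsub>EA\<^esub>) = 0 \<odot>\<^bsub>FS\<^esub> pure (Poly_Mapping.single m 1) \<one>\<^bsub>EA\<^esub>"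
        unfolding FS_eq by (rule pure_smult_right[OF poly_algebra_alg ext_alg mc EA.one_closed])
      moreover have "pure (Poly_Mapping.single m 1) \<one>\<^bsub>EA\<^esub> \<in> carrier FS"
        unfolding FS_eq by (rule pure_closed[OF poly_algebra_alg ext_alg mc EA.one_closed])
      ultimately show ?thesis using S_zero z by simp
    next
      assume "\<exists>v' s. eword odds v = s \<odot>\<^bsub>EA\<^esub> eword odds v' \<and> v' \<in> lists odds \<and> sorted v' \<and> distinct v'"
      then obtain v' s where v': "eword odds v = s \<odot>\<^bsub>EA\<^esub> eword odds v'" "v' \<in> lists odds" "sorted v'" "distinct v'"
        by blast
      have "pure (Poly_Mapping.single m 1) (eword odds v) = s \<odot>\<^bsub>FS\<^esub> pure (Poly_Mapping.single m 1) (eword odds v')"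
        unfolding FS_eq v'(1) by (rule pure_smult_right[OF poly_algebra_alg ext_alg mc eword_closed[OF v'(2)]])
      then show ?thesis using smult[OF sorted_case[OF v'(2-4)], of s] by simp
    qed
  qed
  have pure: "pure a b \<in> ?S" if a: "a \<in> carrier PA" and b: "b \<in> carrier EA" for a b
  proof -
    obtain f where f: "f \<in> carrier (free_algebra odds)" "b = eproj odds f" using b eproj_onto by blast
    have ka: "Poly_Mapping.keys a \<subseteq> {m. set_mset m \<subseteq> evens}" using a by (auto simp: poly_algebra_simps)
    have kf: "Poly_Mapping.keys f \<subseteq> lists odds" using f by (simp add: free_algebra_simps)
    have one_m: "pure (Poly_Mapping.single m 1) (eproj odds f) \<in> ?S" if m: "set_mset m \<subseteq> evens" for m
    proof -
      have mc: "Poly_Mapping.single m 1 \<in> carrier PA" using m by (simp add: poly_algebra_simps)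
      show ?thesis using kf
      proof (induction rule: poly_mapping_keys_induct)
        case zero
        have "eproj odds 0 = 0 \<odot>\<^bsub>EA\<^esub> \<one>\<^bsub>EA\<^esub>"
          using alg_hom_zero_minus(1)[OF free_algebra_alg ext_alg eproj_hom[of odds]] by (simp add: free_algebra_simps)
        moreover have "pure (Poly_Mapping.single m 1) (0 \<odot>\<^bsub>EA\<^esub> \<one>\<^bsub>EA\<^esub>) = 0 \<odot>\<^bsub>FS\<^esub> pure (Poly_Mapping.single m 1) \<one>\<^bsub>EA\<^esub>"
          unfolding FS_eq by (rule pure_smult_right[OF poly_algebra_alg ext_alg mc EA.one_closed])
        moreover have "pure (Poly_Mapping.single m 1) \<one>\<^bsub>EA\<^esub> \<in> carrier FS"
          unfolding FS_eq by (rule pure_closed[OF poly_algebra_alg ext_alg mc EA.one_closed])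
        ultimately show ?case using S_zero by simp
      next
        case (single v c)
        have "eproj odds (Poly_Mapping.single v c) = c \<odot>\<^bsub>EA\<^esub> eword odds v"
          using alg_homD(5)[OF eproj_hom single_free[OF single], of c 1] by (simp add: free_algebra_simps scale_single eword_def)
        moreover have "pure (Poly_Mapping.single m 1) (c \<odot>\<^bsub>EA\<^esub> eword odds v) = c \<odot>\<^bsub>FS\<^esub> pure (Poly_Mapping.single m 1) (eword odds v)"
          unfolding FS_eq by (rule pure_smult_right[OF poly_algebra_alg ext_alg mc eword_closed[OF single]])
        ultimately show ?case using smult[OF words[OF m single], of c] by simp
      next
        case (add f g)
        then have c: "f \<in> carrier (free_algebra odds)" "g \<in> carrier (free_algebra odds)" by (simp_all add: free_algebra_simps)
        then have "eproj odds (f + g) = eproj odds f \<oplus>\<^bsub>EA\<^esub> eproj odds g"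
          using alg_homD(3)[OF eproj_hom c] by (simp add: free_algebra_simps)
        then have "pure (Poly_Mapping.single m 1) (eproj odds (f + g)) =
            pure (Poly_Mapping.single m 1) (eproj odds f) \<oplus>\<^bsub>FS\<^esub> pure (Poly_Mapping.single m 1) (eproj odds g)"
          unfolding FS_eq using pure_add_right[OF poly_algebra_alg ext_alg mc alg_homD(1)[OF eproj_hom c(1)] alg_homD(1)[OF eproj_hom c(2)]]
          by simp
        then show ?case using S_add[OF add(3,4)] by simp
      qed
    qed
    have "pure a (eproj odds f) \<in> ?S" using ka
    proof (induction rule: poly_mapping_keys_induct)
      case zero
      have "pure (0 \<odot>\<^bsub>PA\<^esub> \<one>\<^bsub>PA\<^esub>) (eproj odds f) = 0 \<odot>\<^bsub>FS\<^esub> pure \<one>\<^bsub>PA\<^esub> (eproj odds f)"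
        unfolding FS_eq using b f by (intro pure_smult_left[OF poly_algebra_alg ext_alg PA.one_closed]) simp
      moreover have "pure \<one>\<^bsub>PA\<^esub> (eproj odds f) \<in> carrier FS"
        unfolding FS_eq using b f by (intro pure_closed[OF poly_algebra_alg ext_alg PA.one_closed]) simp
      moreover have "0 \<odot>\<^bsub>PA\<^esub> \<one>\<^bsub>PA\<^esub> = 0"
        using PA.smult_zero_left[OF PA.one_closed] by (simp add: poly_algebra_simps)
      ultimately show ?case using S_zero by simp
    next
      case (single m c)
      then have mc: "Poly_Mapping.single m 1 \<in> carrier PA" by (simp add: poly_algebra_simps)
      have "Poly_Mapping.single m c = c \<odot>\<^bsub>PA\<^esub> Poly_Mapping.single m 1"
        by (simp add: poly_algebra_simps scale_single)
      then have "pure (Poly_Mapping.single m c) (eproj odds f) = c \<odot>\<^bsub>FS\<^esub> pure (Poly_Mapping.single m 1) (eproj odds f)"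
        unfolding FS_eq using pure_smult_left[OF poly_algebra_alg ext_alg mc] b f by simp
      then show ?case using smult[OF one_m, of m c] single by simp
    next
      case (add a a')
      then have c: "a \<in> carrier PA" "a' \<in> carrier PA" by (auto simp: poly_algebra_simps)
      have "pure (a \<oplus>\<^bsub>PA\<^esub> a') (eproj odds f) = pure a (eproj odds f) \<oplus>\<^bsub>FS\<^esub> pure a' (eproj odds f)"
        unfolding FS_eq using pure_add_left[OF poly_algebra_alg ext_alg c] b f by simp
      then show ?case using S_add[OF add(3,4)] by (simp add: poly_algebra_simps)
    qed
    then show ?thesis using f by simp
  qed
  show ?thesis
    unfolding FS_eq
    by (rule tensor_span[OF poly_algebra_alg ext_alg]) (use S_zero S_add smult pure in \<open>simp_all add: FS_eq\<close>)
qed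

lemma supercomm_hom_fs_proj:
  assumes t: "t \<in> alg_hom FS (GY M N)" "\<And>g. g \<in> ygens M N \<Longrightarrow> t (fs_gen g) = X [g]"
    and f: "f \<in> carrier (FA M N)"
  shows "t (fs_proj f) = gr_proj M N f"
proof -
  have w: "t (fs_word w) = X w" if "w \<in> lists (ygens M N)" for w
    using that
  proof (induction w rule: list.induct)
    case Nil
    then show ?case using alg_homD(4)[OF t(1)] by (simp add: fs_word_simps gr_one free_algebra_simps)
  next
    case (Cons g w)
    then have g: "g \<in> ygens M N" "w \<in> lists (ygens M N)" by auto
    then show ?case
      using Cons.IH gr_word_append[of "[g]" M N w] t(2)
      by (simp add: fs_word_simps alg_homD(2)[OF t(1)] fs_gen_closed fs_word_closed)
  qed
  have h: "(\<lambda>f. t (fs_proj f)) \<in> alg_hom (monoid_algebra \<lparr>carrier = lists (ygens M N), mult = (@), one = []\<rparr>) (GY M N)"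
    using alg_hom_comp[OF fs_proj_hom(1) t(1)] by (simp add: free_algebra_def)
  have k: "gr_proj M N \<in> alg_hom (monoid_algebra \<lparr>carrier = lists (ygens M N), mult = (@), one = []\<rparr>) (GY M N)"
    using gr_alg(2) by (simp add: free_algebra_def)
  show ?thesis
  proof (rule alg_hom_eqI[OF monoid_free gr_alg(1) h k])
    fix v assume "v \<in> carrier \<lparr>carrier = lists (ygens M N), mult = (@), one = []\<rparr>"
    then have v: "v \<in> lists (ygens M N)" by simp
    then show "t (fs_proj (Poly_Mapping.single v 1)) = X v"
      using fs_proj_hom(2)[OF v, of 1] fs_word_closed[OF v] w[OF v] by simp
  next
    show "f \<in> carrier (monoid_algebra \<lparr>carrier = lists (ygens M N), mult = (@), one = []\<rparr>)"
      using f by (simp add: free_algebra_def)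
  qed
qed

text \<open>The spanning property is transported from \<open>FS\<close>. Only symbols are compared:
  in the Yangian, each homogeneous part of \<open>f\<close> may differ from that of \<open>n\<close>
  by terms of smaller degree.\<close>

lemma gr_normal_onto:
  assumes "f \<in> carrier (FA M N)"
  obtains n where "n \<in> normal_span" "gr_proj M N f = gr_proj M N n"
proof -
  obtain t where t: "t \<in> alg_hom FS (GY M N)" "\<And>g. g \<in> ygens M N \<Longrightarrow> t (fs_gen g) = X [g]"
    using supercomm_hom by blast
  have "fs_proj f \<in> carrier FS" using alg_homD(1)[OF fs_proj_hom(1) assms] .
  then obtain n where "n \<in> normal_span" "fs_proj f = fs_proj n" using fs_normal_onto by blast
  then show thesis
    using that supercomm_hom_fs_proj[OF t assms] supercomm_hom_fs_proj[OF t, of n] normal_span_closed(6) by metis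
qed

text \<open>The symbol of \<open>f\<close> is that of a normal combination, and one descends on the degree.\<close>

lemma straighten:
  assumes "f \<in> carrier (FA M N)" "deg_lt d f"
  shows "\<exists>n\<in>normal_span. deg_lt d n \<and> f - n \<in> YI M N"
  using assms
proof (induction d arbitrary: f)
  case 0
  then have "f = 0" by (auto simp: deg_lt_def)
  moreover have "0 \<in> YI M N"
    using additive_subgroup.zero_closed[OF ideal.axioms(1)[OF yangian_ideal]] by (simp add: free_algebra_simps)
  ultimately show ?case using normal_span_closed(1) deg_bounds(1) by (intro bexI[of _ 0]) simp_all
next
  case (Suc d)
  have dle: "deg_le d f" using Suc.prems(2) by (auto simp: deg_le_def deg_lt_def)
  obtain n where n: "n \<in> normal_span" "gr_proj M N f = gr_proj M N n"
    using gr_normal_onto[OF Suc.prems(1)] by blast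
  have nc: "n \<in> carrier (FA M N)" using n(1) by (rule normal_span_closed(6))
  have "deg_part d (f - n) \<in> below_pre M N d"
    using n(2) gr_proj_eq_iff[OF Suc.prems(1) nc] by blast
  then obtain b where b: "b \<in> carrier (FA M N)" "deg_lt d b" "deg_part d (f - n) - b \<in> YI M N"
    unfolding below_pre_iff by blast
  \<comment> \<open>The remainder of smaller degree: the lower terms of \<open>f\<close>, together
    with \<open>b\<close>, which is congruent to the difference of the top parts of \<open>f\<close>
    and \<open>n\<close>.\<close>
  let ?y = "(f - deg_part d f) + b"
  have "?y \<in> carrier (FA M N)" "deg_lt d ?y"
    using Suc.prems(1) b deg_le_minus_part[OF dle] by (auto intro: FA_add_closed FA_diff_closed FA_filter_closed deg_bounds(2))
  from Suc.IH[OF this] obtain n' where n': "n' \<in> normal_span" "deg_lt d n'" "?y - n' \<in> YI M N" by blast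
  have "(deg_part d (f - n) - b) + (?y - n') \<in> YI M N"
    using additive_subgroup.a_closed[OF ideal.axioms(1)[OF yangian_ideal] b(3) n'(3)] by (simp add: free_algebra_simps)
  then have "f - (deg_part d n + n') \<in> YI M N"
    by (simp add: pm_filter_simps algebra_simps)
  moreover have "deg_lt (Suc d) (deg_part d n + n')"
    using n'(2) by (intro deg_bounds(2)) (auto simp: deg_lt_def keys_pm_filter)
  moreover have "deg_part d n + n' \<in> normal_span"
    using n(1) n'(1) by (intro normal_span_closed)
  ultimately show ?case by blast
qed

text \<open>Here independence in the Yangian becomes independence in the graded algebra. A
  homogeneous part of \<open>n\<close> with zero symbol is congruent to some \<open>b\<close> of
  smaller degree, and \<open>straighten\<close> rewrites \<open>b\<close> in normal words without
  raising the degree. The difference is a normal combination in the ideal, hence zero, so the part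
  of degree \<open>d\<close> has degree below \<open>d\<close> and vanishes.\<close>

lemma normal_gr_zero:
  assumes n: "n \<in> normal_span" and z: "gr_proj M N n = gr_proj M N 0"
  shows "n = 0"
proof -
  have nc: "n \<in> carrier (FA M N)" using n by (rule normal_span_closed(6))
  have part: "deg_part d n = 0" for d
  proof -
    have "deg_part d n \<in> below_pre M N d"
      using z gr_proj_eq_iff[OF nc FA_zero_closed] by simp
    then obtain b where b: "b \<in> carrier (FA M N)" "deg_lt d b" "deg_part d n - b \<in> YI M N"
      unfolding below_pre_iff by blast
    obtain n' where n': "n' \<in> normal_span" "deg_lt d n'" "b - n' \<in> YI M N"
      using straighten[OF b(1,2)] by blast
    have "(deg_part d n - b) + (b - n') \<in> YI M N"
      using additive_subgroup.a_closed[OF ideal.axioms(1)[OF yangian_ideal] b(3) n'(3)] by (simp add: free_algebra_simps)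
    then have i: "deg_part d n - n' \<in> YI M N" by simp
    have "deg_part d n - n' \<in> normal_span"
      using n n'(1) by (intro normal_span_closed(3,5))
    then have "deg_part d n - n' = 0"
      using i by (intro normal_ideal_zero[of _ M N]) (auto simp: normal_span_def)
    then have "deg_part d n = n'" by simp
    then have lt: "deg_lt d (deg_part d n)" using n'(2) by simp
    then show ?thesis
      by (auto simp: deg_lt_def keys_pm_filter intro!: pm_filter_none)
  qed
  show ?thesis
  proof (rule poly_mapping_eqI)
    fix w
    have "Poly_Mapping.lookup (deg_part (wdeg w) n) w = 0" unfolding part by simp
    then show "Poly_Mapping.lookup n w = Poly_Mapping.lookup 0 w" by (simp add: lookup_pm_filter)
  qed
qed

lemma freely_generated_gr_yangian:
  "freely_generated_supercomm (GY M N) (gr_yangian_parity M N) (ygens M N) (gen_parity M) (X_gen M N)"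
  unfolding freely_generated_supercomm_def
proof (intro conjI ballI gr_supercommutative)
  fix g assume g: "g \<in> ygens M N"
  show "gen_parity M g < 2" by (rule gen_parity_less)
  have "homog M (gen_parity M g) (free_gen g)"
    using gen_parity_less[of g] by (simp add: homog_def free_gen_def)
  then show "X_gen M N g \<in> gr_yangian_parity M N (gen_parity M g)"
    unfolding gr_parity_eq[OF gen_parity_less] X_gen_eq[OF g] using free_gen_carrier[OF g] by blast
next
  obtain t where t: "t \<in> alg_hom FS (GY M N)" "\<And>g. g \<in> ygens M N \<Longrightarrow> t (fs_gen g) = X [g]"
    using supercomm_hom by blast
  note tp = supercomm_hom_fs_proj[OF t]
  \<comment> \<open>Elements of \<open>FS\<close> have normal representatives, and \<open>t\<close>
    sends these to their symbols, so injectivity reduces to \<open>normal_gr_zero\<close>.\<close>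
  have inj: "inj_on t (carrier FS)"
  proof (rule inj_onI)
    fix x y assume x: "x \<in> carrier FS" and y: "y \<in> carrier FS" and eq: "t x = t y"
    obtain f g where f: "f \<in> normal_span" "x = fs_proj f" and g: "g \<in> normal_span" "y = fs_proj g"
      using x y fs_normal_onto by blast
    have c: "f \<in> carrier (FA M N)" "g \<in> carrier (FA M N)" using f g normal_span_closed(6) by blast+
    have "gr_proj M N f = gr_proj M N g" using eq f g tp c by metis
    then have "gr_proj M N (f - g) = gr_proj M N 0"
      using c by (simp add: gr_proj_eq_iff FA_diff_closed FA_zero_closed)
    then have "f - g = 0" by (intro normal_gr_zero normal_span_closed(3) f g)
    then show "x = y" using f g by simp
  qed
  have surj: "t ` carrier FS = carrier (GY M N)"
  proof (intro equalityI subsetI)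
    fix a assume "a \<in> t ` carrier FS"
    then show "a \<in> carrier (GY M N)" using alg_homD(1)[OF t(1)] by blast
  next
    fix a assume "a \<in> carrier (GY M N)"
    then obtain f where f: "f \<in> carrier (FA M N)" "a = gr_proj M N f" using gr_carrier by blast
    then have "a = t (fs_proj f)" using tp by simp
    then show "a \<in> t ` carrier FS" using alg_homD(1)[OF fs_proj_hom(1) f(1)] by blast
  qed
  have "t \<in> algebra_iso FS (GY M N)"
    using t(1) inj surj unfolding algebra_iso_def ring_iso_def alg_hom_def bij_betw_def by blast
  moreover have "t (fs_gen g) = X_gen M N g" if "g \<in> ygens M N" for g
    using t(2)[OF that] X_gen_eq[OF that] by (simp add: free_gen_def)
  ultimately show "\<exists>h\<in>algebra_iso FS (GY M N). \<forall>g\<in>ygens M N. h (fs_gen g) = X_gen M N g"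
    by blast
qed

end

theorem corollary1p9:
  fixes M N :: nat
  assumes "M \<noteq> 0 \<or> N \<noteq> 0"
  shows "freely_generated_supercomm (gr_yangian M N) (gr_yangian_parity M N)
           (ygens M N) (gen_parity M) (X_gen M N)"
  by (rule freely_generated_gr_yangian)

end
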